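(* Let $n\geq 4$. Then $Aut(F_n)$ is generated by $W_n$ together with $\eta$, and the following is a presentation of $Aut(F_n)$: the generators are the elements of $W_n$ together with one additional symbol $\eta$, and the defining relations are \begin{enumerate} \item $\eta^2=1$; \item $(\sigma_{12}\eta)^3=1$; \item $(\eta\tau_i)^2=1$ for all $i>2$; \item $(\eta\sigma_{ij})^2=1$ for all $i,j>2$ (with $i\neq j$); \item $((\eta\tau_1)^2\tau_2)^2=1$; \item $(\eta\sigma_{13}\tau_2\eta\sigma_{12})^4=1$; \item $\sigma_{12}\eta\sigma_{13}\tau_2\eta\sigma_{12}(\sigma_{23}\eta\sigma_{13}\tau_2\eta)^2=1$; \item $(\sigma_{14}\sigma_{23}\eta)^4=1$; \item all relations holding in $W_n$ (e.g. the multiplication table of $W_n$, or any presentation of $W_n$). \end{enumerate} That is, the homomorphism from the abstract group with these generators and relations to $Aut(F_n)$, sending each element of $W_n$ to itself and $\eta$ to the automorphism $\eta$, is an isomorphism.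
   Context: $F_n$ is the free group on fixed generators $a_1,\ldots,a_n$, and $Aut(F_n)$ is its automorphism group, with group product given by composition of automorphisms. $W_n\leq Aut(F_n)$ is the subgroup of automorphisms that permute the generators and possibly invert some of them (the signed permutations of $\{a_1,\dots,a_n\}$). For $1\le i\le n$, $\tau_i\in W_n$ is the automorphism with $a_i\mapsto a_i^{-1}$ and $a_j\mapsto a_j$ for $j\neq i$. For $i\neq j$, $\sigma_{ij}\in W_n$ is the automorphism with $a_i\mapsto a_j$, $a_j\mapsto a_i$, $a_k\mapsto a_k$ for $k\neq i,j$. The automorphism $\eta$ (an involution) is defined by $a_1\mapsto a_2^{-1}a_1$, $a_2\mapsto a_2^{-1}$, and $a_k\mapsto a_k$ for $k>2$. *)

theory Defs
  imports "HOL-Algebra.Algebra"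
begin

text \<open>A letter is a pair (x, b); b = False means the generator x, b = True means x inverse.\<close>

type_synonym 'a word = "('a \<times> bool) list"

definition inv_letter :: "'a \<times> bool \<Rightarrow> 'a \<times> bool" where
  "inv_letter l = (fst l, \<not> snd l)"

fun reduced :: "'a word \<Rightarrow> bool" where
  "reduced (a # b # rest) = (b \<noteq> inv_letter a \<and> reduced (b # rest))"
| "reduced _ = True"

definition ins_letter :: "'a \<times> bool \<Rightarrow> 'a word \<Rightarrow> 'a word" where
  "ins_letter l ys = (case ys of [] \<Rightarrow> [l]
       | y # ys' \<Rightarrow> (if y = inv_letter l then ys' else l # ys))"

definition norm :: "'a word \<Rightarrow> 'a word" where
  "norm w = foldr ins_letter w []"

definition inv_word :: "'a word \<Rightarrow> 'a word" where
  "inv_word w = rev (map inv_letter w)"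

definition free_grp :: "'a set \<Rightarrow> 'a word monoid" where
  "free_grp S = \<lparr>carrier = {w. set w \<subseteq> S \<times> UNIV \<and> reduced w},
                 monoid.mult = (\<lambda>u v. norm (u @ v)), one = []\<rparr>"

definition Fn :: "nat \<Rightarrow> nat word monoid" where
  "Fn n = free_grp {1..n}"

definition gen :: "nat \<Rightarrow> nat word" where
  "gen i = [(i, False)]"

text \<open>Aut(F_n), with product g \<otimes> f = g \<circ> f (composition).\<close>
abbreviation AutF :: "nat \<Rightarrow> (nat word \<Rightarrow> nat word) monoid" where
  "AutF n \<equiv> AutoGroup (Fn n)"

definition subst_hom :: "nat \<Rightarrow> (nat \<Rightarrow> nat word) \<Rightarrow> nat word \<Rightarrow> nat word" where
  "subst_hom n f = (\<lambda>w \<in> carrier (Fn n).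
      norm (concat (map (\<lambda>(i, b). if b then inv_word (f i) else f i) w)))"

definition tau :: "nat \<Rightarrow> nat \<Rightarrow> nat word \<Rightarrow> nat word" where
  "tau n i = subst_hom n (\<lambda>k. if k = i then [(i, True)] else gen k)"

definition sigma :: "nat \<Rightarrow> nat \<Rightarrow> nat \<Rightarrow> nat word \<Rightarrow> nat word" where
  "sigma n i j = subst_hom n (\<lambda>k. if k = i then gen j else if k = j then gen i else gen k)"

definition eta :: "nat \<Rightarrow> nat word \<Rightarrow> nat word" where
  "eta n = subst_hom n (\<lambda>k. if k = 1 then [(2, True), (1, False)]
                           else if k = 2 then [(2, True)] else gen k)"

definition W :: "nat \<Rightarrow> (nat word \<Rightarrow> nat word) set" where
  "W n = {\<alpha> \<in> carrier (AutF n). \<exists>\<pi> \<epsilon>. bij_betw \<pi> {1..n} {1..n} \<and>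
            (\<forall>i \<in> {1..n}. \<alpha> (gen i) = [(\<pi> i, \<epsilon> i)])}"

text \<open>Abstract generators: Some w for w in W_n, and None for the extra symbol eta.\<close>
type_synonym gsym = "(nat word \<Rightarrow> nat word) option"

definition Gens :: "nat \<Rightarrow> gsym set" where
  "Gens n = Some ` W n \<union> {None}"

definition FG :: "nat \<Rightarrow> gsym word monoid" where
  "FG n = free_grp (Gens n)"

definition gval :: "nat \<Rightarrow> gsym \<Rightarrow> nat word \<Rightarrow> nat word" where
  "gval n g = (case g of Some a \<Rightarrow> a | None \<Rightarrow> eta n)"

definition evalP :: "nat \<Rightarrow> gsym word \<Rightarrow> nat word \<Rightarrow> nat word" where
  "evalP n w = foldr (\<lambda>(g, b) acc.
       (if b then inv\<^bsub>AutF n\<^esub> (gval n g) else gval n g) \<otimes>\<^bsub>AutF n\<^esub> acc) w \<one>\<^bsub>AutF n\<^esub>"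

definition pw :: "gsym list \<Rightarrow> gsym word" where
  "pw gs = norm (map (\<lambda>g. (g, False)) gs)"

definition ppow :: "gsym list \<Rightarrow> nat \<Rightarrow> gsym word" where
  "ppow gs k = pw (concat (replicate k gs))"

definition Rel :: "nat \<Rightarrow> gsym word set" where
  "Rel n =
     {pw [None, None]}
   \<union> {ppow [Some (sigma n 1 2), None] 3}
   \<union> {ppow [None, Some (tau n i)] 2 | i. 2 < i \<and> i \<le> n}
   \<union> {ppow [None, Some (sigma n i j)] 2 | i j. 2 < i \<and> i \<le> n \<and> 2 < j \<and> j \<le> n \<and> i \<noteq> j}
   \<union> {ppow (concat (replicate 2 [None, Some (tau n 1)]) @ [Some (tau n 2)]) 2}
   \<union> {ppow [None, Some (sigma n 1 3), Some (tau n 2), None, Some (sigma n 1 2)] 4}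
   \<union> {pw ([Some (sigma n 1 2), None, Some (sigma n 1 3), Some (tau n 2), None, Some (sigma n 1 2)]
          @ concat (replicate 2 [Some (sigma n 2 3), None, Some (sigma n 1 3), Some (tau n 2), None]))}
   \<union> {ppow [Some (sigma n 1 4), Some (sigma n 2 3), None] 4}
   \<union> {w \<in> carrier (FG n). set w \<subseteq> Some ` W n \<times> UNIV \<and> evalP n w = \<one>\<^bsub>AutF n\<^esub>}"

definition normal_closure :: "('a, 'b) monoid_scheme \<Rightarrow> 'a set \<Rightarrow> 'a set" where
  "normal_closure G R = generate G (\<Union>g \<in> carrier G. (\<lambda>r. g \<otimes>\<^bsub>G\<^esub> r \<otimes>\<^bsub>G\<^esub> inv\<^bsub>G\<^esub> g) ` R)"

definition Pres :: "nat \<Rightarrow> gsym word set monoid" where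
  "Pres n = FG n Mod normal_closure (FG n) (Rel n)"

definition pres_map :: "nat \<Rightarrow> gsym word set \<Rightarrow> nat word \<Rightarrow> nat word" where
  "pres_map n C = evalP n (SOME w. w \<in> C)"

end

theory Submission
  imports Defs
begin

text \<open>The proof is peak reduction in the style of Whitehead, Higgins--Lyndon and McCool. In the presented
  group, the product of \<open>\<eta>\<close> with the inversion of the second generator is a transvection;
  its conjugates \<open>E x y\<close> by signed permutations satisfy Steinberg-type relations, and products of
  them with a common multiplier are lifts of the Whitehead automorphisms \<open>(A, a)\<close>. An element \<open>v\<close> of
  the presented group is measured by the total length of the images of the generators under the
  automorphism it represents. The change of this length under a Whitehead automorphism is a cut
  capacity minus a degree in the Whitehead graph, and submodularity of the cut shows that any
  peak can be bypassed by relations of the presented group. Hence every element is reached from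
  the signed permutations by length increasing moves; an element representing the identity has minimal
  length, so it is a signed permutation and trivial. Surjectivity holds because a basis that is not a
  signed permutation of the standard one has a cut letter, found in the last graph
  with two vertices of a Stallings folding sequence.\<close>

section \<open>Words and free groups\<close>

text \<open>The defining relations speak of the indices 1 to 4 only, whereas peak reduction needs
  relations between Whitehead moves with arbitrary sets. The bridge is conjugation by signed
  permutations: relations 3 and 4 make the stabilizer of a_1 and a_2 commute with \<eta>\<tau>_2, so
  a transvection depends only on its pair of letters. Bypassing a peak requires that the two length
  changes around a square add up. This holds for nested or disjoint sets, because the capacity of
  the second set is carried through the first move; other pairs of sets are therefore treated
  through one of the four sets they cut out. Peak reduction relates elements that already lie in the
  presented group, so it yields injectivity and says nothing about automorphisms that are not known
  to be products of the generators. For these a shortening move has to be found from the basis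
  alone.\<close>

lemma inv_letter_inv [simp]: "inv_letter (inv_letter l) = l"
  by (simp add: inv_letter_def)

lemma inv_letter_neq [simp]: "inv_letter l \<noteq> l" "l \<noteq> inv_letter l"
  by (auto simp: inv_letter_def prod_eq_iff)

lemma inv_letter_inject [simp]: "inv_letter a = inv_letter b \<longleftrightarrow> a = b"
  by (metis inv_letter_inv)

lemma inv_letter_eq_swap: "inv_letter a = b \<longleftrightarrow> a = inv_letter b"
  by (metis inv_letter_inv)

lemma fst_inv_letter [simp]: "fst (inv_letter a) = fst a"
  by (simp add: inv_letter_def)

lemma inv_letter_Pair [simp]: "inv_letter (x, b) = (x, \<not> b)"
  by (simp add: inv_letter_def)

lemma fst_eq_letter: "fst a = fst b \<longleftrightarrow> a = b \<or> a = inv_letter b"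
  by (cases a; cases b) auto

lemma reduced_Cons: "reduced (a # w) \<longleftrightarrow> reduced w \<and> (w \<noteq> [] \<longrightarrow> hd w \<noteq> inv_letter a)"
  by (cases w) auto

lemma reduced_ins: "reduced w \<Longrightarrow> reduced (ins_letter l w)"
  by (auto simp: ins_letter_def reduced_Cons split: list.split)

lemma reduced_foldr_ins: "reduced v \<Longrightarrow> reduced (foldr ins_letter u v)"
  by (induction u) (auto simp: reduced_ins)

lemma reduced_norm [simp]: "reduced (norm w)"
  by (simp add: norm_def reduced_foldr_ins)

lemma norm_reduced [simp]: "reduced w \<Longrightarrow> norm w = w"
  by (induction w) (auto simp: norm_def ins_letter_def reduced_Cons split: list.split)

lemma norm_Nil [simp]: "norm [] = []"
  by (simp add: norm_def)

lemma norm_Cons: "norm (a # w) = ins_letter a (norm w)"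
  by (simp add: norm_def)

lemma norm_append: "norm (u @ v) = foldr ins_letter u (norm v)"
  by (simp add: norm_def)

lemma ins_ins_inv: "reduced w \<Longrightarrow> ins_letter l (ins_letter (inv_letter l) w) = w"
  by (auto simp: ins_letter_def reduced_Cons split: list.split)

text \<open>Van der Waerden's argument: a letter acts on reduced words as a bijection whose inverse
  is the action of the inverse letter, so removing a cancelling pair from a word does not change its
  action. This is what makes \<open>norm\<close> compatible with concatenation.\<close>

lemma foldr_ins_ins: "reduced z \<Longrightarrow> foldr ins_letter (ins_letter l w) z = ins_letter l (foldr ins_letter w z)"
proof (cases "\<exists>w'. w = inv_letter l # w'")
  case True
  assume "reduced z"
  with True show ?thesis
    by (auto simp: ins_letter_def[of l "inv_letter l # _"] ins_ins_inv reduced_foldr_ins)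
next
  case False
  then have "ins_letter l w = l # w" by (auto simp: ins_letter_def split: list.split)
  then show ?thesis by simp
qed

lemma foldr_ins_norm: "reduced z \<Longrightarrow> foldr ins_letter (norm u) z = foldr ins_letter u z"
  by (induction u) (auto simp: norm_Cons foldr_ins_ins)

lemma norm_append_norm_left [simp]: "norm (norm u @ v) = norm (u @ v)"
  by (simp add: norm_append foldr_ins_norm)

lemma norm_append_norm_right [simp]: "norm (u @ norm v) = norm (u @ v)"
  by (simp add: norm_append)

lemma norm_Cons_norm [simp]: "norm (a # norm v) = norm (a # v)"
  by (simp add: norm_Cons)

lemma norm_cong_append: "norm u = norm u' \<Longrightarrow> norm v = norm v' \<Longrightarrow> norm (u @ v) = norm (u' @ v')"
  by (metis norm_append_norm_left norm_append_norm_right)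

lemma norm_cancel [simp]: "norm (l # inv_letter l # w) = norm w"
  by (simp add: norm_Cons ins_ins_inv)

lemma norm_cancel' [simp]: "norm (inv_letter l # l # w) = norm w"
  using norm_cancel[of "inv_letter l" w] by simp

lemma norm_cancel_mid [simp]: "norm (u @ l # inv_letter l # w) = norm (u @ w)"
  by (metis norm_append_norm_right norm_cancel)

lemma inv_word_Nil [simp]: "inv_word [] = []"
  by (simp add: inv_word_def)

lemma inv_word_Cons: "inv_word (a # w) = inv_word w @ [inv_letter a]"
  by (simp add: inv_word_def)

lemma inv_word_append: "inv_word (u @ v) = inv_word v @ inv_word u"
  by (simp add: inv_word_def)

lemma inv_word_inv [simp]: "inv_word (inv_word w) = w"
  by (simp add: inv_word_def rev_map comp_def)

lemma norm_inv_right: "norm (w @ inv_word w @ v) = norm v"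
proof (induction w arbitrary: v)
  case (Cons a w)
  have "norm ((a # w) @ inv_word (a # w) @ v) = norm (a # norm (w @ inv_word w @ ([inv_letter a] @ v)))"
    by (simp only: inv_word_Cons append_assoc norm_Cons_norm append_Cons)
  then show ?case unfolding Cons.IH[of "[inv_letter a] @ v"] by simp
qed simp

lemma norm_inv_right' [simp]: "norm (w @ inv_word w) = []"
  using norm_inv_right[of w "[]"] by simp

lemma norm_inv_left: "norm (inv_word w @ w @ v) = norm v"
  using norm_inv_right[of "inv_word w" v] by simp

lemma norm_inv_left' [simp]: "norm (inv_word w @ w) = []"
  using norm_inv_left[of w "[]"] by simp

lemma norm_inv_word_cong: "norm u = norm v \<Longrightarrow> norm (inv_word u) = norm (inv_word v)"
proof -
  assume a: "norm u = norm v"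
  have "norm (inv_word u) = norm (inv_word u @ (v @ inv_word v))"
    by (metis append.right_neutral norm_append_norm_right norm_inv_right')
  also have "\<dots> = norm ((inv_word u @ u) @ inv_word v)"
    by (metis a append_assoc norm_cong_append)
  also have "\<dots> = norm (inv_word v)" using norm_inv_left[of u "inv_word v"] by simp
  finally show ?thesis .
qed

lemma reduced_append: "reduced (u @ v) \<longleftrightarrow>
    reduced u \<and> reduced v \<and> (u \<noteq> [] \<longrightarrow> v \<noteq> [] \<longrightarrow> hd v \<noteq> inv_letter (last u))"
  by (induction u) (auto simp: reduced_Cons)

lemma reduced_inv_word [simp]: "reduced w \<Longrightarrow> reduced (inv_word w)"
proof (induction w)
  case (Cons a w)
  then have *: "reduced (inv_word w)" "w \<noteq> [] \<Longrightarrow> hd w \<noteq> inv_letter a" by (auto simp: reduced_Cons)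
  have "last (inv_word w) = inv_letter (hd w)" if "w \<noteq> []"
    using that by (simp add: inv_word_def last_rev hd_map)
  with * show ?case
    by (auto simp: inv_word_Cons reduced_append inv_word_def)
qed simp

lemma inv_word_norm: "inv_word (norm w) = norm (inv_word w)"
  by (metis norm_inv_word_cong norm_reduced reduced_inv_word reduced_norm)

lemma set_ins: "set (ins_letter l w) \<subseteq> insert l (set w)"
  by (auto simp: ins_letter_def split: list.splits if_splits)

lemma set_norm: "set (norm w) \<subseteq> set w"
  by (induction w) (use set_ins in \<open>fastforce simp: norm_Cons\<close>)+

lemma set_inv_word: "set (inv_word w) \<subseteq> S \<times> UNIV \<longleftrightarrow> set w \<subseteq> S \<times> UNIV"
  by (auto simp: inv_word_def inv_letter_def image_subset_iff)

lemma free_grp_group: "group (free_grp S)"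
proof (rule groupI)
  fix x y z assume "x \<in> carrier (free_grp S)" "y \<in> carrier (free_grp S)" "z \<in> carrier (free_grp S)"
  then show "x \<otimes>\<^bsub>free_grp S\<^esub> y \<in> carrier (free_grp S)"
    using set_norm[of "x @ y"] by (auto simp: free_grp_def)
  show "x \<otimes>\<^bsub>free_grp S\<^esub> y \<otimes>\<^bsub>free_grp S\<^esub> z = x \<otimes>\<^bsub>free_grp S\<^esub> (y \<otimes>\<^bsub>free_grp S\<^esub> z)"
    by (simp add: free_grp_def)
next
  fix x assume "x \<in> carrier (free_grp S)"
  then show "\<exists>y\<in>carrier (free_grp S). y \<otimes>\<^bsub>free_grp S\<^esub> x = \<one>\<^bsub>free_grp S\<^esub>"
    by (intro bexI[of _ "inv_word x"]) (auto simp: free_grp_def set_inv_word)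
qed (auto simp: free_grp_def)

lemma free_grp_simps:
  "carrier (free_grp S) = {w. set w \<subseteq> S \<times> UNIV \<and> reduced w}"
  "x \<otimes>\<^bsub>free_grp S\<^esub> y = norm (x @ y)"
  "\<one>\<^bsub>free_grp S\<^esub> = []"
  by (simp_all add: free_grp_def)

lemma norm_in_free_grp: "set w \<subseteq> S \<times> UNIV \<Longrightarrow> norm w \<in> carrier (free_grp S)"
  using set_norm[of w] by (auto simp: free_grp_simps)

section \<open>Homomorphisms of free groups given by substitution into letters\<close>

definition wsubst :: "('a \<times> bool \<Rightarrow> 'b word) \<Rightarrow> 'a word \<Rightarrow> 'b word" where
  "wsubst f w = norm (concat (map f w))"

definition inv_compat :: "('a \<times> bool \<Rightarrow> 'b word) \<Rightarrow> bool" where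
  "inv_compat f \<longleftrightarrow> (\<forall>l. f (inv_letter l) = inv_word (f l))"

lemma wsubst_Nil [simp]: "wsubst f [] = []"
  by (simp add: wsubst_def)

lemma wsubst_Cons: "wsubst f (l # w) = norm (f l @ wsubst f w)"
  by (simp add: wsubst_def)

lemma wsubst_append: "wsubst f (u @ v) = norm (wsubst f u @ wsubst f v)"
  by (simp add: wsubst_def)

lemma reduced_wsubst [simp]: "reduced (wsubst f w)"
  by (simp add: wsubst_def)

lemma wsubst_ins:
  assumes "inv_compat f" shows "wsubst f (ins_letter l w) = norm (f l @ wsubst f w)"
proof (cases "\<exists>w'. w = inv_letter l # w'")
  case True
  then obtain w' where w: "w = inv_letter l # w'" by blast
  have "norm (f l @ wsubst f w) = norm (f l @ inv_word (f l) @ wsubst f w')"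
    using assms by (simp add: w wsubst_Cons inv_compat_def del: split_paired_All)
  then show ?thesis by (simp add: norm_inv_right w ins_letter_def wsubst_def)
next
  case False
  then have "ins_letter l w = l # w" by (auto simp: ins_letter_def split: list.split)
  then show ?thesis by (simp add: wsubst_Cons)
qed

lemma wsubst_norm [simp]:
  assumes "inv_compat f" shows "wsubst f (norm w) = wsubst f w"
  by (induction w) (simp_all add: norm_Cons wsubst_ins assms wsubst_Cons)

lemma wsubst_wsubst:
  assumes "inv_compat f" shows "wsubst f (wsubst g w) = wsubst (\<lambda>l. wsubst f (g l)) w"
proof (induction w)
  case (Cons l w)
  then show ?case by (simp add: wsubst_Cons wsubst_append assms)
qed simp

lemma wsubst_id: "reduced w \<Longrightarrow> (\<And>l. l \<in> set w \<Longrightarrow> f l = [l]) \<Longrightarrow> wsubst f w = w"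
proof -
  assume r: "reduced w" and "\<And>l. l \<in> set w \<Longrightarrow> f l = [l]"
  then have "concat (map f w) = w" by (induction w) (auto simp: reduced_Cons)
  then show ?thesis using r by (simp add: wsubst_def)
qed

lemma wsubst_cong: "(\<And>l. l \<in> set w \<Longrightarrow> f l = g l) \<Longrightarrow> wsubst f w = wsubst g w"
  by (simp add: wsubst_def cong: map_cong)

section \<open>Signed permutations and the relations of the presentation\<close>

declare split_paired_All [simp del] split_paired_Ex [simp del]

definition letters :: "nat \<Rightarrow> (nat \<times> bool) set" where
  "letters n = {1..n} \<times> UNIV"

lemma inv_letter_letters [simp]: "inv_letter l \<in> letters n \<longleftrightarrow> l \<in> letters n"
  by (cases l) (auto simp: letters_def)

lemma finite_letters [simp]: "finite (letters n)"
  by (simp add: letters_def)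

text \<open>W_n acts on letters by bijections that commute with inversion. Fixing all letters
  outside the rank makes them total functions, so composition and \<open>pinv\<close> need no domain
  conditions.\<close>

definition SP :: "nat \<Rightarrow> (nat \<times> bool \<Rightarrow> nat \<times> bool) set" where
  "SP n = {f. bij f \<and> (\<forall>l. f (inv_letter l) = inv_letter (f l)) \<and> (\<forall>l. l \<notin> letters n \<longrightarrow> f l = l)}"

abbreviation pinv :: "('a \<Rightarrow> 'a) \<Rightarrow> 'a \<Rightarrow> 'a" where
  "pinv f \<equiv> inv_into UNIV f"

text \<open>Both kinds of generators of W_n in one formula: for letters of different index it is a
  transposition with signs, and for \<open>y\<close> the inverse of \<open>x\<close> it is a sign
  change.\<close>

definition sw :: "nat \<times> bool \<Rightarrow> nat \<times> bool \<Rightarrow> nat \<times> bool \<Rightarrow> nat \<times> bool" where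
  "sw x y l = (if l = x then y else if l = inv_letter x then inv_letter y
     else if l = y then x else if l = inv_letter y then inv_letter x else l)"

lemma sw_sw [simp]: "sw x y (sw x y l) = l"
  by (auto simp: sw_def inv_letter_eq_swap)

lemma sw_comp_sw: "sw x y \<circ> sw x y = id"
  by (auto simp: fun_eq_iff)

lemma sw_inv: "sw x y (inv_letter l) = inv_letter (sw x y l)"
  by (auto simp: sw_def inv_letter_eq_swap)

lemma sw_left [simp]: "sw x y x = y"
  by (simp add: sw_def)

lemma sw_other: "fst l \<noteq> fst x \<Longrightarrow> fst l \<noteq> fst y \<Longrightarrow> sw x y l = l"
  by (auto simp: sw_def)

lemma sw_SP: "x \<in> letters n \<Longrightarrow> y \<in> letters n \<Longrightarrow> sw x y \<in> SP n"
proof -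
  assume a: "x \<in> letters n" "y \<in> letters n"
  have "bij (sw x y)" by (rule o_bij[OF sw_comp_sw sw_comp_sw])
  moreover have "sw x y l = l" if "l \<notin> letters n" for l
    using a that by (simp add: sw_def) (metis inv_letter_letters)
  ultimately show ?thesis by (simp add: SP_def sw_inv)
qed

lemma SP_bij: "f \<in> SP n \<Longrightarrow> bij f"
  and SP_inv: "f \<in> SP n \<Longrightarrow> f (inv_letter l) = inv_letter (f l)"
  and SP_out: "f \<in> SP n \<Longrightarrow> l \<notin> letters n \<Longrightarrow> f l = l"
  by (auto simp: SP_def)

lemma SP_eq_iff: "f \<in> SP n \<Longrightarrow> f x = f y \<longleftrightarrow> x = y"
  using SP_bij by (metis bij_pointE)

lemma SP_letters: "f \<in> SP n \<Longrightarrow> f l \<in> letters n \<longleftrightarrow> l \<in> letters n"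
  by (metis SP_eq_iff SP_out)

lemma SP_pair: "f \<in> SP n \<Longrightarrow> f (i, b) = c \<Longrightarrow> f (i, \<not> b) = inv_letter c"
  using SP_inv[of f n "(i, b)"] by simp

lemma SP_fst: "f \<in> SP n \<Longrightarrow> fst (f x) = fst (f y) \<longleftrightarrow> fst x = fst y"
  by (metis SP_eq_iff SP_inv fst_eq_letter)

lemma SP_sw: "f \<in> SP n \<Longrightarrow> f (sw a b l) = sw (f a) (f b) (f l)"
  by (simp add: sw_def SP_inv SP_eq_iff flip: SP_inv)

lemma SP_id: "id \<in> SP n"
  by (simp add: SP_def)

lemma SP_comp: "f \<in> SP n \<Longrightarrow> g \<in> SP n \<Longrightarrow> f \<circ> g \<in> SP n"
  by (simp add: SP_def bij_comp)

lemma SP_pinv: "f \<in> SP n \<Longrightarrow> pinv f \<in> SP n"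
proof -
  assume f: "f \<in> SP n"
  have b: "bij f" using f by (rule SP_bij)
  have "f (inv_letter (pinv f l)) = inv_letter l" for l
    using b by (simp add: SP_inv[OF f] bij_is_surj surj_f_inv_f)
  then have "pinv f (inv_letter l) = inv_letter (pinv f l)" for l
    using b by (metis bij_inv_eq_iff)
  moreover have "pinv f l = l" if "l \<notin> letters n" for l
    using SP_out[OF f that] b by (metis bij_inv_eq_iff)
  ultimately show ?thesis using b by (simp add: SP_def bij_imp_bij_inv)
qed

lemma SP_pinv_comp: "f \<in> SP n \<Longrightarrow> pinv f \<circ> f = id"  "f \<in> SP n \<Longrightarrow> f \<circ> pinv f = id"
  using SP_bij[of f n] by (simp_all add: bij_is_inj bij_is_surj flip: surj_iff)

lemma SP_pinv_app [simp]: "f \<in> SP n \<Longrightarrow> pinv f (f x) = x" "f \<in> SP n \<Longrightarrow> f (pinv f x) = x"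
  using SP_pinv_comp by (metis comp_apply id_apply)+

lemma SP_ext: "f \<in> SP n \<Longrightarrow> g \<in> SP n \<Longrightarrow> (\<And>i. i \<in> {1..n} \<Longrightarrow> f (i, False) = g (i, False)) \<Longrightarrow> f = g"
proof
  fix l :: "nat \<times> bool" assume a: "f \<in> SP n" "g \<in> SP n" "\<And>i. i \<in> {1..n} \<Longrightarrow> f (i, False) = g (i, False)"
  obtain i b where l: "l = (i, b)" by (cases l)
  show "f l = g l"
  proof (cases "i \<in> {1..n}")
    case True
    with a(3) have "f (i, False) = g (i, False)" by blast
    then show ?thesis
      using SP_inv[OF a(1), of "(i, False)"] SP_inv[OF a(2), of "(i, False)"] by (cases b) (auto simp: l)
  next
    case False
    with a(1,2) show ?thesis by (simp add: SP_def letters_def l)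
  qed
qed

text \<open>Letters are placed one at a time, each by a switch that does not touch the earlier
  values. The lemma serves to carry relations stated for small indices to arbitrary letters.\<close>

lemma SP_ex:
  "distinct (map fst xs) \<Longrightarrow> set xs \<subseteq> letters n \<Longrightarrow>
    \<exists>f\<in>SP n. \<forall>i<length xs. f (Suc i, False) = xs ! i"
proof (induction xs rule: rev_induct)
  case Nil
  then show ?case using SP_id by auto
next
  case (snoc x xs)
  then obtain f where f: "f \<in> SP n" "\<forall>i<length xs. f (Suc i, False) = xs ! i" by auto
  let ?y = "f (Suc (length xs), False)"
  \<comment> \<open>Distinct indices up to \<open>n\<close> leave room for one more, so
    \<open>?y\<close> has an index in range and the switch belongs to \<open>SP n\<close>.\<close>
  have "length xs < n"
  proof -
    have "card (fst ` set (xs @ [x])) \<le> card {1..n}"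
      using snoc.prems(2) by (intro card_mono) (auto simp: letters_def)
    moreover have "card (fst ` set (xs @ [x])) = length xs + 1"
      using snoc.prems(1) distinct_card[of "map fst (xs @ [x])"] by simp
    ultimately show ?thesis by simp
  qed
  then have y: "?y \<in> letters n" using f(1) SP_letters[OF f(1)] by (simp add: letters_def)
  have x: "x \<in> letters n" using snoc.prems(2) by simp
  have "sw ?y x \<circ> f \<in> SP n" using f(1) x y by (simp add: SP_comp sw_SP)
  moreover have "(sw ?y x \<circ> f) (Suc i, False) = (xs @ [x]) ! i" if "i < length (xs @ [x])" for i
  proof (cases "i = length xs")
    case False
    then have i: "i < length xs" using that by simp
    have "xs ! i \<in> set xs" using i by simp
    then have "fst (xs ! i) \<noteq> fst x" using snoc.prems(1) by (auto simp: image_iff)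
    moreover have "fst (xs ! i) \<noteq> fst ?y"
      using f i SP_fst[OF f(1), of "(Suc i, False)" "(Suc (length xs), False)"] by auto
    ultimately show ?thesis using i f(2) by (simp add: sw_other nth_append)
  qed simp
  ultimately show ?case by blast
qed

text \<open>Composing with one switch repairs a moved generator and disturbs no fixed one. Hence the
  stabilizer of the first two generators is generated by switches of letters with larger index, and
  relations 3 and 4 speak of such switches.\<close>

lemma SP_fix12_induct [consumes 3, case_names id sw]:
  assumes "f \<in> SP n" "f (1, False) = (1, False)" "f (2, False) = (2, False)"
    and "Q id"
    and "\<And>x y f. x \<in> letters n \<Longrightarrow> y \<in> letters n \<Longrightarrow> 2 < fst x \<Longrightarrow> 2 < fst y \<Longrightarrow> f \<in> SP n \<Longrightarrow>
           Q f \<Longrightarrow> Q (sw x y \<circ> f)"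
  shows "Q f"
  using assms(1-3)
proof (induction "card {i \<in> {1..n}. f (i, False) \<noteq> (i, False)}" arbitrary: f rule: less_induct)
  case less
  show ?case
  proof (cases "\<exists>i\<in>{1..n}. f (i, False) \<noteq> (i, False)")
    case False
    then have "f = id" using less.prems(1) by (intro SP_ext[of _ n]) (auto simp: SP_id)
    then show ?thesis using assms(4) by simp
  next
    case True
    then obtain i where i: "i \<in> {1..n}" "f (i, False) \<noteq> (i, False)" by blast
    let ?x = "(i, False)" and ?g = "sw (f (i, False)) (i, False) \<circ> f"
    have x: "?x \<in> letters n" using i by (simp add: letters_def)
    have fx: "f ?x \<in> letters n" using x less.prems(1) SP_letters by blast
    have i2: "2 < i" using i less.prems by (cases "i = 1"; cases "i = 2") auto
    have nfix: "fst (f ?x) \<noteq> k" if "f (k, False) = (k, False)" for k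
      using that i(2) SP_fst[OF less.prems(1), of "(k, False)" ?x] by auto
    have f2: "2 < fst (f ?x)"
      using nfix[of 1] nfix[of 2] less.prems fx by (cases "f ?x") (auto simp: letters_def)
    have gfix: "?g (k, False) = (k, False)" if "f (k, False) = (k, False)" for k
    proof (cases "k = i")
      case False
      then show ?thesis using that nfix[OF that] by (simp add: sw_other)
    qed (use that i in simp)
    have gi: "?g ?x = ?x" by simp
    have g: "?g \<in> SP n" using less.prems(1) x fx by (simp add: SP_comp sw_SP)
    have "card {i \<in> {1..n}. ?g (i, False) \<noteq> (i, False)} < card {i \<in> {1..n}. f (i, False) \<noteq> (i, False)}"
    proof (intro psubset_card_mono psubsetI)
      show "{i \<in> {1..n}. ?g (i, False) \<noteq> (i, False)} \<subseteq> {i \<in> {1..n}. f (i, False) \<noteq> (i, False)}"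
        using gfix by blast
      show "{i \<in> {1..n}. ?g (i, False) \<noteq> (i, False)} \<noteq> {i \<in> {1..n}. f (i, False) \<noteq> (i, False)}"
        using gi i by blast
    qed simp
    then have "Q ?g" using less.hyps[OF _ g] gfix less.prems by blast
    then have "Q (sw (f ?x) ?x \<circ> ?g)"
      using assms(5)[OF fx x f2 _ g] i2 by simp
    moreover have "sw (f ?x) ?x \<circ> ?g = f" by (simp add: fun_eq_iff)
    ultimately show ?thesis by simp
  qed
qed

abbreviation tauL :: "nat \<Rightarrow> nat \<times> bool \<Rightarrow> nat \<times> bool" where
  "tauL i \<equiv> sw (i, False) (i, True)"

abbreviation sigmaL :: "nat \<Rightarrow> nat \<Rightarrow> nat \<times> bool \<Rightarrow> nat \<times> bool" where
  "sigmaL i j \<equiv> sw (i, False) (j, False)"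

text \<open>The relations of the presentation, read in an arbitrary monoid; \<open>\<iota>\<close> is the image of the
  signed permutation group, which is encoded by its action on letters.\<close>

locale presented =
  fixes n :: nat and mul :: "'m \<Rightarrow> 'm \<Rightarrow> 'm" (infixr "\<bullet>" 70) and u :: 'm
    and \<iota> :: "(nat \<times> bool \<Rightarrow> nat \<times> bool) \<Rightarrow> 'm" and \<eta> :: 'm
  assumes n4: "4 \<le> n"
    and assoc: "(a \<bullet> b) \<bullet> c = a \<bullet> b \<bullet> c"
    and left_neutral [simp]: "u \<bullet> a = a"
    and right_neutral [simp]: "a \<bullet> u = a"
    and iota_comp: "f \<in> SP n \<Longrightarrow> g \<in> SP n \<Longrightarrow> \<iota> f \<bullet> \<iota> g = \<iota> (f \<circ> g)"
    and iota_id: "\<iota> id = u"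
    and rel1: "\<eta> \<bullet> \<eta> = u"
    and rel2: "\<iota> (sigmaL 1 2) \<bullet> \<eta> \<bullet> \<iota> (sigmaL 1 2) \<bullet> \<eta> \<bullet> \<iota> (sigmaL 1 2) \<bullet> \<eta> = u"
    and rel3: "2 < i \<Longrightarrow> i \<le> n \<Longrightarrow> \<eta> \<bullet> \<iota> (tauL i) \<bullet> \<eta> \<bullet> \<iota> (tauL i) = u"
    and rel4: "2 < i \<Longrightarrow> i \<le> n \<Longrightarrow> 2 < j \<Longrightarrow> j \<le> n \<Longrightarrow> i \<noteq> j \<Longrightarrow>
      \<eta> \<bullet> \<iota> (sigmaL i j) \<bullet> \<eta> \<bullet> \<iota> (sigmaL i j) = u"
    and rel5: "\<eta> \<bullet> \<iota> (tauL 1) \<bullet> \<eta> \<bullet> \<iota> (tauL 1) \<bullet> \<iota> (tauL 2) \<bullet> \<eta> \<bullet> \<iota> (tauL 1) \<bullet> \<eta> \<bullet> \<iota> (tauL 1) \<bullet> \<iota> (tauL 2) = u"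
    and rel7: "\<iota> (sigmaL 1 2) \<bullet> \<eta> \<bullet> \<iota> (sigmaL 1 3) \<bullet> \<iota> (tauL 2) \<bullet> \<eta> \<bullet> \<iota> (sigmaL 1 2) \<bullet>
      \<iota> (sigmaL 2 3) \<bullet> \<eta> \<bullet> \<iota> (sigmaL 1 3) \<bullet> \<iota> (tauL 2) \<bullet> \<eta> \<bullet> \<iota> (sigmaL 2 3) \<bullet> \<eta> \<bullet> \<iota> (sigmaL 1 3) \<bullet> \<iota> (tauL 2) \<bullet> \<eta> = u"
    and rel8: "\<iota> (sigmaL 1 4) \<bullet> \<iota> (sigmaL 2 3) \<bullet> \<eta> \<bullet> \<iota> (sigmaL 1 4) \<bullet> \<iota> (sigmaL 2 3) \<bullet> \<eta> \<bullet>
      \<iota> (sigmaL 1 4) \<bullet> \<iota> (sigmaL 2 3) \<bullet> \<eta> \<bullet> \<iota> (sigmaL 1 4) \<bullet> \<iota> (sigmaL 2 3) \<bullet> \<eta> = u"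
begin

section \<open>The basic transvection and its conjugates under signed permutations\<close>

definition e :: 'm where
  "e = \<eta> \<bullet> \<iota> (tauL 2)"

lemma small_letters [simp]: "(1, b) \<in> letters n" "(Suc 0, b) \<in> letters n" "(2, b) \<in> letters n"
    "(3, b) \<in> letters n" "(4, b) \<in> letters n"
  using n4 by (auto simp: letters_def)

lemma iota_cancel [simp]: "f \<in> SP n \<Longrightarrow> \<iota> f \<bullet> \<iota> (pinv f) = u"
    "f \<in> SP n \<Longrightarrow> \<iota> (pinv f) \<bullet> \<iota> f = u"
    "f \<in> SP n \<Longrightarrow> \<iota> f \<bullet> \<iota> (pinv f) \<bullet> x = x"
    "f \<in> SP n \<Longrightarrow> \<iota> (pinv f) \<bullet> \<iota> f \<bullet> x = x"
  by (simp_all add: iota_comp SP_pinv SP_pinv_comp iota_id flip: assoc)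

lemma iota_right_cancel: "f \<in> SP n \<Longrightarrow> x \<bullet> \<iota> f = y \<bullet> \<iota> f \<longleftrightarrow> x = y"
  by (metis iota_cancel(1) assoc right_neutral)

lemma sw_invol [simp]: "x \<in> letters n \<Longrightarrow> y \<in> letters n \<Longrightarrow> \<iota> (sw x y) \<bullet> \<iota> (sw x y) = u"
    "x \<in> letters n \<Longrightarrow> y \<in> letters n \<Longrightarrow> \<iota> (sw x y) \<bullet> \<iota> (sw x y) \<bullet> z = z"
  by (simp_all add: iota_comp sw_SP sw_comp_sw iota_id flip: assoc)

lemma eta_e: "\<eta> = e \<bullet> \<iota> (tauL 2)"
  by (simp add: e_def assoc)

lemma mult_commute: "a \<bullet> x = x \<bullet> a \<Longrightarrow> b \<bullet> x = x \<bullet> b \<Longrightarrow> (a \<bullet> b) \<bullet> x = x \<bullet> a \<bullet> b"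
  by (metis assoc)

lemma invol_commute:
  assumes "a \<bullet> b \<bullet> a \<bullet> b = u" "a \<bullet> a = u" "b \<bullet> b = u" shows "b \<bullet> a = a \<bullet> b"
proof -
  have "b \<bullet> a = (a \<bullet> a) \<bullet> b \<bullet> a \<bullet> (b \<bullet> b)" using assms(2,3) by simp
  also have "\<dots> = a \<bullet> (a \<bullet> b \<bullet> a \<bullet> b) \<bullet> b" by (simp only: assoc)
  finally show ?thesis using assms(1) by simp
qed

lemma t_eta: "2 < i \<Longrightarrow> i \<le> n \<Longrightarrow> \<iota> (tauL i) \<bullet> \<eta> = \<eta> \<bullet> \<iota> (tauL i)"
  by (intro invol_commute rel3 rel1 sw_invol) (auto simp: letters_def)

lemma s_eta: "2 < i \<Longrightarrow> i \<le> n \<Longrightarrow> 2 < j \<Longrightarrow> j \<le> n \<Longrightarrow> i \<noteq> j \<Longrightarrow> \<iota> (sigmaL i j) \<bullet> \<eta> = \<eta> \<bullet> \<iota> (sigmaL i j)"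
  by (intro invol_commute rel4 rel1 sw_invol) (auto simp: letters_def)

text \<open>A switch of letters with unequal signs is a conjugate of \<sigma>_ij by \<tau>_i, so
  relations 3 and 4 suffice.\<close>

lemma sw_eta:
  assumes "x \<in> letters n" "y \<in> letters n" "2 < fst x" "2 < fst y"
  shows "\<iota> (sw x y) \<bullet> \<eta> = \<eta> \<bullet> \<iota> (sw x y)"
proof -
  obtain i b j c where xy: "x = (i, b)" "y = (j, c)" by (cases x; cases y)
  have l: "(i, b) \<in> letters n" "(j, b) \<in> letters n" "2 < i" "2 < j" "i \<le> n" "j \<le> n" for b
    using assms by (auto simp: xy letters_def)
  show ?thesis
  proof (cases "i = j")
    case True
    then have "sw x y = (if b = c then id else tauL i)"
      by (cases b; cases c) (auto simp: xy sw_def fun_eq_iff)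
    then show ?thesis
      using t_eta l iota_id by (simp add: id_def)
  next
    case False
    then have "sw x y = (if b = c then sigmaL i j else tauL i \<circ> sigmaL i j \<circ> tauL i)"
      by (cases b; cases c) (auto simp: xy sw_def fun_eq_iff)
    then consider "sw x y = sigmaL i j" | "sw x y = tauL i \<circ> sigmaL i j \<circ> tauL i"
      by meson
    then show ?thesis
    proof cases
      case 2
      have "\<iota> (sw x y) = \<iota> (tauL i) \<bullet> \<iota> (sigmaL i j) \<bullet> \<iota> (tauL i)"
        using l by (simp add: 2 iota_comp sw_SP SP_comp flip: comp_assoc)
      have t: "\<iota> (tauL i) \<bullet> \<eta> = \<eta> \<bullet> \<iota> (tauL i)" and s: "\<iota> (sigmaL i j) \<bullet> \<eta> = \<eta> \<bullet> \<iota> (sigmaL i j)"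
        using t_eta[of i] s_eta[of i j] l False by auto
      show ?thesis
        unfolding \<open>\<iota> (sw x y) = _\<close> by (rule mult_commute[OF t mult_commute[OF s t]])
    qed (use s_eta l False in auto)
  qed
qed

lemma sw_e:
  assumes "x \<in> letters n" "y \<in> letters n" "2 < fst x" "2 < fst y"
  shows "\<iota> (sw x y) \<bullet> e = e \<bullet> \<iota> (sw x y)"
proof -
  have "sw x y (2, b) = (2, b)" for b using assms(3,4) by (simp add: sw_other)
  then have "sw x y \<circ> tauL 2 = tauL 2 \<circ> sw x y"
    using SP_sw[OF sw_SP[OF assms(1,2)], of "(2, False)" "(2, True)"] by (simp add: fun_eq_iff)
  then have "\<iota> (sw x y) \<bullet> \<iota> (tauL 2) = \<iota> (tauL 2) \<bullet> \<iota> (sw x y)"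
    using assms by (simp add: iota_comp sw_SP)
  then show ?thesis using sw_eta[OF assms] unfolding e_def by (metis assoc)
qed

text \<open>This makes \<open>E\<close> below independent of the conjugating signed
  permutation.\<close>

lemma iota_e_commute:
  assumes "f \<in> SP n" "f (1, False) = (1, False)" "f (2, False) = (2, False)"
  shows "\<iota> f \<bullet> e = e \<bullet> \<iota> f"
  using assms
proof (induction rule: SP_fix12_induct)
  case (sw x y f)
  have "\<iota> (sw x y \<circ> f) = \<iota> (sw x y) \<bullet> \<iota> f" using sw by (simp add: iota_comp sw_SP)
  then show ?case using sw sw_e[of x y] by (metis assoc)
qed (use iota_id in \<open>simp add: id_def\<close>)

text \<open>The lift of the map that sends \<open>x\<close> to \<open>x y\<close> and fixes the
  generators of other index. Since \<eta>\<tau>_2 sends a_1^{-1} to a_1^{-1} a_2, the model pair is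
  \<open>(1, True)\<close>, \<open>(2, False)\<close>.\<close>

definition E :: "nat \<times> bool \<Rightarrow> nat \<times> bool \<Rightarrow> 'm" where
  "E x y = (let f = (SOME f. f \<in> SP n \<and> f (1, True) = x \<and> f (2, False) = y) in \<iota> f \<bullet> e \<bullet> \<iota> (pinv f))"

definition ok :: "nat \<times> bool \<Rightarrow> nat \<times> bool \<Rightarrow> bool" where
  "ok x y \<longleftrightarrow> x \<in> letters n \<and> y \<in> letters n \<and> fst x \<noteq> fst y"

lemma ok_simps [simp]: "ok (inv_letter x) y = ok x y" "ok x (inv_letter y) = ok x y"
  "f \<in> SP n \<Longrightarrow> ok (f x) (f y) = ok x y"
  by (auto simp: ok_def SP_letters SP_fst)

lemma ok_sym: "ok x y \<Longrightarrow> ok y x"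
  by (auto simp: ok_def)

lemma SP_ex2: "ok x y \<Longrightarrow> \<exists>f\<in>SP n. f (1, False) = x \<and> f (2, False) = y"
  using SP_ex[of "[x, y]" n] by (auto simp: ok_def less_Suc_eq all_conj_distrib numeral_2_eq_2)

lemma SP_ex3: "ok x y \<Longrightarrow> ok x z \<Longrightarrow> ok y z \<Longrightarrow>
    \<exists>f\<in>SP n. f (1, False) = x \<and> f (2, False) = y \<and> f (3, False) = z"
  using SP_ex[of "[x, y, z]" n]
  by (auto simp: ok_def less_Suc_eq all_conj_distrib eval_nat_numeral)

lemma SP_ex4: "ok x y \<Longrightarrow> ok x z \<Longrightarrow> ok y z \<Longrightarrow> ok x w \<Longrightarrow> ok y w \<Longrightarrow> ok z w \<Longrightarrow>
    \<exists>f\<in>SP n. f (1, False) = x \<and> f (2, False) = y \<and> f (3, False) = z \<and> f (4, False) = w"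
  using SP_ex[of "[x, y, z, w]" n]
  by (auto simp: ok_def less_Suc_eq all_conj_distrib eval_nat_numeral)

lemma ex_fresh_letter: "ok x y \<Longrightarrow> ok x z \<Longrightarrow> ok y z \<Longrightarrow> \<exists>w. ok x w \<and> ok y w \<and> ok z w"
proof -
  assume a: "ok x y" "ok x z" "ok y z"
  have "\<not> {1..4} \<subseteq> {fst x, fst y, fst z}"
    using card_mono[of "{fst x, fst y, fst z}" "{1..4::nat}"] a by (auto simp: ok_def)
  then obtain i where "i \<in> {1..4::nat}" "i \<notin> {fst x, fst y, fst z}" by blast
  then show ?thesis using a n4 by (intro exI[of _ "(i, False)"]) (auto simp: ok_def letters_def)
qed

text \<open>Two signed permutations that place the model pair alike differ by \<open>?h\<close>,
  which fixes the first two generators and hence commutes with \<open>e\<close>.\<close>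

lemma E_SP:
  assumes "f \<in> SP n" "f (1, True) = x" "f (2, False) = y"
  shows "E x y = \<iota> f \<bullet> e \<bullet> \<iota> (pinv f)"
proof -
  define g where "g = (SOME f. f \<in> SP n \<and> f (1, True) = x \<and> f (2, False) = y)"
  have g: "g \<in> SP n" "g (1, True) = x" "g (2, False) = y"
    using someI[of "\<lambda>f. f \<in> SP n \<and> f (1, True) = x \<and> f (2, False) = y" f] assms
    by (auto simp: g_def)
  let ?h = "pinv g \<circ> f"
  have h: "?h \<in> SP n" using assms g by (simp add: SP_comp SP_pinv)
  have h1: "?h (1, True) = (1, True)" "?h (2, False) = (2, False)"
    using assms g by (metis SP_pinv_app(1) comp_apply)+
  then have "?h (1, False) = (1, False)"
    using SP_inv[OF h, of "(1, True)"] by simp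
  then have c: "\<iota> ?h \<bullet> e = e \<bullet> \<iota> ?h" using h h1 iota_e_commute by blast
  have "\<iota> f = \<iota> g \<bullet> \<iota> ?h"
    using assms g by (simp add: iota_comp SP_comp SP_pinv SP_pinv_comp flip: comp_assoc)
  then have "\<iota> f \<bullet> e \<bullet> \<iota> (pinv f) = \<iota> g \<bullet> e \<bullet> \<iota> ?h \<bullet> \<iota> (pinv f)"
    using c by (metis assoc)
  also have "\<iota> ?h \<bullet> \<iota> (pinv f) = \<iota> (pinv g)"
    using assms g by (simp add: iota_comp SP_comp SP_pinv SP_pinv_comp comp_assoc)
  finally show ?thesis by (simp add: E_def g_def Let_def)
qed

lemma E_12: "E (1, True) (2, False) = e"
  using E_SP[of id "(1, True)" "(2, False)"] by (simp add: SP_id iota_id flip: id_def)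

lemma SP_ex2': "ok x y \<Longrightarrow> \<exists>f\<in>SP n. f (1, True) = x \<and> f (2, False) = y"
  using SP_ex2[of "inv_letter x" y] SP_pair[of _ n 1 False] by fastforce

lemma iota_E:
  assumes "f \<in> SP n" "ok x y"
  shows "\<iota> f \<bullet> E x y = E (f x) (f y) \<bullet> \<iota> f"
proof -
  obtain g where g: "g \<in> SP n" "g (1, True) = x" "g (2, False) = y" using SP_ex2' assms by blast
  let ?h = "f \<circ> g"
  have h: "?h \<in> SP n" using assms g by (simp add: SP_comp)
  have "E (f x) (f y) \<bullet> \<iota> f = (\<iota> ?h \<bullet> e \<bullet> \<iota> (pinv ?h)) \<bullet> \<iota> f"
    using E_SP[of ?h "f x" "f y"] h g by simp
  also have "\<dots> = \<iota> ?h \<bullet> e \<bullet> \<iota> (pinv ?h \<circ> f)"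
    using h assms(1) by (simp add: assoc iota_comp SP_pinv)
  also have "pinv ?h \<circ> f = pinv g"
    using g assms(1) by (simp add: o_inv_distrib SP_bij comp_assoc SP_pinv_comp)
  also have "\<iota> ?h = \<iota> f \<bullet> \<iota> g" using g assms by (simp add: iota_comp)
  finally show ?thesis using E_SP[OF g] by (simp add: assoc)
qed

lemma iota_E': "f \<in> SP n \<Longrightarrow> ok x y \<Longrightarrow> \<iota> f \<bullet> E x y \<bullet> z = E (f x) (f y) \<bullet> \<iota> f \<bullet> z"
  using iota_E by (simp flip: assoc)

end

section \<open>Steinberg relations\<close>

context presented
begin

lemma std_ok [simp]: "ok (i, b) (j, c) \<longleftrightarrow> i \<noteq> j \<and> i \<in> {1..n} \<and> j \<in> {1..n}"
  by (auto simp: ok_def letters_def)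

lemma n_ge [simp]: "Suc 0 \<le> n" "2 \<le> n" "3 \<le> n" "4 \<le> n"
  using n4 by auto

text \<open>Moves every signed permutation to the right. A defining relation then becomes a product
  of transvections followed by a word in W_n, and that word is evaluated on letters.\<close>

lemma push_simps:
  "f \<in> SP n \<Longrightarrow> ok x y \<Longrightarrow> \<iota> f \<bullet> E x y = E (f x) (f y) \<bullet> \<iota> f"
  "f \<in> SP n \<Longrightarrow> ok x y \<Longrightarrow> \<iota> f \<bullet> E x y \<bullet> z = E (f x) (f y) \<bullet> \<iota> f \<bullet> z"
  by (rule iota_E, assumption+) (rule iota_E', assumption+)

text \<open>\<open>E\<close> depends on \<open>\<eta>\<close>, so rewriting \<open>\<eta>\<close> to an expression in \<open>E\<close> would not terminate;
  hence the substitution is made through a variable.\<close>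

lemma rels_subst:
  assumes "h = \<eta>"
  shows "h \<bullet> h = u"
    "\<iota> (sigmaL 1 2) \<bullet> h \<bullet> \<iota> (sigmaL 1 2) \<bullet> h \<bullet> \<iota> (sigmaL 1 2) \<bullet> h = u"
    "h \<bullet> \<iota> (tauL 1) \<bullet> h \<bullet> \<iota> (tauL 1) \<bullet> \<iota> (tauL 2) \<bullet> h \<bullet> \<iota> (tauL 1) \<bullet> h \<bullet> \<iota> (tauL 1) \<bullet> \<iota> (tauL 2) = u"
    "\<iota> (sigmaL 1 2) \<bullet> h \<bullet> \<iota> (sigmaL 1 3) \<bullet> \<iota> (tauL 2) \<bullet> h \<bullet> \<iota> (sigmaL 1 2) \<bullet>
      \<iota> (sigmaL 2 3) \<bullet> h \<bullet> \<iota> (sigmaL 1 3) \<bullet> \<iota> (tauL 2) \<bullet> h \<bullet> \<iota> (sigmaL 2 3) \<bullet> h \<bullet> \<iota> (sigmaL 1 3) \<bullet> \<iota> (tauL 2) \<bullet> h = u"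
    "\<iota> (sigmaL 1 4) \<bullet> \<iota> (sigmaL 2 3) \<bullet> h \<bullet> \<iota> (sigmaL 1 4) \<bullet> \<iota> (sigmaL 2 3) \<bullet> h \<bullet>
      \<iota> (sigmaL 1 4) \<bullet> \<iota> (sigmaL 2 3) \<bullet> h \<bullet> \<iota> (sigmaL 1 4) \<bullet> \<iota> (sigmaL 2 3) \<bullet> h = u"
  unfolding assms by (rule rel1 rel2 rel5 rel7 rel8)+

lemma eta_E: "E (1, True) (2, False) \<bullet> \<iota> (tauL 2) = \<eta>"
  using eta_e by (simp only: E_12)

lemmas E_rels = rels_subst[OF eta_E]

text \<open>Relation 1 with \<eta> written as a transvection times \<tau>_2; conjugation by
  \<open>f\<close> carries it from the indices 1 and 2 to the given letters. The translations of the
  other relations follow this pattern.\<close>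

lemma E_inv [simp]:
  assumes "ok x y" shows "E x y \<bullet> E x (inv_letter y) = u"
proof -
  obtain f where f: "f \<in> SP n" "f (1, True) = x" "f (2, False) = y" using SP_ex2' assms by blast
  have f2: "f (2, True) = inv_letter y" using SP_pair[OF f(1,3)] by simp
  have "E (1, True) (2, False) \<bullet> E (1, True) (2, True) = u"
    using E_rels(1) by (simp add: push_simps sw_SP sw_def assoc)
  then have "\<iota> f \<bullet> E (1, True) (2, False) \<bullet> E (1, True) (2, True) = \<iota> f" by simp
  then have "(E x y \<bullet> E x (inv_letter y)) \<bullet> \<iota> f = u \<bullet> \<iota> f"
    using f f2 by (simp add: push_simps ok_def assoc)
  then show ?thesis using f(1) by (simp only: iota_right_cancel)
qed

lemma E_inv' [simp]: "ok x y \<Longrightarrow> E x (inv_letter y) \<bullet> E x y = u"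
  using E_inv[of x "inv_letter y"] by simp

lemma E_cancel [simp]: "ok x y \<Longrightarrow> E x y \<bullet> E x (inv_letter y) \<bullet> z = z"
   "ok x y \<Longrightarrow> E x (inv_letter y) \<bullet> E x y \<bullet> z = z"
  by (simp_all flip: assoc)

lemma E_left_cancel: "ok x y \<Longrightarrow> E x y \<bullet> v = E x y \<bullet> w \<longleftrightarrow> v = w"
  by (metis E_cancel(2))

lemma E_right_cancel: "ok x y \<Longrightarrow> v \<bullet> E x y = w \<bullet> E x y \<longleftrightarrow> v = w"
  by (metis E_inv assoc right_neutral)

lemma E_inv_commute:
  assumes "ok x y" "E x y \<bullet> v = v \<bullet> E x y"
  shows "E x (inv_letter y) \<bullet> v = v \<bullet> E x (inv_letter y)"
  using assms by (metis E_inv E_cancel(2) assoc right_neutral)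

text \<open>Reduces an identity between words in W_n with indices up to 4 to four
  evaluations.\<close>

lemma SP_ext4:
  assumes "f \<in> SP n" "g \<in> SP n" "f (1, False) = g (1, False)" "f (2, False) = g (2, False)"
    "f (3, False) = g (3, False)" "f (4, False) = g (4, False)"
    "\<And>i. 4 < i \<Longrightarrow> f (i, False) = g (i, False)"
  shows "f = g"
proof (rule SP_ext[OF assms(1,2)])
  fix i assume "i \<in> {1..n}"
  then consider "i = 1" | "i = 2" | "i = 3" | "i = 4" | "4 < i" by fastforce
  then show "f (i, False) = g (i, False)" using assms by cases simp_all
qed

text \<open>The quarter turn taking \<open>a\<close> to \<open>b\<close> and \<open>b\<close> to the
  inverse of \<open>a\<close>, the counterpart of a Weyl element in Steinberg's presentation of the
  special linear group.\<close>

definition rho :: "nat \<times> bool \<Rightarrow> nat \<times> bool \<Rightarrow> nat \<times> bool \<Rightarrow> nat \<times> bool" where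
  "rho a b = sw a b \<circ> sw b (inv_letter b)"

lemma rho_SP: "ok a b \<Longrightarrow> rho a b \<in> SP n"
  by (auto simp: rho_def ok_def sw_SP SP_comp)

lemma rho_simps [simp]: "ok a b \<Longrightarrow> rho a b a = b" "ok a b \<Longrightarrow> rho a b b = inv_letter a"
  by (auto simp: rho_def sw_def ok_def)

lemma rho_other: "fst l \<noteq> fst a \<Longrightarrow> fst l \<noteq> fst b \<Longrightarrow> rho a b l = l"
  by (simp add: rho_def sw_other)

lemma SP_rho: "f \<in> SP n \<Longrightarrow> f \<circ> rho a b = rho (f a) (f b) \<circ> f"
  by (auto simp: rho_def fun_eq_iff SP_sw SP_inv)

text \<open>Relation 2 after pushing: the left-hand product times the cube of \<sigma>_12\<tau>_2 is
  trivial, and \<sigma>_12\<tau>_2 has order four.\<close>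

lemma E_rho_12: "E (2, True) (1, False) \<bullet> E (1, False) (2, False) \<bullet> E (2, False) (1, True) = \<iota> (sigmaL 1 2) \<bullet> \<iota> (tauL 2)"
proof -
  let ?x = "E (2, True) (1, False) \<bullet> E (1, False) (2, False) \<bullet> E (2, False) (1, True)"
  have "?x \<bullet> \<iota> (sigmaL 1 2) \<bullet> \<iota> (tauL 2) \<bullet> \<iota> (sigmaL 1 2) \<bullet> \<iota> (tauL 2) \<bullet> \<iota> (sigmaL 1 2) \<bullet> \<iota> (tauL 2) = u"
    using E_rels(2) by (simp add: push_simps sw_SP assoc sw_def)
  moreover have "\<iota> (sigmaL 1 2) \<bullet> \<iota> (tauL 2) \<bullet> \<iota> (sigmaL 1 2) \<bullet> \<iota> (tauL 2) \<bullet> \<iota> (sigmaL 1 2) \<bullet> \<iota> (tauL 2) \<bullet> \<iota> (sigmaL 1 2) \<bullet> \<iota> (tauL 2) = \<iota> id"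
    by (simp add: iota_comp sw_SP SP_comp)
      (rule arg_cong[of _ _ \<iota>], rule SP_ext4, simp_all add: sw_SP SP_comp SP_id, simp_all add: sw_def)
  ultimately show ?thesis by (metis assoc iota_id left_neutral right_neutral)
qed

lemma E_rho:
  assumes "ok a b"
  shows "E (inv_letter b) a \<bullet> E a b \<bullet> E b (inv_letter a) = \<iota> (rho a b)"
proof -
  obtain f where f: "f \<in> SP n" "f (1, False) = a" "f (2, False) = b" using SP_ex2 assms by blast
  have f2: "f (1, True) = inv_letter a" "f (2, True) = inv_letter b"
    using SP_pair[OF f(1,2)] SP_pair[OF f(1,3)] by auto
  have "\<iota> f \<bullet> E (2, True) (1, False) \<bullet> E (1, False) (2, False) \<bullet> E (2, False) (1, True) = \<iota> f \<bullet> \<iota> (rho (1, False) (2, False))"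
    unfolding E_rho_12 by (simp add: rho_def iota_comp sw_SP)
  also have "\<dots> = \<iota> (rho a b) \<bullet> \<iota> f"
    using f SP_rho[OF f(1), of "(1, False)" "(2, False)"] by (simp add: iota_comp rho_SP assms)
  finally have "(E (inv_letter b) a \<bullet> E a b \<bullet> E b (inv_letter a)) \<bullet> \<iota> f = \<iota> (rho a b) \<bullet> \<iota> f"
    using f f2 by (simp add: push_simps assoc)
  then show ?thesis using f(1) by (simp only: iota_right_cancel)
qed

text \<open>Relation 5, once the signed permutations are pushed away, is the commutator of a left
  and a right multiplication of a_1 by powers of a_2.\<close>

lemma E_opp_commute:
  assumes "ok x a" shows "E (inv_letter x) a \<bullet> E x a = E x a \<bullet> E (inv_letter x) a"
proof -
  obtain f where f: "f \<in> SP n" "f (1, False) = x" "f (2, False) = a" using SP_ex2 assms by blast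
  have f2: "f (1, True) = inv_letter x" "f (2, True) = inv_letter a"
    using SP_pair[OF f(1,2)] SP_pair[OF f(1,3)] by auto
  have t: "\<iota> (tauL 2) \<bullet> \<iota> (tauL 1) = \<iota> (tauL 1) \<bullet> \<iota> (tauL 2)"
    by (simp add: iota_comp sw_SP)
      (rule arg_cong[of _ _ \<iota>], rule SP_ext4, simp_all add: sw_SP SP_comp SP_id, simp_all add: sw_def)
  have t': "\<iota> (tauL 2) \<bullet> \<iota> (tauL 1) \<bullet> z = \<iota> (tauL 1) \<bullet> \<iota> (tauL 2) \<bullet> z" for z
    using t by (simp flip: assoc)
  have "E (1, True) (2, False) \<bullet> E (1, False) (2, True) \<bullet> E (1, True) (2, True) \<bullet> E (1, False) (2, False) = u"
    using E_rels(3) by (simp add: push_simps sw_SP assoc sw_def t t')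
  then have "\<iota> f \<bullet> E (1, True) (2, False) \<bullet> E (1, False) (2, True) \<bullet> E (1, True) (2, True) \<bullet> E (1, False) (2, False) = \<iota> f"
    by simp
  then have "(E (inv_letter x) a \<bullet> E x (inv_letter a) \<bullet> E (inv_letter x) (inv_letter a) \<bullet> E x a) \<bullet> \<iota> f = u \<bullet> \<iota> f"
    using f f2 by (simp add: push_simps assoc)
  then have "E (inv_letter x) a \<bullet> E x (inv_letter a) \<bullet> E (inv_letter x) (inv_letter a) \<bullet> E x a = u"
    using f(1) by (simp only: iota_right_cancel)
  then have "E x (inv_letter a) \<bullet> E (inv_letter x) (inv_letter a) \<bullet> E x a = E (inv_letter x) (inv_letter a)"
    using assms by (metis E_cancel(2) ok_simps(1) right_neutral)
  then have "E (inv_letter x) (inv_letter a) \<bullet> E x a = E x a \<bullet> E (inv_letter x) (inv_letter a)"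
    using assms by (metis E_cancel(1))
  then show ?thesis using E_inv_commute[of "inv_letter x" "inv_letter a" "E x a"] assms by simp
qed

text \<open>Relation 7 contains this relation for the indices 1, 2, 3 as \<open>?M\<close>, flanked
  by the two outer factors of \<open>E_rho_12\<close>. The signed permutations left behind amount to
  the same quarter turn, so the outer factors cancel.\<close>

lemma steinberg:
  assumes "ok x a" "ok x b" "ok a b"
  shows "E x a \<bullet> E a b \<bullet> E x b = E a b \<bullet> E x a"
proof -
  obtain f where f: "f \<in> SP n" "f (1, False) = a" "f (2, False) = b" "f (3, False) = inv_letter x"
    using SP_ex3[of a b "inv_letter x"] assms ok_sym by auto
  have f2: "f (1, True) = inv_letter a" "f (2, True) = inv_letter b" "f (3, True) = x"
    using SP_pair[OF f(1,2)] SP_pair[OF f(1,3)] SP_pair[OF f(1,4)] by auto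
  let ?E1 = "E (2, True) (1, False)" and ?E2 = "E (2, False) (1, True)"
  let ?M = "E (3, True) (1, False) \<bullet> E (1, False) (2, False) \<bullet> E (3, True) (2, False) \<bullet> E (3, True) (1, True)"
  let ?c = "\<iota> (sigmaL 1 2) \<bullet> \<iota> (tauL 2) \<bullet> \<iota> (sigmaL 1 3) \<bullet> \<iota> (sigmaL 1 2) \<bullet> \<iota> (sigmaL 2 3) \<bullet> \<iota> (tauL 2) \<bullet> \<iota> (sigmaL 1 3) \<bullet> \<iota> (sigmaL 2 3) \<bullet> \<iota> (tauL 2) \<bullet> \<iota> (sigmaL 1 3)"
  have 1: "(?E1 \<bullet> ?M \<bullet> ?E2) \<bullet> ?c = u"
    using E_rels(4) by (simp add: push_simps sw_SP assoc sw_def)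
  have "?c \<bullet> \<iota> (sigmaL 1 2) \<bullet> \<iota> (tauL 2) = \<iota> id"
    by (simp add: iota_comp sw_SP SP_comp)
      (rule arg_cong[of _ _ \<iota>], rule SP_ext4, simp_all add: sw_SP SP_comp SP_id, simp_all add: sw_def)
  with 1 have "?E1 \<bullet> ?M \<bullet> ?E2 = \<iota> (sigmaL 1 2) \<bullet> \<iota> (tauL 2)"
    by (metis assoc iota_id left_neutral right_neutral)
  then have "?E1 \<bullet> ?M \<bullet> ?E2 = ?E1 \<bullet> E (1, False) (2, False) \<bullet> ?E2"
    by (simp only: E_rho_12)
  then have "?M \<bullet> ?E2 = E (1, False) (2, False) \<bullet> ?E2"
    by (rule E_left_cancel[THEN iffD1, rotated]) simp
  then have "?M = E (1, False) (2, False)"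
    by (rule E_right_cancel[THEN iffD1, rotated]) simp
  then have "\<iota> f \<bullet> ?M = \<iota> f \<bullet> E (1, False) (2, False)" by simp
  then have "(E x a \<bullet> E a b \<bullet> E x b \<bullet> E x (inv_letter a)) \<bullet> \<iota> f = E a b \<bullet> \<iota> f"
    using f f2 by (simp add: push_simps assoc)
  then have "E x a \<bullet> E a b \<bullet> E x b \<bullet> E x (inv_letter a) = E a b"
    using f(1) by (simp only: iota_right_cancel)
  then show ?thesis using assms by (metis E_inv' assoc right_neutral)
qed

text \<open>Conjugation by \<sigma>_14\<sigma>_23 exchanges the index pairs (1, 2) and (4, 3), so
  the fourth power in relation 8 comes down to the commutator of two transvections on disjoint
  indices.\<close>

lemma E_disjoint_commute:
  assumes "ok x a" "ok x b" "ok x y" "ok a b" "ok y a" "ok y b"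
  shows "E x a \<bullet> E y b = E y b \<bullet> E x a"
proof -
  obtain f where f: "f \<in> SP n" "f (1, False) = inv_letter y" "f (2, False) = b" "f (3, False) = a" "f (4, False) = inv_letter x"
    using SP_ex4[of "inv_letter y" b a "inv_letter x"] assms ok_sym by auto
  have f2: "f (1, True) = y" "f (2, True) = inv_letter b" "f (3, True) = inv_letter a" "f (4, True) = x"
    using SP_pair[OF f(1,2)] SP_pair[OF f(1,3)] SP_pair[OF f(1,4)] SP_pair[OF f(1,5)] by auto
  let ?M = "E (4, True) (3, False) \<bullet> E (1, True) (2, False) \<bullet> E (4, True) (3, True) \<bullet> E (1, True) (2, True)"
  let ?c = "\<iota> (sigmaL 1 4) \<bullet> \<iota> (sigmaL 2 3) \<bullet> \<iota> (tauL 2) \<bullet> \<iota> (sigmaL 1 4) \<bullet> \<iota> (sigmaL 2 3) \<bullet> \<iota> (tauL 2) \<bullet> \<iota> (sigmaL 1 4) \<bullet> \<iota> (sigmaL 2 3) \<bullet> \<iota> (tauL 2) \<bullet> \<iota> (sigmaL 1 4) \<bullet> \<iota> (sigmaL 2 3) \<bullet> \<iota> (tauL 2)"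
  have 1: "?M \<bullet> ?c = u"
    using E_rels(5) by (simp add: push_simps sw_SP assoc sw_def)
  have "?c = \<iota> id"
    by (simp add: iota_comp sw_SP SP_comp)
      (rule arg_cong[of _ _ \<iota>], rule SP_ext4, simp_all add: sw_SP SP_comp SP_id, simp_all add: sw_def)
  with 1 have "\<iota> f \<bullet> ?M = \<iota> f" by (simp add: iota_id)
  then have "(E x a \<bullet> E y b \<bullet> E x (inv_letter a) \<bullet> E y (inv_letter b)) \<bullet> \<iota> f = u \<bullet> \<iota> f"
    using f f2 by (simp add: push_simps assoc)
  then have "E x a \<bullet> E y b \<bullet> E x (inv_letter a) \<bullet> E y (inv_letter b) = u"
    using f(1) by (simp only: iota_right_cancel)
  then show ?thesis using assms by (metis E_inv' assoc right_neutral left_neutral)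
qed

text \<open>The idea is to conjugate the commuting pair \<open>E x a\<close>, \<open>E y b\<close> by \<open>E a y\<close>; this is where a fourth index
  is needed.\<close>

lemma E_same_commute:
  assumes "ok x a" "ok x b" "ok a b"
  shows "E x b \<bullet> E a b = E a b \<bullet> E x b"
proof -
  obtain y where y: "ok x y" "ok a y" "ok b y" using ex_fresh_letter assms by blast
  note ok = assms y ok_sym[OF y(3)] ok_sym[OF y(2)]
  let ?X = "E x a" and ?Y = "E y b" and ?A = "E a y" and ?A' = "E a (inv_letter y)" and ?x = "E x (inv_letter y)"
  have X: "?A' \<bullet> ?X \<bullet> ?A = ?X \<bullet> ?x"
  proof -
    have "?A' \<bullet> ?X \<bullet> ?A = ?A' \<bullet> (?X \<bullet> ?A \<bullet> E x y) \<bullet> ?x" using ok by (simp add: assoc)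
    then show ?thesis using steinberg[of x a y] ok by (simp add: assoc)
  qed
  have Y: "?A' \<bullet> ?Y \<bullet> ?A = ?Y \<bullet> E a b"
    using steinberg[of a y b, symmetric] ok by simp
  \<comment> \<open>Passing \<open>?x\<close> across \<open>?Y\<close> creates \<open>E x b\<close>,
    the factor whose commutation with \<open>E a b\<close> is to be shown.\<close>
  have xY: "?x \<bullet> ?Y = ?Y \<bullet> E x b \<bullet> ?x"
  proof -
    have "?x \<bullet> ?Y = ?x \<bullet> (?Y \<bullet> E x y) \<bullet> ?x" using ok by (simp add: assoc)
    then show ?thesis using steinberg[of x y b, symmetric] ok by (simp add: assoc)
  qed
  have XY: "?X \<bullet> ?Y = ?Y \<bullet> ?X" using E_disjoint_commute[of x a b y] ok by simp
  have "(?X \<bullet> ?x) \<bullet> (?Y \<bullet> E a b) = ?A' \<bullet> (?X \<bullet> ?Y) \<bullet> ?A"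
    unfolding X[symmetric] Y[symmetric] using ok by (simp add: assoc)
  also have "\<dots> = (?Y \<bullet> E a b) \<bullet> (?X \<bullet> ?x)"
    unfolding X[symmetric] Y[symmetric] XY using ok by (simp add: assoc)
  finally have 1: "(?X \<bullet> ?x) \<bullet> (?Y \<bullet> E a b) = (?Y \<bullet> E a b) \<bullet> (?X \<bullet> ?x)" .
  have xa: "?x \<bullet> E a b = E a b \<bullet> ?x"
    using E_disjoint_commute[of x "inv_letter y" b a] ok ok_sym by simp
  have "(?X \<bullet> ?x) \<bullet> (?Y \<bullet> E a b) = ?X \<bullet> (?x \<bullet> ?Y) \<bullet> E a b" by (simp add: assoc)
  also have "\<dots> = (?X \<bullet> ?Y) \<bullet> E x b \<bullet> ?x \<bullet> E a b" by (simp add: xY assoc)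
  also have "\<dots> = ?Y \<bullet> ?X \<bullet> E x b \<bullet> E a b \<bullet> ?x" by (simp only: XY xa assoc)
  finally have "?Y \<bullet> ?X \<bullet> E x b \<bullet> E a b \<bullet> ?x = ?Y \<bullet> E a b \<bullet> ?X \<bullet> ?x"
    using 1 by (simp add: assoc)
  then have "(?X \<bullet> E x b \<bullet> E a b) \<bullet> ?x = (E a b \<bullet> ?X) \<bullet> ?x"
    using ok by (simp add: E_left_cancel assoc)
  then have "?X \<bullet> E x b \<bullet> E a b = E a b \<bullet> ?X" using ok by (simp only: E_right_cancel ok_simps)
  also have "\<dots> = ?X \<bullet> E a b \<bullet> E x b" using steinberg ok by simp
  finally show ?thesis using ok by (simp only: E_left_cancel)
qed

text \<open>\<open>E_rho\<close> turns \<open>E (inv_letter x) a\<close> into a product of a quarter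
  turn, \<open>E x a\<close> and \<open>E a (inv_letter x)\<close>. How these three factors pass
  \<open>E x b\<close> is known already.\<close>

lemma E_inv_letter_commute:
  assumes "ok x a" "ok x b" "ok a b"
  shows "E (inv_letter x) a \<bullet> E x b = E x b \<bullet> E (inv_letter x) a"
proof -
  note ok = assms ok_sym[OF assms(1)]
  let ?r = "\<iota> (rho a x)" and ?c = "E a (inv_letter x)"
  have r: "E (inv_letter x) a = ?r \<bullet> E x a \<bullet> ?c"
    using E_rho[of a x, symmetric] ok by (simp add: assoc)
  have cx: "?c \<bullet> E x b = E x b \<bullet> E a b \<bullet> ?c"
  proof -
    have "?c \<bullet> E x b = ?c \<bullet> (E x b \<bullet> E a x) \<bullet> ?c" using ok by (simp add: assoc)
    then show ?thesis using steinberg[of a x b, symmetric] ok by (simp add: assoc)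
  qed
  have "E (inv_letter x) a \<bullet> E x b = ?r \<bullet> E x a \<bullet> (E x b \<bullet> E a b) \<bullet> ?c"
    by (simp add: r assoc cx)
  also have "\<dots> = ?r \<bullet> (E x a \<bullet> E a b \<bullet> E x b) \<bullet> ?c" by (simp only: E_same_commute[OF assms] assoc)
  also have "\<dots> = (?r \<bullet> E a b) \<bullet> E x a \<bullet> ?c" by (simp only: steinberg[OF assms] assoc)
  also have "?r \<bullet> E a b = E x b \<bullet> ?r"
  proof -
    have "rho a x b = b" using ok by (intro rho_other) (auto simp: ok_def)
    then show ?thesis using ok by (simp add: push_simps rho_SP)
  qed
  finally show ?thesis by (simp add: r assoc)
qed

text \<open>Sorts the commutation relations by whether the indices of \<open>x\<close> and
  \<open>y\<close>, and those of \<open>a\<close> and \<open>b\<close>, agree. Equal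
  \<open>x\<close> and \<open>y\<close> are left out since \<open>x a b\<close> and
  \<open>x b a\<close> differ in general.\<close>

lemma E_commute:
  assumes "ok x a" "ok y b" "x \<noteq> y" "fst x \<noteq> fst b" "fst y \<noteq> fst a"
  shows "E x a \<bullet> E y b = E y b \<bullet> E x a"
proof -
  have ok: "ok x b" "ok y a" using assms by (auto simp: ok_def)
  have same: "E x a \<bullet> E y a = E y a \<bullet> E x a"
  proof (cases "fst x = fst y")
    case True
    then have "x = inv_letter y" using assms(3) by (simp add: fst_eq_letter)
    then show ?thesis using E_opp_commute[OF ok(2)] by simp
  next
    case False
    then have "ok x y" using assms by (simp add: ok_def)
    then show ?thesis using E_same_commute ok assms by blast
  qed
  show ?thesis
  proof (cases "fst a = fst b")
    case True
    then consider "b = a" | "b = inv_letter a" by (metis fst_eq_letter)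
    then show ?thesis
      by cases (use same E_inv_commute[OF ok(2), of "E x a"] in auto)
  next
    case ab: False
    then have 1: "ok a b" using assms by (simp add: ok_def)
    show ?thesis
    proof (cases "fst x = fst y")
      case True
      then have "x = inv_letter y" using assms(3) by (simp add: fst_eq_letter)
      then show ?thesis using E_inv_letter_commute[of y a b] ok assms 1 by simp
    next
      case False
      then have "ok x y" using assms by (simp add: ok_def)
      then show ?thesis using E_disjoint_commute[of x a b y] ok assms 1 by simp
    qed
  qed
qed

end

section \<open>Whitehead automorphisms\<close>

context presented
begin

definition Pl :: "(nat \<times> bool) list \<Rightarrow> nat \<times> bool \<Rightarrow> 'm" where
  "Pl xs a = foldr (\<lambda>x acc. E x a \<bullet> acc) xs u"

text \<open>The factors commute only because they share the multiplier; \<open>Pl_set_eq\<close>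
  shows that the chosen enumeration does not matter.\<close>

definition Pr :: "(nat \<times> bool) set \<Rightarrow> nat \<times> bool \<Rightarrow> 'm" where
  "Pr V a = Pl (SOME xs. set xs = V \<and> distinct xs) a"

lemma E_commute_same: "ok x a \<Longrightarrow> ok y a \<Longrightarrow> E x a \<bullet> E y a = E y a \<bullet> E x a"
  by (cases "x = y") (auto intro!: E_commute simp: ok_def)

lemma Pl_Cons: "Pl (x # xs) a = E x a \<bullet> Pl xs a"
  by (simp add: Pl_def)

lemma Pl_remove1:
  "x \<in> set xs \<Longrightarrow> \<forall>y\<in>set xs. ok y a \<Longrightarrow> Pl xs a = E x a \<bullet> Pl (remove1 x xs) a"
proof (induction xs)
  case (Cons z xs)
  show ?case
  proof (cases "z = x")
    case False
    with Cons have "Pl (z # xs) a = (E z a \<bullet> E x a) \<bullet> Pl (remove1 x xs) a"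
      by (simp add: Pl_Cons assoc)
    also have "E z a \<bullet> E x a = E x a \<bullet> E z a" using Cons.prems by (auto intro!: E_commute_same)
    finally show ?thesis using False by (simp add: Pl_Cons assoc)
  qed (simp add: Pl_Cons)
qed simp

lemma Pl_set_eq:
  "distinct xs \<Longrightarrow> distinct ys \<Longrightarrow> set xs = set ys \<Longrightarrow> \<forall>y\<in>set xs. ok y a \<Longrightarrow> Pl xs a = Pl ys a"
proof (induction xs arbitrary: ys)
  case (Cons x xs)
  have "Pl ys a = E x a \<bullet> Pl (remove1 x ys) a"
    using Cons.prems by (intro Pl_remove1) auto
  moreover have "set xs = set (remove1 x ys)" using Cons.prems by (auto simp: set_remove1_eq)
  then have "Pl xs a = Pl (remove1 x ys) a" using Cons.prems by (intro Cons.IH) auto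
  ultimately show ?case by (simp add: Pl_Cons)
qed simp

definition okS :: "(nat \<times> bool) set \<Rightarrow> nat \<times> bool \<Rightarrow> bool" where
  "okS V a \<longleftrightarrow> (\<forall>x\<in>V. ok x a)"

lemma okS_finite: "okS V a \<Longrightarrow> finite V"
  by (rule finite_subset[of _ "letters n"]) (auto simp: okS_def ok_def)

lemma okS_simps [simp]: "okS {} a" "okS (insert x V) a \<longleftrightarrow> ok x a \<and> okS V a"
  "okS (V \<union> Y) a \<longleftrightarrow> okS V a \<and> okS Y a" "okS V (inv_letter a) = okS V a"
  by (auto simp: okS_def)

lemma Pr_set: "distinct xs \<Longrightarrow> okS (set xs) a \<Longrightarrow> Pr (set xs) a = Pl xs a"
proof -
  assume d: "distinct xs" and o: "okS (set xs) a"
  let ?ys = "SOME ys. set ys = set xs \<and> distinct ys"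
  have "set ?ys = set xs \<and> distinct ?ys" by (rule someI[of _ xs]) (use d in simp)
  then show ?thesis unfolding Pr_def using d o by (intro Pl_set_eq) (auto simp: okS_def)
qed

lemma Pr_empty [simp]: "Pr {} a = u"
  using Pr_set[of "[]"] by (simp add: Pl_def)

lemma Pr_insert:
  assumes "ok x a" "okS V a" "x \<notin> V" shows "Pr (insert x V) a = E x a \<bullet> Pr V a"
proof -
  obtain xs where xs: "set xs = V" "distinct xs"
    using finite_distinct_list okS_finite assms(2) by blast
  then show ?thesis using Pr_set[of xs a] Pr_set[of "x # xs" a] assms by (simp add: Pl_Cons)
qed

lemma Pr_single [simp]: "ok x a \<Longrightarrow> Pr {x} a = E x a"
  using Pr_insert[of x a "{}"] by simp

lemma Pr_induct [consumes 1, case_names empty insert]: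
  assumes "okS V a" "Q {}" "\<And>x V. ok x a \<Longrightarrow> okS V a \<Longrightarrow> x \<notin> V \<Longrightarrow> Q V \<Longrightarrow> Q (insert x V)"
  shows "Q V"
  using okS_finite[OF assms(1)] assms by (induction V rule: finite_induct) auto

lemma Pr_commute:
  assumes "okS V a" "\<And>x. x \<in> V \<Longrightarrow> E x a \<bullet> v = v \<bullet> E x a" shows "Pr V a \<bullet> v = v \<bullet> Pr V a"
  using assms
proof (induction rule: Pr_induct)
  case (insert x V)
  have 1: "E x a \<bullet> v = v \<bullet> E x a" using insert.prems by blast
  have 2: "Pr V a \<bullet> v = v \<bullet> Pr V a" using insert.prems by (intro insert.IH) blast
  show ?case unfolding Pr_insert[OF insert.hyps] by (rule mult_commute[OF 1 2])
qed simp

lemma Pr_Un: "okS V a \<Longrightarrow> okS Y a \<Longrightarrow> V \<inter> Y = {} \<Longrightarrow> Pr (V \<union> Y) a = Pr V a \<bullet> Pr Y a"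
proof (induction rule: Pr_induct)
  case (insert x V)
  then show ?case by (simp add: Pr_insert assoc)
qed simp

lemma Pr_inv [simp]: "okS V a \<Longrightarrow> Pr V a \<bullet> Pr V (inv_letter a) = u"
proof (induction rule: Pr_induct)
  case (insert x V)
  have c: "Pr V a \<bullet> E x (inv_letter a) = E x (inv_letter a) \<bullet> Pr V a"
    using insert(1,2)
    by (intro Pr_commute E_inv_commute[symmetric] E_commute_same) (auto simp: okS_def)
  have "Pr (insert x V) a \<bullet> Pr (insert x V) (inv_letter a) =
      E x a \<bullet> (Pr V a \<bullet> E x (inv_letter a)) \<bullet> Pr V (inv_letter a)"
    using insert by (simp add: Pr_insert assoc)
  then show ?case using insert by (simp add: c assoc)
qed simp

lemma Pr_inv' [simp]: "okS V a \<Longrightarrow> Pr V (inv_letter a) \<bullet> Pr V a = u"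
  using Pr_inv[of V "inv_letter a"] by simp

lemma Pr_cancel [simp]: "okS V a \<Longrightarrow> Pr V a \<bullet> Pr V (inv_letter a) \<bullet> z = z"
   "okS V a \<Longrightarrow> Pr V (inv_letter a) \<bullet> Pr V a \<bullet> z = z"
  by (simp_all flip: assoc)

lemma iota_Pr:
  assumes "f \<in> SP n" "okS V a" shows "\<iota> f \<bullet> Pr V a = Pr (f ` V) (f a) \<bullet> \<iota> f"
  using assms(2,1)
proof (induction rule: Pr_induct)
  case (insert x V)
  have "okS (f ` V) (f a)" "f x \<notin> f ` V" using insert by (auto simp: okS_def SP_eq_iff)
  then have "Pr (f ` insert x V) (f a) \<bullet> \<iota> f = E (f x) (f a) \<bullet> Pr (f ` V) (f a) \<bullet> \<iota> f"
    using insert by (simp add: Pr_insert assoc)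
  also have "\<dots> = \<iota> f \<bullet> E x a \<bullet> Pr V a" using insert by (simp add: iota_E' flip: insert.IH)
  finally show ?case using insert by (simp add: Pr_insert)
qed simp

text \<open>The situation of a Steinberg relation in which a whole set of letters is multiplied at
  once.\<close>

definition disj :: "(nat \<times> bool) set \<Rightarrow> nat \<times> bool \<Rightarrow> nat \<times> bool \<Rightarrow> bool" where
  "disj V a b \<longleftrightarrow> ok a b \<and> okS V a \<and> okS V b"

lemma disj_inv [simp]: "disj V (inv_letter a) b = disj V a b" "disj V a (inv_letter b) = disj V a b"
  by (auto simp: disj_def)

lemma disj_sym: "disj V a b \<Longrightarrow> disj V b a"
  by (auto simp: disj_def ok_sym)

lemma Pr_Pr_commute:
  assumes "okS V a" "okS Y b" "V \<inter> Y = {}" "okS V b" "okS Y a"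
  shows "Pr V a \<bullet> Pr Y b = Pr Y b \<bullet> Pr V a"
proof (intro Pr_commute assms(1))
  fix x assume x: "x \<in> V"
  show "E x a \<bullet> Pr Y b = Pr Y b \<bullet> E x a"
  proof (rule Pr_commute[symmetric, OF assms(2)])
    fix y assume "y \<in> Y"
    then show "E y b \<bullet> E x a = E x a \<bullet> E y b"
      using x assms by (intro E_commute) (auto simp: okS_def ok_def)
  qed
qed

text \<open>Since \<open>x\<close> is not in \<open>V\<close>, the new factor \<open>E x b\<close>
  commutes with \<open>Pr V a\<close>, so the relation for \<open>V\<close> can be used inside and
  \<open>steinberg\<close> for \<open>x\<close> outside.\<close>

lemma steinberg_Pr:
  assumes "disj V a b" shows "Pr V a \<bullet> E a b \<bullet> Pr V b = E a b \<bullet> Pr V a"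
proof -
  have "okS V a" "okS V b" "ok a b" using assms by (auto simp: disj_def)
  then show ?thesis
  proof (induction rule: Pr_induct)
    case (insert x V)
    have c: "Pr V a \<bullet> E x b = E x b \<bullet> Pr V a"
      using Pr_Pr_commute[of V a "{x}" b] insert by simp
    have ib: "okS V b" "ok x b" using insert.prems by auto
    have c2: "Pr V b \<bullet> E x b = E x b \<bullet> Pr V b"
      using ib by (intro Pr_commute E_commute_same) (auto simp: okS_def)
    have "Pr (insert x V) a \<bullet> E a b \<bullet> Pr (insert x V) b = E x a \<bullet> (Pr V a \<bullet> E a b \<bullet> Pr V b) \<bullet> E x b"
      unfolding Pr_insert[OF insert.hyps] Pr_insert[OF ib(2,1) insert.hyps(3)] by (simp only: c2 assoc)
    also have "\<dots> = E x a \<bullet> E a b \<bullet> (Pr V a \<bullet> E x b)"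
      using insert.IH ib insert.prems by (simp add: assoc)
    also have "\<dots> = (E x a \<bullet> E a b \<bullet> E x b) \<bullet> Pr V a" by (simp only: c assoc)
    also have "\<dots> = (E a b \<bullet> E x a) \<bullet> Pr V a" using insert ib by (simp only: steinberg)
    finally show ?case using insert by (simp add: Pr_insert assoc)
  qed simp
qed

lemma steinberg_Pr_inv:
  assumes "disj V a b" shows "E (inv_letter a) b \<bullet> Pr V b \<bullet> Pr V a = Pr V a \<bullet> E (inv_letter a) b"
proof -
  have o: "okS V a" using assms by (simp add: disj_def)
  have "Pr V (inv_letter a) \<bullet> E (inv_letter a) b \<bullet> Pr V b = E (inv_letter a) b \<bullet> Pr V (inv_letter a)"
    using steinberg_Pr[of V "inv_letter a" b] assms by simp
  then have "Pr V a \<bullet> (Pr V (inv_letter a) \<bullet> E (inv_letter a) b \<bullet> Pr V b) \<bullet> Pr V a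
    = Pr V a \<bullet> (E (inv_letter a) b \<bullet> Pr V (inv_letter a)) \<bullet> Pr V a" by simp
  then show ?thesis using o by (simp add: assoc)
qed

section \<open>Whitehead moves and McCool's relations between them\<close>

definition valid :: "(nat \<times> bool) set \<Rightarrow> nat \<times> bool \<Rightarrow> bool" where
  "valid A a \<longleftrightarrow> A \<subseteq> letters n \<and> a \<in> A \<and> inv_letter a \<notin> A"

text \<open>Letters of \<open>A\<close> other than \<open>a\<close> are multiplied on the right by
  \<open>a\<close>; a generator with both signs in \<open>A\<close> is conjugated. The multiplier is
  kept in \<open>A\<close> so that \<open>A\<close> separates \<open>a\<close> from its inverse, as
  a cut does.\<close>

definition Wh :: "(nat \<times> bool) set \<Rightarrow> nat \<times> bool \<Rightarrow> 'm" where
  "Wh A a = Pr (A - {a}) a"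

lemma valid_okS: "valid A a \<Longrightarrow> okS (A - {a}) a"
  by (auto simp: valid_def okS_def ok_def fst_eq_letter)

lemma valid_ok: "valid A a \<Longrightarrow> x \<in> A \<Longrightarrow> x \<noteq> a \<Longrightarrow> ok x a"
  using valid_okS by (auto simp: okS_def)

lemma valid_SP: "f \<in> SP n \<Longrightarrow> valid A a \<Longrightarrow> valid (f ` A) (f a)"
  by (auto simp: valid_def SP_letters SP_eq_iff simp flip: SP_inv)

lemma iota_Wh:
  assumes "f \<in> SP n" "valid A a" shows "\<iota> f \<bullet> Wh A a = Wh (f ` A) (f a) \<bullet> \<iota> f"
proof -
  have "f ` (A - {a}) = f ` A - {f a}" using assms(1) by (auto simp: SP_eq_iff)
  then show ?thesis unfolding Wh_def using iota_Pr[OF assms(1) valid_okS[OF assms(2)]] by simp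
qed

definition invset :: "(nat \<times> bool) set \<Rightarrow> nat \<times> bool \<Rightarrow> (nat \<times> bool) set" where
  "invset A a = insert (inv_letter a) (A - {a})"

lemma valid_invset: "valid A a \<Longrightarrow> valid (invset A a) (inv_letter a)"
  by (auto simp: valid_def invset_def)

lemma invset_diff: "valid A a \<Longrightarrow> invset A a - {inv_letter a} = A - {a}"
  by (auto simp: valid_def invset_def)

lemma Wh_inv [simp]: "valid A a \<Longrightarrow> Wh A a \<bullet> Wh (invset A a) (inv_letter a) = u"
   "valid A a \<Longrightarrow> Wh (invset A a) (inv_letter a) \<bullet> Wh A a = u"
  unfolding Wh_def by (simp_all add: invset_diff valid_okS)

lemma Wh_single [simp]: "Wh {a} a = u"
  by (simp add: Wh_def)

lemma Wh_nested:
  assumes "valid A a" "valid B a" "A \<subseteq> B"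
  shows "valid (insert a (B - A)) a" "Wh B a = Wh (insert a (B - A)) a \<bullet> Wh A a"
proof -
  show "valid (insert a (B - A)) a" using assms by (auto simp: valid_def)
  have "B - {a} = (B - A) \<union> (A - {a})" "insert a (B - A) - {a} = B - A"
    using assms by (auto simp: valid_def)
  moreover have "Pr ((B - A) \<union> (A - {a})) a = Pr (B - A) a \<bullet> Pr (A - {a}) a"
    using valid_okS[OF assms(2)] valid_okS[OF assms(1)] assms(1)
    by (intro Pr_Un) (auto simp: okS_def valid_def)
  ultimately show "Wh B a = Wh (insert a (B - A)) a \<bullet> Wh A a" by (simp add: Wh_def)
qed

text \<open>The inverse of \<open>(A, a)\<close> has the multiplier of the second move and acts on
  letters outside \<open>B\<close>, so the quotient of the two lifts is one move on a union. It
  joins the two sides of a peak by a single edge.\<close>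

lemma Wh_opp:
  assumes "valid A a" "valid B (inv_letter a)" "A \<inter> B = {}"
  shows "\<exists>C. valid C (inv_letter a) \<and> Wh B (inv_letter a) = Wh C (inv_letter a) \<bullet> Wh A a"
proof -
  let ?C = "B \<union> (A - {a})"
  have C: "valid ?C (inv_letter a)" using assms by (auto simp: valid_def)
  have o: "okS (A - {a}) a" "okS (B - {inv_letter a}) (inv_letter a)"
    using valid_okS[OF assms(1)] valid_okS[OF assms(2)] by auto
  have "?C - {inv_letter a} = (B - {inv_letter a}) \<union> (A - {a})" using assms by (auto simp: valid_def)
  moreover have "Pr ((B - {inv_letter a}) \<union> (A - {a})) (inv_letter a) =
      Pr (B - {inv_letter a}) (inv_letter a) \<bullet> Pr (A - {a}) (inv_letter a)"
    using o assms(3) by (intro Pr_Un) auto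
  ultimately have "Wh ?C (inv_letter a) \<bullet> Wh A a = Wh B (inv_letter a)"
    using o by (simp add: Wh_def assoc)
  then show ?thesis using C by metis
qed

lemma Wh_disjoint_commute:
  assumes "valid A a" "valid B b" "A \<inter> B = {}" "inv_letter a \<notin> B" "inv_letter b \<notin> A"
  shows "Wh A a \<bullet> Wh B b = Wh B b \<bullet> Wh A a"
  unfolding Wh_def using assms valid_okS[OF assms(1)] valid_okS[OF assms(2)]
  by (intro Pr_Pr_commute) (auto simp: okS_def ok_def fst_eq_letter valid_def)

text \<open>\<open>B\<close> multiplies the inverse of \<open>a\<close> by \<open>b\<close>. Passing
  that factor across \<open>(A, a)\<close> makes \<open>b\<close> act on the rest of
  \<open>A\<close> as well, by \<open>steinberg_Pr_inv\<close>, which enlarges the set of the second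
  move.\<close>

lemma Wh_disjoint_conj:
  assumes "valid A a" "valid B b" "A \<inter> B = {}" "inv_letter a \<in> B" "inv_letter b \<notin> A" "inv_letter a \<noteq> b"
  shows "valid (A \<union> B - {a}) b" "Wh (A \<union> B - {a}) b \<bullet> Wh A a = Wh A a \<bullet> Wh B b"
proof -
  show "valid (A \<union> B - {a}) b" using assms by (auto simp: valid_def)
  let ?X = "A - {a}" and ?Z = "B - {b, inv_letter a}" and ?a = "inv_letter a"
  have a: "a \<notin> B" "b \<notin> A" using assms by (auto simp: valid_def)
  have ab: "ok a b" using valid_ok[OF assms(2,4,6)] by simp
  have V: "disj ?X a b"
    using assms a ab by (auto simp: disj_def okS_def ok_def valid_def fst_eq_letter)
  have Z: "disj ?Z a b"
    using assms a ab by (auto simp: disj_def okS_def ok_def valid_def fst_eq_letter)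
  have "B - {b} = insert ?a ?Z" "A \<union> B - {a} - {b} = insert ?a (?X \<union> ?Z)"
    using assms a by auto
  moreover have "Pr (insert ?a ?Z) b = E ?a b \<bullet> Pr ?Z b"
    using Z by (intro Pr_insert) (auto simp: disj_def)
  moreover have "Pr (insert ?a (?X \<union> ?Z)) b = E ?a b \<bullet> Pr ?X b \<bullet> Pr ?Z b"
    using V Z assms(1,3) by (subst Pr_insert, auto simp: disj_def valid_def intro!: Pr_Un arg_cong2[of _ _ _ _ mul])
  moreover have c: "Pr ?X a \<bullet> Pr ?Z b = Pr ?Z b \<bullet> Pr ?X a"
    using V Z assms(3) by (intro Pr_Pr_commute) (auto simp: disj_def)
  ultimately have "Wh (A \<union> B - {a}) b \<bullet> Wh A a = (E ?a b \<bullet> Pr ?X b \<bullet> Pr ?X a) \<bullet> Pr ?Z b"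
     "Wh A a \<bullet> Wh B b = (Pr ?X a \<bullet> E ?a b) \<bullet> Pr ?Z b"
    by (simp_all add: Wh_def assoc)
  then show "Wh (A \<union> B - {a}) b \<bullet> Wh A a = Wh A a \<bullet> Wh B b"
    using steinberg_Pr_inv[OF V] by simp
qed

text \<open>Here \<open>B\<close> multiplies \<open>a\<close> but not its inverse, and
  \<open>steinberg_Pr\<close> absorbs the action of \<open>b\<close> on the rest of
  \<open>C\<close>. What remains for the second move is the part of \<open>B\<close> outside
  \<open>C\<close>, together with \<open>a\<close>.\<close>

lemma Wh_nested_conj:
  assumes "valid C a" "valid B b" "C \<subseteq> B" "b \<notin> C" "inv_letter a \<notin> B"
  shows "valid (insert a (B - C)) b" "Wh (insert a (B - C)) b \<bullet> Wh C a = Wh C a \<bullet> Wh B b"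
proof -
  show "valid (insert a (B - C)) b" using assms by (auto simp: valid_def)
  let ?X = "C - {a}" and ?Z = "B - C - {b}"
  have a: "a \<in> B" "b \<noteq> a" using assms by (auto simp: valid_def)
  have ab: "ok a b" using valid_ok[OF assms(2)] a by auto
  have V: "disj ?X a b"
    using assms a ab by (auto simp: disj_def okS_def ok_def valid_def fst_eq_letter)
  have Z: "disj ?Z a b"
    using assms a ab by (auto simp: disj_def okS_def ok_def valid_def fst_eq_letter)
  have "B - {b} = insert a (?X \<union> ?Z)" "insert a (B - C) - {b} = insert a ?Z"
    using assms a by (auto simp: valid_def)
  moreover have "Pr (insert a ?Z) b = E a b \<bullet> Pr ?Z b"
    using Z assms by (intro Pr_insert) (auto simp: disj_def valid_def)
  moreover have "Pr (insert a (?X \<union> ?Z)) b = E a b \<bullet> Pr ?X b \<bullet> Pr ?Z b"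
    using V Z assms(1) by (subst Pr_insert, auto simp: disj_def valid_def intro!: Pr_Un arg_cong2[of _ _ _ _ mul])
  moreover have c: "Pr ?X a \<bullet> Pr ?Z b = Pr ?Z b \<bullet> Pr ?X a"
    using V Z by (intro Pr_Pr_commute) (auto simp: disj_def)
  ultimately have "Wh (insert a (B - C)) b \<bullet> Wh C a = (E a b \<bullet> Pr ?X a) \<bullet> Pr ?Z b"
     "Wh C a \<bullet> Wh B b = (Pr ?X a \<bullet> E a b \<bullet> Pr ?X b) \<bullet> Pr ?Z b"
    by (simp_all add: Wh_def assoc)
  then show "Wh (insert a (B - C)) b \<bullet> Wh C a = Wh C a \<bullet> Wh B b"
    using steinberg_Pr[OF V] by simp
qed

text \<open>With both signs of \<open>a\<close> multiplied, \<open>a\<close> is conjugated by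
  \<open>b\<close>, and the corrections from \<open>steinberg_Pr\<close> and
  \<open>steinberg_Pr_inv\<close> cancel.\<close>

lemma Pr_conj_commute:
  assumes "disj V a b" "disj Z a b" "V \<inter> Z = {}"
  shows "Pr V a \<bullet> E a b \<bullet> E (inv_letter a) b \<bullet> Pr V b \<bullet> Pr Z b =
     (E a b \<bullet> E (inv_letter a) b \<bullet> Pr V b \<bullet> Pr Z b) \<bullet> Pr V a"
proof -
  let ?a = "inv_letter a"
  have ab: "ok a b" using assms by (simp add: disj_def)
  have c: "Pr Z b \<bullet> Pr V a = Pr V a \<bullet> Pr Z b"
    using assms by (intro Pr_Pr_commute[symmetric]) (auto simp: disj_def)
  have c2: "E ?a b \<bullet> Pr V b = Pr V b \<bullet> E ?a b"
    using assms(1) ab by (intro Pr_commute[symmetric] E_commute_same) (auto simp: disj_def okS_def)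
  have "(E a b \<bullet> E ?a b \<bullet> Pr V b \<bullet> Pr Z b) \<bullet> Pr V a = E a b \<bullet> (E ?a b \<bullet> Pr V b \<bullet> Pr V a) \<bullet> Pr Z b"
    by (simp add: assoc c)
  also have "\<dots> = (E a b \<bullet> Pr V a) \<bullet> E ?a b \<bullet> Pr Z b"
    using steinberg_Pr_inv[OF assms(1)] by (simp add: assoc)
  also have "\<dots> = Pr V a \<bullet> E a b \<bullet> (Pr V b \<bullet> E ?a b) \<bullet> Pr Z b"
    using steinberg_Pr[OF assms(1), symmetric] by (simp add: assoc)
  finally show ?thesis by (simp only: c2[symmetric] assoc)
qed

lemma Wh_nested_commute:
  assumes "valid C a" "valid B b" "C \<subseteq> B" "b \<notin> C" "inv_letter a \<in> B" "inv_letter a \<noteq> b"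
  shows "Wh C a \<bullet> Wh B b = Wh B b \<bullet> Wh C a"
proof -
  let ?X = "C - {a}" and ?Z = "B - C - {b, inv_letter a}" and ?a = "inv_letter a"
  have a: "a \<in> B" "b \<noteq> a" using assms by (auto simp: valid_def)
  have ab: "ok a b" using valid_ok[OF assms(2)] a by auto
  have V: "disj ?X a b"
    using assms a ab by (auto simp: disj_def okS_def ok_def valid_def fst_eq_letter)
  have Z: "disj ?Z a b"
    using assms a ab by (auto simp: disj_def okS_def ok_def valid_def fst_eq_letter)
  have "B - {b} = insert a (insert ?a (?X \<union> ?Z))"
    using assms a by (auto simp: valid_def)
  moreover have "Pr (?X \<union> ?Z) b = Pr ?X b \<bullet> Pr ?Z b"
    using V Z by (intro Pr_Un) (auto simp: disj_def)
  moreover have "Pr (insert ?a (?X \<union> ?Z)) b = E ?a b \<bullet> Pr (?X \<union> ?Z) b"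
    using V Z assms(1) by (intro Pr_insert) (auto simp: disj_def valid_def)
  moreover have "Pr (insert a (insert ?a (?X \<union> ?Z))) b = E a b \<bullet> Pr (insert ?a (?X \<union> ?Z)) b"
    using V Z assms(1) by (intro Pr_insert) (auto simp: disj_def valid_def)
  ultimately have "Wh B b = E a b \<bullet> E ?a b \<bullet> Pr ?X b \<bullet> Pr ?Z b"
    by (simp add: Wh_def)
  moreover have "?X \<inter> ?Z = {}" by auto
  ultimately show ?thesis using Pr_conj_commute[OF V Z] by (simp add: Wh_def)
qed

text \<open>Exchanging the multiplier within one cut changes the lift by one move and a quarter turn
  only. In the graph of moves it costs a single edge.\<close>

lemma Wh_swap:
  assumes "valid A a" "valid A b" "a \<noteq> b"
  shows "Wh A b = \<iota> (rho a b) \<bullet> Wh (invset A a) b \<bullet> Wh A a" "valid (invset A a) b" "rho a b \<in> SP n"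
proof -
  have ab: "ok a b" using valid_ok[OF assms(2)] assms(1,3) by (auto simp: valid_def)
  show r: "rho a b \<in> SP n" by (rule rho_SP[OF ab])
  show "valid (invset A a) b" using assms by (auto simp: valid_def invset_def inv_letter_eq_swap)
  let ?X = "A - {a, b}" and ?r = "\<iota> (rho a b)"
  have V: "disj ?X a b"
    using assms ab by (auto simp: disj_def okS_def ok_def valid_def fst_eq_letter)
  then have o: "okS ?X a" "okS ?X b" by (auto simp: disj_def)
  have ba: "ok b a" by (rule ok_sym[OF ab])
  have "A - {b} = insert a ?X" "A - {a} = insert b ?X" "invset A a - {b} = insert (inv_letter a) ?X"
    using assms by (auto simp: valid_def invset_def inv_letter_eq_swap)
  then have W: "Wh A b = E a b \<bullet> Pr ?X b" "Wh A a = E b a \<bullet> Pr ?X a"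
      "Wh (invset A a) b = E (inv_letter a) b \<bullet> Pr ?X b"
    using o ab ba assms by (simp_all add: Wh_def Pr_insert valid_def)
  have "rho a b ` ?X = ?X"
  proof -
    have "rho a b x = x" if "x \<in> ?X" for x
      using o that by (intro rho_other) (auto simp: okS_def ok_def)
    then show ?thesis by simp
  qed
  then have rX: "?r \<bullet> Pr ?X b = Pr ?X (inv_letter a) \<bullet> ?r"
    using iota_Pr[OF r o(2)] ab by simp
  have rE: "?r \<bullet> E (inv_letter a) b = E (inv_letter b) (inv_letter a) \<bullet> ?r"
    using iota_E[OF r, of "inv_letter a" b] ab SP_inv[OF r, of a] by simp
  have Er: "E a b \<bullet> E b (inv_letter a) = E (inv_letter b) (inv_letter a) \<bullet> ?r"
    using E_rho[OF ab, symmetric] ba by simp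
  have c: "Pr ?X b \<bullet> E (inv_letter a) b = E (inv_letter a) b \<bullet> Pr ?X b"
    using o ab by (intro Pr_commute E_commute_same) (auto simp: okS_def)
  have "?r \<bullet> Wh (invset A a) b \<bullet> Wh A a = (?r \<bullet> Pr ?X b) \<bullet> E (inv_letter a) b \<bullet> E b a \<bullet> Pr ?X a"
    by (simp add: W assoc) (simp add: c flip: assoc)
  also have "\<dots> = Pr ?X (inv_letter a) \<bullet> (?r \<bullet> E (inv_letter a) b) \<bullet> E b a \<bullet> Pr ?X a"
    by (simp only: rX assoc)
  also have "\<dots> = Pr ?X (inv_letter a) \<bullet> (E a b \<bullet> E b (inv_letter a)) \<bullet> E b a \<bullet> Pr ?X a"
    by (simp only: rE Er)
  also have "\<dots> = Pr ?X (inv_letter a) \<bullet> E a b \<bullet> Pr ?X a"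
    using ba by (simp add: assoc)
  also have "\<dots> = Pr ?X (inv_letter a) \<bullet> Pr ?X a \<bullet> E a b \<bullet> Pr ?X b"
    by (simp only: steinberg_Pr[OF V, symmetric])
  also have "\<dots> = Wh A b" using o by (simp add: W)
  finally show "Wh A b = ?r \<bullet> Wh (invset A a) b \<bullet> Wh A a" by simp
qed

text \<open>The two factors with multiplier \<open>b\<close> conjugate \<open>a\<close> by
  \<open>b\<close>, and \<open>b\<close> times that conjugate is \<open>a b\<close>; so right
  multiplication of \<open>b\<close> by \<open>a\<close> becomes left multiplication. The derivation
  runs through the quarter turn \<open>?r\<close>.\<close>

lemma E_nested_base:
  assumes "ok a b"
  shows "E a b \<bullet> E (inv_letter a) b \<bullet> E b a = E (inv_letter b) (inv_letter a) \<bullet> E a b \<bullet> E (inv_letter a) b"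
proof -
  let ?a = "inv_letter a" and ?b = "inv_letter b" and ?r = "\<iota> (rho (inv_letter a) b)"
  have r: "rho ?a b \<in> SP n" using assms by (intro rho_SP) simp
  have ba: "ok b a" by (rule ok_sym[OF assms])
  have E: "E ?b ?a \<bullet> E ?a b \<bullet> E b a = ?r" using E_rho[of ?a b] assms by simp
  have 1: "E ?a b \<bullet> E b a = E ?b a \<bullet> ?r" unfolding E[symmetric] using ba by simp
  have 2: "E ?b ?a \<bullet> E ?a b = ?r \<bullet> E b ?a" unfolding E[symmetric] using ba by (simp add: assoc)
  have "rho ?a b a = ?b" using SP_inv[OF r, of ?a] assms by simp
  moreover have "rho ?a b b = a" using assms by simp
  ultimately have 3: "?r \<bullet> E b ?a = E a b \<bullet> ?r" "?r \<bullet> E a b = E ?b a \<bullet> ?r"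
    using iota_E[OF r, of b ?a] iota_E[OF r, of a b] ba assms by auto
  have "E ?b ?a \<bullet> E a b \<bullet> E ?a b = (E ?b ?a \<bullet> E ?a b) \<bullet> E a b"
    using E_opp_commute[OF assms] by (simp add: assoc)
  also have "\<dots> = E a b \<bullet> ?r \<bullet> E a b" by (simp add: 2 3 assoc)
  also have "\<dots> = E a b \<bullet> E ?a b \<bullet> E b a" by (simp add: 1 3)
  finally show ?thesis by simp
qed

text \<open>In the remaining nested position, conjugation of \<open>a\<close> by \<open>b\<close>
  turns the move with multiplier \<open>a\<close> into one with the inverse multiplier. The action
  of that multiplier on the letters common to both sets cancels, so only \<open>B - C\<close> and
  the inverse of \<open>b\<close> stay.\<close>

lemma Wh_nested_special:
  assumes "valid C a" "valid B b" "C \<subseteq> B" "b \<in> C" "inv_letter a \<in> B" "a \<noteq> b"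
  shows "valid (insert (inv_letter b) (B - C)) (inv_letter a)"
    "Wh B b \<bullet> Wh C a = Wh (insert (inv_letter b) (B - C)) (inv_letter a) \<bullet> Wh B b"
proof -
  let ?X = "C - {a, b}" and ?Z = "B - C - {inv_letter a}" and ?a = "inv_letter a" and ?b = "inv_letter b"
  show "valid (insert ?b (B - C)) ?a" using assms by (auto simp: valid_def)
  have ba: "ok b a" using valid_ok[OF assms(1,4)] assms(6) by auto
  have ab: "ok a b" by (rule ok_sym[OF ba])
  have a: "a \<in> C" "a \<in> B" "?b \<notin> B" "b \<in> B" "?a \<notin> C" using assms by (auto simp: valid_def)
  have V: "disj ?X a b"
    using assms ab a by (auto simp: disj_def okS_def ok_def valid_def fst_eq_letter)
  have Z: "disj ?Z a b"
    using assms ab a by (auto simp: disj_def okS_def ok_def valid_def fst_eq_letter)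
  have oX: "okS ?X a" "okS ?X b" and oZ: "okS ?Z a" "okS ?Z b" using V Z by (auto simp: disj_def)
  have XZ: "?X \<inter> ?Z = {}" by auto
  have "B - {b} = insert a (insert ?a (?X \<union> ?Z))" "C - {a} = insert b ?X"
     "insert ?b (B - C) - {?a} = insert ?b ?Z"
    using assms a by (auto simp: inv_letter_eq_swap)
  moreover have "Pr (?X \<union> ?Z) b = Pr ?X b \<bullet> Pr ?Z b" using oX oZ XZ by (intro Pr_Un)
  moreover have "Pr (insert ?a (?X \<union> ?Z)) b = E ?a b \<bullet> Pr (?X \<union> ?Z) b"
    using oX oZ a ab by (intro Pr_insert) auto
  moreover have "Pr (insert a (insert ?a (?X \<union> ?Z))) b = E a b \<bullet> Pr (insert ?a (?X \<union> ?Z)) b"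
    using oX oZ a ab by (intro Pr_insert) auto
  moreover have "Pr (insert b ?X) a = E b a \<bullet> Pr ?X a" "Pr (insert ?b ?Z) ?a = E ?b ?a \<bullet> Pr ?Z ?a"
    using oX oZ a ba by (simp_all add: Pr_insert)
  ultimately have W: "Wh B b = E a b \<bullet> E ?a b \<bullet> Pr ?X b \<bullet> Pr ?Z b" "Wh C a = E b a \<bullet> Pr ?X a"
     "Wh (insert ?b (B - C)) ?a = E ?b ?a \<bullet> Pr ?Z ?a"
    by (simp_all add: Wh_def)
  \<comment> \<open>Passing \<open>Pr Y b\<close> across \<open>E b a\<close> costs a factor with
    the inverse multiplier; for \<open>?X\<close> it cancels against \<open>Pr ?X a\<close>, for
    \<open>?Z\<close> it survives.\<close>
  have push: "Pr Y b \<bullet> E b a = E b a \<bullet> Pr Y b \<bullet> Pr Y ?a" if "disj Y a b" for Y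
  proof -
    have "okS Y a" using that by (simp add: disj_def)
    then have "Pr Y b \<bullet> E b a = (Pr Y b \<bullet> E b a \<bullet> Pr Y a) \<bullet> Pr Y ?a" by (simp add: assoc)
    then show ?thesis using steinberg_Pr[OF disj_sym[OF that]] by (simp add: assoc)
  qed
  have XbZb: "Pr ?X b \<bullet> Pr ?Z b = Pr ?Z b \<bullet> Pr ?X b"
    using oX oZ by (metis Pr_Un Un_commute XZ inf_commute)
  have XaZa: "Pr ?Z ?a \<bullet> Pr ?X a = Pr ?X a \<bullet> Pr ?Z ?a"
    using oX oZ by (intro Pr_Pr_commute) auto
  have XaZb: "Pr ?X ?a \<bullet> Pr ?Z b = Pr ?Z b \<bullet> Pr ?X ?a"
    using oX oZ by (intro Pr_Pr_commute) auto
  have XZa: "(E a b \<bullet> E ?a b \<bullet> Pr ?Z b \<bullet> Pr ?X b) \<bullet> Pr ?Z ?a = Pr ?Z ?a \<bullet> E a b \<bullet> E ?a b \<bullet> Pr ?Z b \<bullet> Pr ?X b"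
  proof -
    have "Pr ?Z ?a \<bullet> E ?a b \<bullet> E a b \<bullet> Pr ?Z b \<bullet> Pr ?X b = (E ?a b \<bullet> E a b \<bullet> Pr ?Z b \<bullet> Pr ?X b) \<bullet> Pr ?Z ?a"
      using Pr_conj_commute[of ?Z ?a b ?X] V Z XZ by (simp add: Int_commute)
    moreover have "E ?a b \<bullet> E a b \<bullet> z = E a b \<bullet> E ?a b \<bullet> z" for z
      using E_opp_commute[OF ab] by (simp flip: assoc)
    ultimately show ?thesis by simp
  qed
  have "Wh B b \<bullet> Wh C a = E a b \<bullet> E ?a b \<bullet> Pr ?X b \<bullet> (Pr ?Z b \<bullet> E b a) \<bullet> Pr ?X a"
    by (simp add: W assoc)
  also have "\<dots> = E a b \<bullet> E ?a b \<bullet> (Pr ?X b \<bullet> E b a) \<bullet> Pr ?Z b \<bullet> (Pr ?Z ?a \<bullet> Pr ?X a)"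
    by (simp only: push[OF Z] assoc)
  also have "\<dots> = E a b \<bullet> E ?a b \<bullet> E b a \<bullet> Pr ?X b \<bullet> (Pr ?X ?a \<bullet> Pr ?Z b) \<bullet> Pr ?X a \<bullet> Pr ?Z ?a"
    by (simp only: push[OF V] XaZa assoc)
  also have "\<dots> = (E a b \<bullet> E ?a b \<bullet> E b a) \<bullet> (Pr ?X b \<bullet> Pr ?Z b) \<bullet> Pr ?Z ?a"
    using oX by (simp add: XaZb assoc)
  also have "\<dots> = E ?b ?a \<bullet> (E a b \<bullet> E ?a b \<bullet> Pr ?Z b \<bullet> Pr ?X b) \<bullet> Pr ?Z ?a"
    by (simp only: E_nested_base[OF ab] XbZb assoc)
  also have "\<dots> = E ?b ?a \<bullet> Pr ?Z ?a \<bullet> E a b \<bullet> E ?a b \<bullet> (Pr ?X b \<bullet> Pr ?Z b)"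
    by (simp only: XZa XbZb)
  also have "\<dots> = Wh (insert ?b (B - C)) ?a \<bullet> Wh B b" by (simp add: W assoc)
  finally show "Wh B b \<bullet> Wh C a = Wh (insert ?b (B - C)) ?a \<bullet> Wh B b" .
qed

end

section \<open>Length and cuts\<close>

text \<open>The image of one letter under the Whitehead automorphism \<open>(A, a)\<close>.\<close>

definition lm :: "(nat \<times> bool) set \<Rightarrow> nat \<times> bool \<Rightarrow> nat \<times> bool \<Rightarrow> nat word" where
  "lm A a x = (if x = a \<or> x = inv_letter a then [x] else
     (if inv_letter x \<in> A then [inv_letter a] else []) @ [x] @ (if x \<in> A then [a] else []))"

lemma lm_simps [simp]: "lm A a a = [a]" "lm A a (inv_letter a) = [inv_letter a]"
  by (simp_all add: lm_def)

lemma lm_other: "x \<noteq> a \<Longrightarrow> x \<noteq> inv_letter a \<Longrightarrow>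
    lm A a x = (if inv_letter x \<in> A then [inv_letter a] else []) @ [x] @ (if x \<in> A then [a] else [])"
  by (simp add: lm_def)

lemma inv_compat_lm: "inv_compat (lm A a)"
  by (simp add: inv_compat_def lm_def inv_word_def inv_letter_eq_swap)

text \<open>The image of a reduced word under the Whitehead automorphism \<open>(A, a)\<close> in reduced form: delete
  all letters \<open>a\<close> and their inverses, and insert \<open>a\<close> or its inverse at each place where the word
  crosses \<open>A\<close>. The flag records whether the previous letter lies in \<open>A\<close>.\<close>

fun mv :: "(nat \<times> bool) set \<Rightarrow> nat \<times> bool \<Rightarrow> bool \<Rightarrow> nat word \<Rightarrow> nat word" where
  "mv A a p [] = (if p then [a] else [])"
| "mv A a p (y # w) =
    (if p \<and> inv_letter y \<notin> A then [a] else if \<not> p \<and> inv_letter y \<in> A then [inv_letter a] else []) @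
    (if y = a \<or> y = inv_letter a then [] else [y]) @ mv A a (y \<in> A) w"

text \<open>The flag is an \<open>a\<close> still owed by the previous letter. It cancels if the
  inverse of the next letter lies in \<open>A\<close>, and is written out otherwise.\<close>

lemma norm_mv:
  assumes "a \<in> A" "inv_letter a \<notin> A"
  shows "norm (mv A a p w) = norm ((if p then [a] else []) @ concat (map (lm A a) w))"
proof (induction w arbitrary: p)
  case (Cons y w)
  have IH: "norm (u @ mv A a (y \<in> A) w) = norm (u @ (if y \<in> A then [a] else []) @ concat (map (lm A a) w))" for u
    using Cons.IH[of "y \<in> A"] by (metis norm_append_norm_right)
  show ?case
  proof (cases "y = a \<or> y = inv_letter a")
    case True
    then show ?thesis using assms IH[of "[]"] IH[of "[a]"] IH[of "[inv_letter a]"]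
      by auto
  next
    case False
    then show ?thesis using IH[of "[y]"] IH[of "[a, y]"] IH[of "[inv_letter a, y]"]
      by (auto simp: lm_other)
  qed
qed simp

text \<open>Reducedness requires that the first letter written after \<open>x\<close> does not
  cancel \<open>x\<close>. If \<open>x\<close> is the multiplier or its inverse, it is deleted, and
  the danger is a cancellation with the letter before it. The last two clauses exclude this: the
  next output is that multiplier again, or a letter whose inverse lies on the same side of
  \<open>A\<close>.\<close>

lemma reduced_mv_aux:
  assumes "a \<in> A" "inv_letter a \<notin> A" "reduced (x # w)"
  shows "reduced (mv A a (x \<in> A) w) \<and>
    (mv A a (x \<in> A) w \<noteq> [] \<longrightarrow> hd (mv A a (x \<in> A) w) \<noteq> inv_letter x \<and>
      (x = a \<longrightarrow> hd (mv A a True w) \<noteq> a \<longrightarrow> inv_letter (hd (mv A a True w)) \<in> A) \<and>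
      (x = inv_letter a \<longrightarrow> hd (mv A a False w) \<noteq> inv_letter a \<longrightarrow> inv_letter (hd (mv A a False w)) \<notin> A))"
  using assms(3)
proof (induction w arbitrary: x)
  case Nil
  then show ?case using assms by (auto simp: inv_letter_eq_swap)
next
  case (Cons y w)
  have r: "reduced (y # w)" and yx: "y \<noteq> inv_letter x" using Cons.prems by auto
  let ?m = "mv A a (y \<in> A) w"
  have IH: "reduced ?m" "?m \<noteq> [] \<Longrightarrow> hd ?m \<noteq> inv_letter y"
    "?m \<noteq> [] \<Longrightarrow> y = a \<Longrightarrow> hd ?m \<noteq> a \<Longrightarrow> inv_letter (hd ?m) \<in> A"
    "?m \<noteq> [] \<Longrightarrow> y = inv_letter a \<Longrightarrow> hd ?m \<noteq> inv_letter a \<Longrightarrow> inv_letter (hd ?m) \<notin> A"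
    using Cons.IH[OF r] assms by auto
  consider (a) "y = a" | (a') "y = inv_letter a" | (o) "y \<noteq> a" "y \<noteq> inv_letter a" by blast
  then show ?case
  proof cases
    case a
    have "x \<in> A" if "hd ?m = inv_letter x" "?m \<noteq> []"
      using IH(3)[OF that(2) a] that yx a by auto
    then show ?thesis using a IH yx assms by (auto simp: reduced_Cons inv_letter_eq_swap)
  next
    case a'
    then show ?thesis using IH yx assms by (auto simp: reduced_Cons inv_letter_eq_swap)
  next
    case o
    then show ?thesis using IH yx assms by (auto simp: reduced_Cons inv_letter_eq_swap)
  qed
qed

lemma reduced_mv:
  assumes "a \<in> A" "inv_letter a \<notin> A" "reduced w"
  shows "reduced (mv A a False w)"
proof (cases w)
  case (Cons y v)
  note IH = reduced_mv_aux[OF assms(1,2), of y v]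
  consider "y = a" | "y = inv_letter a" | "y \<noteq> a" "y \<noteq> inv_letter a" by blast
  then show ?thesis using IH assms Cons by cases (auto simp: reduced_Cons)
qed simp

lemma wsubst_lm:
  assumes "a \<in> A" "inv_letter a \<notin> A" "reduced w"
  shows "wsubst (lm A a) w = mv A a False w"
  using norm_mv[OF assms(1,2), of False w] reduced_mv[OF assms] by (simp add: wsubst_def)

text \<open>The capacity of \<open>S\<close> in the Whitehead graph of a word, where consecutive
  letters \<open>y\<close>, \<open>y'\<close> give an edge from \<open>y\<close> to the inverse of
  \<open>y'\<close>. The flags \<open>p\<close> and \<open>z\<close> are the sides of the two ends,
  because the words are not cyclic.\<close>

fun cut :: "(nat \<times> bool) set \<Rightarrow> bool \<Rightarrow> bool \<Rightarrow> nat word \<Rightarrow> nat" where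
  "cut S z p [] = of_bool (p \<noteq> z)"
| "cut S z p (y # w) = of_bool (p \<noteq> (inv_letter y \<in> S)) + cut S z (y \<in> S) w"

definition wdeg :: "nat \<times> bool \<Rightarrow> nat word \<Rightarrow> nat" where
  "wdeg a w = length (filter (\<lambda>y. y = a \<or> y = inv_letter a) w)"

lemma wdeg_inv [simp]: "wdeg (inv_letter a) w = wdeg a w"
  by (simp add: wdeg_def disj_commute)

text \<open>Every occurrence of \<open>a\<close> or its inverse is deleted, and one letter is
  inserted for each crossing of \<open>A\<close>.\<close>

lemma length_mv: "length (mv A a p w) + wdeg a w = length w + cut A False p w"
  by (induction w arbitrary: p) (auto simp: wdeg_def)

lemma wdeg_mv: "b \<noteq> a \<Longrightarrow> b \<noteq> inv_letter a \<Longrightarrow> wdeg b (mv A a p w) = wdeg b w"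
  by (induction w arbitrary: p) (auto simp: wdeg_def inv_letter_eq_swap)

lemma cut_compl: "cut (- S) (\<not> z) (\<not> p) w = cut S z p w"
  by (induction w arbitrary: p) (simp_all add: of_bool_def)

text \<open>An edge crossing \<open>A\<close> is split by the inserted letter, and \<open>S'\<close>
  is chosen so that the new graph has the capacity of the old one: the letters of \<open>A\<close>
  other than \<open>a\<close> are put on the side \<open>d\<close> of the inverse of
  \<open>a\<close>. With a pending \<open>a\<close> the next vertex is on side \<open>d\<close>
  whether \<open>a\<close> is written out or not, hence the term \<open>c \<noteq> d\<close>. If
  instead the pending \<open>a\<close> cancels against a deleted letter, the last hypothesis is what
  makes the sides agree.\<close>

lemma cut_mv_aux:
  assumes "a \<in> A" "inv_letter a \<notin> A" "S \<inter> A = {}"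
    and d: "d \<longleftrightarrow> inv_letter a \<in> S" and S': "S' = (if d then S \<union> A - {a} else S)"
    and "reduced w" "p \<Longrightarrow> w \<noteq> [] \<Longrightarrow> hd w = inv_letter a \<Longrightarrow> c = d"
  shows "cut S' z c (mv A a p w) = (if p then of_bool (c \<noteq> d) + cut S z False w else cut S z c w)"
  using assms(6,7)
proof (induction w arbitrary: p c)
  case Nil
  then show ?case using assms by auto
next
  case (Cons y w)
  have h: "a \<notin> S" "a \<notin> S'" "inv_letter a \<in> S' \<longleftrightarrow> d" using assms by (auto split: if_splits)
  have o: "x \<in> S' \<longleftrightarrow> (if x \<in> A then d else x \<in> S)" "x \<in> A \<Longrightarrow> x \<notin> S" if "x \<noteq> a" for x
    using that assms by auto
  have r: "reduced w" "w \<noteq> [] \<Longrightarrow> hd w \<noteq> inv_letter y" using Cons.prems(1) by (auto simp: reduced_Cons)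
  consider (a) "y = a" | (a') "y = inv_letter a" | (o) "y \<noteq> a" "y \<noteq> inv_letter a" by blast
  then show ?case
  proof cases
    case a
    have IH: "cut S' z c' (mv A a True w) = of_bool (c' \<noteq> d) + cut S z False w" for c'
      using Cons.IH[OF r(1), of True c'] r(2) a by auto
    show ?thesis using assms(1,2) by (auto simp: a IH h d[symmetric])
  next
    case a'
    have IH: "cut S' z c' (mv A a False w) = cut S z c' w" for c'
      using Cons.IH[OF r(1), of False c'] by auto
    show ?thesis using assms(1,2) Cons.prems(2) by (auto simp: a' IH h d[symmetric])
  next
    case y: o
    have IH: "cut S' z (y \<in> S') (mv A a (y \<in> A) w) = cut S z (y \<in> S) w"
      using Cons.IH[OF r(1), of "y \<in> A" "y \<in> S'"] o[of y] y by auto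
    have yi: "inv_letter y \<noteq> a" "inv_letter y \<noteq> inv_letter a" using y by (auto simp: inv_letter_eq_swap)
    show ?thesis using y yi IH h o(1)[OF yi(1)] o(2)[OF yi(1)] by auto
  qed
qed

lemma cut_submodular:
  "cut (A \<inter> B) False (p \<and> q) w + cut (A \<union> B) False (p \<or> q) w \<le> cut A False p w + cut B False q w"
proof (induction w arbitrary: p q)
  case (Cons y w)
  show ?case using Cons.IH[of "y \<in> A" "y \<in> B"]
    by (cases p; cases q; cases "inv_letter y \<in> A"; cases "inv_letter y \<in> B") auto
qed auto

text \<open>Submodularity for \<open>A\<close> and the complement of \<open>B\<close>, in view of
  the fact that an edge crosses a set exactly when it crosses the complement. It is checked edge by
  edge.\<close>

lemma cut_submodular_diff:
  "cut (A - B) False (p \<and> \<not> q) w + cut (B - A) False (q \<and> \<not> p) w \<le> cut A False p w + cut B False q w"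
proof (induction w arbitrary: p q)
  case (Cons y w)
  show ?case using Cons.IH[of "y \<in> A" "y \<in> B"]
    by (cases p; cases q; cases "inv_letter y \<in> A"; cases "inv_letter y \<in> B") auto
qed auto

section \<open>Length, degree and capacity of a tuple of words\<close>

definition tlen :: "nat \<Rightarrow> (nat \<Rightarrow> nat word) \<Rightarrow> nat" where
  "tlen n f = (\<Sum>i=1..n. length (f i))"

definition tdeg :: "nat \<Rightarrow> nat \<times> bool \<Rightarrow> (nat \<Rightarrow> nat word) \<Rightarrow> nat" where
  "tdeg n a f = (\<Sum>i=1..n. wdeg a (f i))"

definition tcap :: "nat \<Rightarrow> (nat \<times> bool) set \<Rightarrow> (nat \<Rightarrow> nat word) \<Rightarrow> nat" where
  "tcap n S f = (\<Sum>i=1..n. cut S False False (f i))"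

definition tmv :: "(nat \<times> bool) set \<Rightarrow> nat \<times> bool \<Rightarrow> (nat \<Rightarrow> nat word) \<Rightarrow> nat \<Rightarrow> nat word" where
  "tmv A a f i = mv A a False (f i)"

lemma tdeg_inv [simp]: "tdeg n (inv_letter a) f = tdeg n a f"
  by (simp add: tdeg_def)

lemma tlen_tmv: "tlen n (tmv A a f) + tdeg n a f = tlen n f + tcap n A f"
  by (simp add: tlen_def tdeg_def tcap_def tmv_def length_mv flip: sum.distrib)

lemma tdeg_tmv: "b \<noteq> a \<Longrightarrow> b \<noteq> inv_letter a \<Longrightarrow> tdeg n b (tmv A a f) = tdeg n b f"
  by (simp add: tdeg_def tmv_def wdeg_mv)

lemma tcap_submodular: "tcap n (A \<inter> B) f + tcap n (A \<union> B) f \<le> tcap n A f + tcap n B f"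
  unfolding tcap_def sum.distrib[symmetric]
  using cut_submodular[of A B False False] by (intro sum_mono) simp

lemma tcap_submodular_diff: "tcap n (A - B) f + tcap n (B - A) f \<le> tcap n A f + tcap n B f"
  unfolding tcap_def sum.distrib[symmetric]
  using cut_submodular_diff[of A B False False] by (intro sum_mono) simp

lemma tcap_tmv_disjoint:
  assumes "a \<in> A" "inv_letter a \<notin> A" "S \<inter> A = {}" "\<And>i. i \<in> {1..n} \<Longrightarrow> reduced (f i)"
  shows "tcap n (if inv_letter a \<in> S then S \<union> A - {a} else S) (tmv A a f) = tcap n S f"
  unfolding tcap_def tmv_def using assms
  by (intro sum.cong refl) (subst cut_mv_aux[OF assms(1-3) refl refl], auto)

text \<open>The complement of \<open>S\<close> is disjoint from \<open>A\<close>. It contains the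
  base vertex, so \<open>cut_mv_aux\<close> is used with the two end flags true.\<close>

lemma tcap_tmv_superset:
  assumes "a \<in> A" "inv_letter a \<notin> A" "A \<subseteq> S" "\<And>i. i \<in> {1..n} \<Longrightarrow> reduced (f i)"
  shows "tcap n (if inv_letter a \<notin> S then insert a (S - A) else S) (tmv A a f) = tcap n S f"
proof -
  let ?T = "- S"
  let ?T' = "if inv_letter a \<in> ?T then ?T \<union> A - {a} else ?T"
  have eq: "(if inv_letter a \<notin> S then insert a (S - A) else S) = - ?T'" by auto
  have "cut (- ?T') False False (mv A a False (f i)) = cut S False False (f i)" if "i \<in> {1..n}" for i
  proof -
    have "cut ?T' True True (mv A a False (f i)) = cut ?T True True (f i)"
      using assms that by (subst cut_mv_aux[OF assms(1,2) _ refl refl]) auto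
    then show ?thesis
      using cut_compl[of ?T' True True "mv A a False (f i)"] cut_compl[of ?T True True "f i"] by simp
  qed
  then show ?thesis unfolding eq tcap_def tmv_def by (intro sum.cong refl)
qed

text \<open>The second move changes the length by as much as \<open>(S, b)\<close> would have
  changed it before the first move, so at the far corner of a square the two changes add up.\<close>

lemma tlen_tmv_tmv_disjoint:
  assumes "a \<in> A" "inv_letter a \<notin> A" "S \<inter> A = {}" "\<And>i. i \<in> {1..n} \<Longrightarrow> reduced (f i)"
    "b \<noteq> a" "b \<noteq> inv_letter a"
    "S' = (if inv_letter a \<in> S then S \<union> A - {a} else S)"
  shows "tlen n (tmv S' b (tmv A a f)) + tdeg n a f + tdeg n b f = tlen n f + tcap n A f + tcap n S f"
  using tlen_tmv[of n S' b "tmv A a f"] tlen_tmv[of n A a f] tdeg_tmv[OF assms(5,6), of n A f]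
    tcap_tmv_disjoint[OF assms(1-4)] assms(7) by simp

lemma tlen_tmv_tmv_superset:
  assumes "a \<in> A" "inv_letter a \<notin> A" "A \<subseteq> S" "\<And>i. i \<in> {1..n} \<Longrightarrow> reduced (f i)"
    "b \<noteq> a" "b \<noteq> inv_letter a"
    "S' = (if inv_letter a \<notin> S then insert a (S - A) else S)"
  shows "tlen n (tmv S' b (tmv A a f)) + tdeg n a f + tdeg n b f = tlen n f + tcap n A f + tcap n S f"
  using tlen_tmv[of n S' b "tmv A a f"] tlen_tmv[of n A a f] tdeg_tmv[OF assms(5,6), of n A f]
    tcap_tmv_superset[OF assms(1-4)] assms(7) by simp

section \<open>Peak reduction\<close>

lemma norm_map_SP: "f \<in> SP n \<Longrightarrow> norm (map f w) = map f (norm w)"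
proof (induction w)
  case (Cons l w)
  have "ins_letter (f l) (map f v) = map f (ins_letter l v)" for v
    using Cons.prems by (auto simp: ins_letter_def SP_eq_iff simp flip: SP_inv split: list.split)
  then show ?case using Cons by (simp add: norm_Cons)
qed simp

lemma map_wsubst: "f \<in> SP n \<Longrightarrow> map f (wsubst g w) = wsubst (\<lambda>l. map f (g l)) w"
  by (simp add: wsubst_def map_concat comp_def flip: norm_map_SP)

lemma wsubst_map: "wsubst g (map f w) = wsubst (\<lambda>l. g (f l)) w"
  by (simp add: wsubst_def comp_def)

lemma wsubst_norm_fun: "wsubst (\<lambda>l. norm (g l)) w = wsubst g w"
proof (induction w)
  case (Cons l w)
  then show ?case by (simp add: wsubst_Cons)
qed simp

lemma lm_SP: "f \<in> SP n \<Longrightarrow> map f (lm A a k) = lm (f ` A) (f a) (f k)"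
  by (auto simp: lm_def SP_eq_iff simp flip: SP_inv)

lemma lm_insert:
  assumes "a \<in> B" "inv_letter a \<notin> B" "x \<notin> B" "x \<noteq> inv_letter a"
  shows "concat (map (lm {x, a} a) (lm B a l)) = lm (insert x B) a l"
proof (cases "l = a \<or> l = inv_letter a")
  case False
  have "inv_letter l = x \<longleftrightarrow> l = inv_letter x" by (auto simp: inv_letter_eq_swap)
  then show ?thesis using False assms
    by (auto simp: lm_other inv_letter_eq_swap)
qed auto

text \<open>\<open>tup v\<close> stands for the images of the generators under the automorphism of
  \<open>v\<close>. Multiplication from the left applies one substitution to all these words at
  once, so each move has a computable effect on the length.\<close>

locale acting = presented +
  fixes act :: "'a \<Rightarrow> 'v \<Rightarrow> 'v" (infixr "\<star>" 65) and tup :: "'v \<Rightarrow> nat \<Rightarrow> nat word" and V :: "'v set"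
  assumes mul_app [simp]: "(a \<bullet> b) \<star> v = a \<star> b \<star> v"
    and u_app [simp]: "u \<star> v = v"
    and iota_V: "f \<in> SP n \<Longrightarrow> v \<in> V \<Longrightarrow> \<iota> f \<star> v \<in> V"
    and eta_V: "v \<in> V \<Longrightarrow> \<eta> \<star> v \<in> V"
    and tup_reduced: "v \<in> V \<Longrightarrow> i \<in> {1..n} \<Longrightarrow> reduced (tup v i)"
    and tup_nonempty: "v \<in> V \<Longrightarrow> i \<in> {1..n} \<Longrightarrow> tup v i \<noteq> []"
    and tup_iota: "f \<in> SP n \<Longrightarrow> v \<in> V \<Longrightarrow> i \<in> {1..n} \<Longrightarrow> tup (\<iota> f \<star> v) i = map f (tup v i)"
    and tup_eta: "v \<in> V \<Longrightarrow> i \<in> {1..n} \<Longrightarrow>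
      tup (\<eta> \<star> v) i = wsubst (lm {(1, True), (2, False)} (2, False)) (map (tauL 2) (tup v i))"
begin

lemma tup_e:
  assumes "v \<in> V" shows "e \<star> v \<in> V"
    and "i \<in> {1..n} \<Longrightarrow> tup (e \<star> v) i = wsubst (lm {(1, True), (2, False)} (2, False)) (tup v i)"
proof -
  have t2: "tauL 2 \<in> SP n" by (simp add: sw_SP)
  have v: "\<iota> (tauL 2) \<star> v \<in> V" using assms t2 by (simp add: iota_V)
  then show "e \<star> v \<in> V" by (simp add: e_def eta_V)
  show "tup (e \<star> v) i = wsubst (lm {(1, True), (2, False)} (2, False)) (tup v i)" if "i \<in> {1..n}"
    using that assms v t2 by (simp add: e_def tup_eta tup_iota comp_def)
qed

lemma tup_E:
  assumes "v \<in> V" "ok x a" shows "E x a \<star> v \<in> V"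
    and "i \<in> {1..n} \<Longrightarrow> tup (E x a \<star> v) i = wsubst (lm {x, a} a) (tup v i)"
proof -
  obtain f where f: "f \<in> SP n" "f (1, True) = x" "f (2, False) = a" using SP_ex2' assms by blast
  have E: "E x a \<star> v = \<iota> f \<star> (e \<star> (\<iota> (pinv f) \<star> v))" using E_SP[OF f] by simp
  have v1: "\<iota> (pinv f) \<star> v \<in> V" using f assms by (simp add: iota_V SP_pinv)
  then have v2: "e \<star> (\<iota> (pinv f) \<star> v) \<in> V" by (rule tup_e)
  then show "E x a \<star> v \<in> V" unfolding E using f by (simp add: iota_V)
  have "map f (lm {(1, True), (2, False)} (2, False) (pinv f l)) = lm {x, a} a l" for l
    using lm_SP[OF f(1), of "{(1, True), (2, False)}" "(2, False)" "pinv f l"] f by simp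
  then show "tup (E x a \<star> v) i = wsubst (lm {x, a} a) (tup v i)" if "i \<in> {1..n}"
    unfolding E using that f v1 v2 assms
    by (simp add: tup_iota tup_e(2) SP_pinv map_wsubst wsubst_map)
qed

lemma tup_Pr:
  assumes "okS U a" "v \<in> V" shows "Pr U a \<star> v \<in> V \<and> (\<forall>i\<in>{1..n}. tup (Pr U a \<star> v) i = wsubst (lm (insert a U) a) (tup v i))"
  using assms
proof (induction rule: Pr_induct)
  case empty
  have "tup v i = wsubst (lm {a} a) (tup v i)" if "i \<in> {1..n}" for i
    using tup_reduced[OF empty that] by (subst wsubst_id) (auto simp: lm_def inv_letter_eq_swap)
  then show ?case using empty by simp
next
  case (insert x U)
  have "a \<notin> U" "inv_letter a \<notin> U" using insert.hyps(2) by (auto simp: okS_def ok_def)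
  moreover have x: "x \<noteq> a" "x \<noteq> inv_letter a" using insert.hyps(1) by (auto simp: ok_def)
  ultimately have "concat (map (lm {x, a} a) (lm (insert a U) a l)) = lm (insert x (insert a U)) a l" for l
    using insert.hyps(3) by (intro lm_insert) auto
  then have "wsubst (lm {x, a} a) (lm (insert a U) a l) = norm (lm (insert a (insert x U)) a l)" for l
    by (simp add: wsubst_def insert_commute)
  then show ?case using insert.IH[OF insert.prems] insert.hyps(1)
    by (simp add: Pr_insert[OF insert.hyps] tup_E wsubst_wsubst inv_compat_lm wsubst_norm_fun)
qed

lemma Wh_V: "valid A a \<Longrightarrow> v \<in> V \<Longrightarrow> Wh A a \<star> v \<in> V"
  using tup_Pr[OF valid_okS] by (simp add: Wh_def)

lemma tup_Wh:
  assumes "valid A a" "v \<in> V" "i \<in> {1..n}"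
  shows "tup (Wh A a \<star> v) i = tmv A a (tup v) i"
proof -
  have "insert a (A - {a}) = A" using assms(1) by (auto simp: valid_def)
  then show ?thesis
    using tup_Pr[OF valid_okS[OF assms(1)] assms(2)] assms wsubst_lm[of a A "tup v i"] tup_reduced
    by (simp add: Wh_def tmv_def valid_def)
qed

section \<open>The length function and the graph of Whitehead moves\<close>

definition len :: "'v \<Rightarrow> nat" where
  "len v = tlen n (tup v)"

abbreviation dg :: "'v \<Rightarrow> nat \<times> bool \<Rightarrow> nat" where
  "dg v a \<equiv> tdeg n a (tup v)"

abbreviation cp :: "'v \<Rightarrow> (nat \<times> bool) set \<Rightarrow> nat" where
  "cp v A \<equiv> tcap n A (tup v)"

lemma tlen_cong: "(\<And>i. i \<in> {1..n} \<Longrightarrow> f i = g i) \<Longrightarrow> tlen n f = tlen n g"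
  by (simp add: tlen_def)

lemma len_Wh: "valid A a \<Longrightarrow> v \<in> V \<Longrightarrow> len (Wh A a \<star> v) + dg v a = len v + cp v A"
proof -
  assume "valid A a" "v \<in> V"
  then have "tlen n (tup (Wh A a \<star> v)) = tlen n (tmv A a (tup v))" by (intro tlen_cong tup_Wh)
  then show ?thesis using tlen_tmv[of n A a "tup v"] by (simp add: len_def)
qed

lemma len_Wh_less: "valid A a \<Longrightarrow> v \<in> V \<Longrightarrow> len (Wh A a \<star> v) < len v \<longleftrightarrow> cp v A < dg v a"
  using len_Wh[of A a v] by linarith

lemma len_Wh_le: "valid A a \<Longrightarrow> v \<in> V \<Longrightarrow> len (Wh A a \<star> v) \<le> len v \<longleftrightarrow> cp v A \<le> dg v a"
  using len_Wh[of A a v] by linarith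

lemma len_Wh_Wh: "valid A a \<Longrightarrow> valid B b \<Longrightarrow> v \<in> V \<Longrightarrow>
    len (Wh B b \<star> (Wh A a \<star> v)) = tlen n (tmv B b (tmv A a (tup v)))"
  unfolding len_def by (rule tlen_cong) (simp add: tup_Wh Wh_V, simp add: tmv_def tup_Wh)

lemma len_iota: "f \<in> SP n \<Longrightarrow> v \<in> V \<Longrightarrow> len (\<iota> f \<star> v) = len v"
  by (simp add: len_def tlen_def tup_iota)

lemma len_ge: "v \<in> V \<Longrightarrow> n \<le> len v"
proof -
  assume v: "v \<in> V"
  have "(\<Sum>i=1..n. 1) \<le> (\<Sum>i=1..n. length (tup v i))"
    using tup_nonempty[OF v] by (intro sum_mono) (simp add: Suc_leI)
  then show ?thesis by (simp add: len_def tlen_def)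
qed

text \<open>Signed permutations preserve the length, so an edge may include one; this is what makes
  a change of multiplier by \<open>Wh_swap\<close> a single edge.\<close>

definition adj :: "'v \<Rightarrow> 'v \<Rightarrow> bool" where
  "adj g g' \<longleftrightarrow> (\<exists>f\<in>SP n. \<exists>A a. valid A a \<and> g' = \<iota> f \<star> (Wh A a \<star> g))"

lemma adj_Wh: "valid A a \<Longrightarrow> adj g (Wh A a \<star> g)"
  unfolding adj_def using SP_id iota_id by (metis u_app)

lemma comp_eq_app: "f \<bullet> g = h \<Longrightarrow> f \<star> g \<star> x = h \<star> x"
  by (metis mul_app)

text \<open>Inverting puts the signed permutation before the move, and \<open>iota_Wh\<close>
  restores the order.\<close>

lemma adj_sym: "adj g g' \<Longrightarrow> adj g' g"
proof -
  assume "adj g g'"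
  then obtain f A a where f: "f \<in> SP n" "valid A a" "g' = \<iota> f \<star> (Wh A a \<star> g)" by (auto simp: adj_def)
  let ?A = "invset A a" and ?a = "inv_letter a"
  have A: "valid ?A ?a" by (rule valid_invset[OF f(2)])
  have "\<iota> (pinv f) \<bullet> Wh (f ` ?A) (f ?a) = Wh ?A ?a \<bullet> \<iota> (pinv f)"
    using iota_Wh[OF SP_pinv[OF f(1)] valid_SP[OF f(1) A]] f(1) by (simp add: image_image)
  then have "\<iota> (pinv f) \<star> (Wh (f ` ?A) (f ?a) \<star> g') = Wh ?A ?a \<star> (\<iota> (pinv f) \<star> g')"
    by (metis mul_app)
  also have "\<dots> = g"
    using comp_eq_app[OF iota_cancel(2)[OF f(1)]] comp_eq_app[OF Wh_inv(2)[OF f(2)]] by (simp add: f(3))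
  finally show ?thesis unfolding adj_def using SP_pinv[OF f(1)] valid_SP[OF f(1) A] by metis
qed

text \<open>The bound concerns only the vertices strictly between the two ends, so a single edge is
  a path for every \<open>m\<close>.\<close>

inductive path :: "nat \<Rightarrow> 'v \<Rightarrow> 'v \<Rightarrow> bool" for m where
  path_adj: "adj g g' \<Longrightarrow> path m g g'"
| path_step: "adj g c \<Longrightarrow> len c < m \<Longrightarrow> path m c g' \<Longrightarrow> path m g g'"

lemma path_trans: "path m g c \<Longrightarrow> len c < m \<Longrightarrow> path m c g' \<Longrightarrow> path m g g'"
  by (induction rule: path.induct) (blast intro: path.intros)+

lemma path_sym: "path m g g' \<Longrightarrow> path m g' g"
  by (induction rule: path.induct) (blast intro: path.intros adj_sym path_trans)+

lemma path_corner: "adj g c \<Longrightarrow> adj g' c \<Longrightarrow> len c < m \<Longrightarrow> path m g g'"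
  by (blast intro: path.intros adj_sym)

lemma path_same:
  assumes "valid A a" "valid B a" "A \<subseteq> B" shows "path m (Wh A a \<star> v) (Wh B a \<star> v)"
  using path_adj[OF adj_Wh[OF Wh_nested(1)[OF assms]], of m "Wh A a \<star> v"] Wh_nested(2)[OF assms] by simp

lemma path_opp:
  assumes "valid A a" "valid B (inv_letter a)" "A \<inter> B = {}"
  shows "path m (Wh A a \<star> v) (Wh B (inv_letter a) \<star> v)"
proof -
  obtain C where C: "valid C (inv_letter a)" "Wh B (inv_letter a) = Wh C (inv_letter a) \<bullet> Wh A a"
    using Wh_opp[OF assms] by blast
  then show ?thesis using path_adj[OF adj_Wh[OF C(1)], of m "Wh A a \<star> v"] by simp
qed

lemma path_swap:
  assumes "valid A a" "valid A b" "a \<noteq> b" shows "path m (Wh A a \<star> v) (Wh A b \<star> v)"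
proof (rule path_adj)
  show "adj (Wh A a \<star> v) (Wh A b \<star> v)"
    unfolding adj_def using Wh_swap[OF assms] by (metis mul_app)
qed

text \<open>The relation between the two moves closes a square over \<open>v\<close>. Its far corner
  is shorter than \<open>v\<close>, because the two length changes add up to a negative
  number.\<close>

lemma path_disjoint_one:
  assumes v: "v \<in> V" and A: "valid A a" and B: "valid B b" and AB: "A \<inter> B = {}"
    and b: "inv_letter b \<notin> A" and ab: "inv_letter a \<noteq> b"
    and d: "cp v A + cp v B < dg v a + dg v b"
  shows "path (len v) (Wh A a \<star> v) (Wh B b \<star> v)"
proof -
  define S where "S = (if inv_letter a \<in> B then B \<union> A - {a} else B)"
  have S: "valid S b" "Wh S b \<bullet> Wh A a = Wh A a \<bullet> Wh B b"
    using Wh_disjoint_conj[OF A B AB _ b ab] Wh_disjoint_commute[OF A B AB _ b] B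
    by (auto simp: S_def Un_commute)
  have "tlen n (tmv S b (tmv A a (tup v))) + dg v a + dg v b = len v + cp v A + cp v B"
    unfolding len_def using A B AB ab v
    by (intro tlen_tmv_tmv_disjoint) (auto simp: valid_def S_def tup_reduced)
  then have "len (Wh S b \<star> (Wh A a \<star> v)) < len v"
    using d len_Wh_Wh[OF A S(1) v] by linarith
  moreover have "adj (Wh A a \<star> v) (Wh S b \<star> (Wh A a \<star> v))" using S(1) by (rule adj_Wh)
  moreover have "adj (Wh B b \<star> v) (Wh S b \<star> (Wh A a \<star> v))"
    using adj_Wh[OF A, of "Wh B b \<star> v"] comp_eq_app[OF S(2)] by simp
  ultimately show ?thesis by (blast intro: path_corner)
qed

lemma path_disjoint:
  assumes v: "v \<in> V" and A: "valid A a" and B: "valid B b" and AB: "A \<inter> B = {}"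
    and d: "cp v A \<le> dg v a" "cp v B \<le> dg v b" "cp v A + cp v B < dg v a + dg v b"
  shows "path (len v) (Wh A a \<star> v) (Wh B b \<star> v)"
proof -
  consider (opp) "b = inv_letter a" | (b) "b \<noteq> inv_letter a" "inv_letter b \<notin> A"
    | (a) "b \<noteq> inv_letter a" "inv_letter a \<notin> B"
    | (both) "b \<noteq> inv_letter a" "inv_letter b \<in> A" "inv_letter a \<in> B" by blast
  then show ?thesis
  proof cases
    case opp
    then show ?thesis using path_opp A B AB by simp
  next
    case b
    then show ?thesis using path_disjoint_one[OF v A B AB b(2) _ d(3)] by simp
  next
    case a
    then show ?thesis
      using path_sym[OF path_disjoint_one[OF v B A]] AB d(3) by (auto simp: inv_letter_eq_swap)
  next
    case both
    let ?a = "inv_letter a" and ?b = "inv_letter b"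
    \<comment> \<open>Each set now admits the inverse of the other multiplier as its own. By the
      strict inequality one of these two new moves shortens \<open>v\<close>.\<close>
    have Ba: "valid B ?a" and Ab: "valid A ?b" using A B AB both by (auto simp: valid_def)
    have b': "?b \<noteq> a" using both(1) by (auto simp: inv_letter_eq_swap)
    have 1: "path m (Wh A a \<star> v) (Wh B ?a \<star> v)" "path m (Wh B ?a \<star> v) (Wh B b \<star> v)" for m
      using path_opp[OF A Ba AB] path_swap[OF Ba B] both(1) by auto
    have 2: "path m (Wh A a \<star> v) (Wh A ?b \<star> v)" "path m (Wh A ?b \<star> v) (Wh B b \<star> v)" for m
      using path_opp[OF Ab _ AB] path_swap[OF A Ab] B b' by auto
    have "cp v B < dg v ?a \<or> cp v A < dg v ?b" using d by auto
    then show ?thesis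
      using path_trans[OF 1(1) _ 1(2)] path_trans[OF 2(1) _ 2(2)]
        len_Wh_less[OF Ba v] len_Wh_less[OF Ab v] by blast
  qed
qed

lemma path_nested:
  assumes v: "v \<in> V" and C: "valid C a" and B: "valid B b" and CB: "C \<subseteq> B"
    and d: "cp v C \<le> dg v a" "cp v B \<le> dg v b" "cp v C + cp v B < dg v a + dg v b"
  shows "path (len v) (Wh C a \<star> v) (Wh B b \<star> v)"
proof -
  let ?a = "inv_letter a" and ?b = "inv_letter b"
  have ab: "?a \<noteq> b" using C B CB by (auto simp: valid_def)
  \<comment> \<open>As long as \<open>b\<close> is outside \<open>C\<close>, the two moves close up
    to a square; the set \<open>S\<close> of the second edge depends on whether \<open>B\<close>
    contains the inverse of \<open>a\<close>.\<close>
  have S: ?thesis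
    if "b \<notin> C" "a \<noteq> b" "S = (if ?a \<notin> B then insert a (B - C) else B)" for S
  proof -
    have S: "valid S b" "Wh S b \<bullet> Wh C a = Wh C a \<bullet> Wh B b"
      using Wh_nested_conj[OF C B CB that(1)] Wh_nested_commute[OF C B CB that(1) _ ab] B
      by (auto simp: that(3))
    have "tlen n (tmv S b (tmv C a (tup v))) + dg v a + dg v b = len v + cp v C + cp v B"
      unfolding len_def using C B CB ab v that(2)
      by (intro tlen_tmv_tmv_superset) (auto simp: valid_def that(3) tup_reduced)
    then have "len (Wh S b \<star> (Wh C a \<star> v)) < len v"
      using d len_Wh_Wh[OF C S(1) v] by linarith
    moreover have "adj (Wh C a \<star> v) (Wh S b \<star> (Wh C a \<star> v))" using S(1) by (rule adj_Wh)
    moreover have "adj (Wh B b \<star> v) (Wh S b \<star> (Wh C a \<star> v))"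
      using adj_Wh[OF C, of "Wh B b \<star> v"] comp_eq_app[OF S(2)] by simp
    ultimately show ?thesis by (blast intro: path_corner)
  qed
  consider (same) "a = b" | (n) "a \<noteq> b" "b \<notin> C" | (swap) "a \<noteq> b" "b \<in> C" "?a \<notin> B"
    | (special) "a \<noteq> b" "b \<in> C" "?a \<in> B" by blast
  then show ?thesis
  proof cases
    case same
    then show ?thesis using path_same C B CB by simp
  next
    case n
    then show ?thesis using S by simp
  next
    case swap
    \<comment> \<open>Both sets admit both multipliers, and one of the exchanged pairings shortens
      \<open>v\<close>.\<close>
    have Ba: "valid B a" and Cb: "valid C b" using C B CB swap by (auto simp: valid_def)
    have 1: "path m (Wh C a \<star> v) (Wh B a \<star> v)" "path m (Wh B a \<star> v) (Wh B b \<star> v)" for m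
      using path_same[OF C Ba CB] path_swap[OF Ba B] swap by auto
    have 2: "path m (Wh C a \<star> v) (Wh C b \<star> v)" "path m (Wh C b \<star> v) (Wh B b \<star> v)" for m
      using path_same[OF Cb B CB] path_swap[OF C Cb] swap by auto
    have "cp v B < dg v a \<or> cp v C < dg v b" using d by auto
    then show ?thesis
      using path_trans[OF 1(1) _ 1(2)] path_trans[OF 2(1) _ 2(2)]
        len_Wh_less[OF Ba v] len_Wh_less[OF Cb v] by blast
  next
    case special
    \<comment> \<open>The far corner is reached from the side of \<open>C\<close> by the move
      \<open>(B, b)\<close> itself, and from the side of \<open>B\<close> by the move with set
      \<open>?R\<close> and the inverse of \<open>a\<close> as multiplier.\<close>
    let ?R = "insert ?b (B - C)"
    note R = Wh_nested_special[OF C B CB special(2,3,1)]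
    have "tlen n (tmv B b (tmv C a (tup v))) + dg v a + dg v b = len v + cp v C + cp v B"
      unfolding len_def using C B CB ab v special
      by (intro tlen_tmv_tmv_superset) (auto simp: valid_def tup_reduced)
    then have "len (Wh B b \<star> (Wh C a \<star> v)) < len v"
      using d len_Wh_Wh[OF C B v] by linarith
    moreover have "adj (Wh C a \<star> v) (Wh B b \<star> (Wh C a \<star> v))" using B by (rule adj_Wh)
    moreover have "adj (Wh B b \<star> v) (Wh B b \<star> (Wh C a \<star> v))"
      using adj_Wh[OF R(1), of "Wh B b \<star> v"] comp_eq_app[OF R(2)] by simp
    ultimately show ?thesis by (blast intro: path_corner)
  qed
qed

lemma path_compat:
  assumes "v \<in> V" "valid A a" "valid B b" "A \<subseteq> B \<or> B \<subseteq> A \<or> A \<inter> B = {}"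
    and "cp v A \<le> dg v a" "cp v B \<le> dg v b" "cp v A + cp v B < dg v a + dg v b"
  shows "path (len v) (Wh A a \<star> v) (Wh B b \<star> v)"
  using assms path_nested[of v A a B b] path_disjoint[of v A a B b]
    path_sym[OF path_nested[of v B b A a]] by (auto simp: add.commute)

text \<open>In the cases \<open>x\<close> and \<open>y\<close> each of the four regions cut out by \<open>A\<close> and \<open>B\<close> contains exactly one of
  \<open>a\<close>, \<open>b\<close> and their inverses; the letter of larger degree then serves as multiplier
  for both of its regions.\<close>

lemma strict_between:
  assumes A: "valid A a" and B: "valid B b"
    and d: "cp v A \<le> dg v a" "cp v B \<le> dg v b" "cp v A + cp v B < dg v a + dg v b"
  shows "\<exists>C c. C \<in> {A \<inter> B, A \<union> B, A - B, B - A} \<and> valid C c \<and> cp v C < dg v c"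
proof -
  let ?a = "inv_letter a" and ?b = "inv_letter b"
  have s: "cp v (A \<inter> B) + cp v (A \<union> B) < dg v a + dg v b"
     "cp v (A - B) + cp v (B - A) < dg v a + dg v b"
    using tcap_submodular[of n A B "tup v"] tcap_submodular_diff[of n A B "tup v"] d by auto
  have *: ?thesis if "valid C c" "valid D c'" "C \<in> {A \<inter> B, A \<union> B, A - B, B - A}"
    "D \<in> {A \<inter> B, A \<union> B, A - B, B - A}" "cp v C + cp v D < dg v c + dg v c'" for C c D c'
  proof (cases "cp v C < dg v c")
    case False
    then have "cp v D < dg v c'" using that(5) by linarith
    then show ?thesis using that by blast
  qed (use that in blast)
  have V: "a \<in> B \<Longrightarrow> valid (A \<inter> B) a" "b \<in> A \<Longrightarrow> valid (A \<inter> B) b"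
    "?a \<notin> B \<Longrightarrow> valid (A \<union> B) a" "?b \<notin> A \<Longrightarrow> valid (A \<union> B) b"
    "a \<notin> B \<Longrightarrow> valid (A - B) a" "?b \<in> A \<Longrightarrow> valid (A - B) ?b"
    "b \<notin> A \<Longrightarrow> valid (B - A) b" "?a \<in> B \<Longrightarrow> valid (B - A) ?a"
    using A B by (auto simp: valid_def)
  consider "a \<in> B" "?b \<notin> A" | "b \<in> A" "?a \<notin> B" | "a \<notin> B" "b \<notin> A" | "?b \<in> A" "?a \<in> B"
    | (x) "a \<in> B" "?a \<notin> B" "?b \<in> A" "b \<notin> A" | (y) "b \<in> A" "?b \<notin> A" "?a \<in> B" "a \<notin> B" by blast
  then show ?thesis
  proof cases
    case 1 then show ?thesis using *[OF V(1) V(4)] s(1) by simp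
  next
    case 2 then show ?thesis using *[OF V(2) V(3)] s(1) by simp
  next
    case 3 then show ?thesis using *[OF V(5) V(7)] s(2) by simp
  next
    case 4 then show ?thesis using *[OF V(6) V(8)] s(2) by simp
  next
    case x
    show ?thesis
    proof (cases "dg v b \<le> dg v a")
      case True
      then show ?thesis using *[OF V(1) V(3)] s(1) x by simp
    next
      case False
      then show ?thesis using *[OF V(6) V(7)] s(2) x by simp
    qed
  next
    case y
    show ?thesis
    proof (cases "dg v a \<le> dg v b")
      case True
      then show ?thesis using *[OF V(2) V(4)] s(1) y by simp
    next
      case False
      then show ?thesis using *[OF V(5) V(8)] s(2) y by simp
    qed
  qed
qed

text \<open>Each of the four candidate sets is nested with or disjoint from both \<open>A\<close>
  and \<open>B\<close>. The detour through a shorter neighbour of \<open>v\<close> therefore needs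
  only the compatible case, used twice.\<close>

lemma path_peak:
  assumes v: "v \<in> V" and A: "valid A a" and B: "valid B b"
    and d: "cp v A \<le> dg v a" "cp v B \<le> dg v b" "cp v A + cp v B < dg v a + dg v b"
  shows "path (len v) (Wh A a \<star> v) (Wh B b \<star> v)"
proof -
  obtain C c where C: "C \<in> {A \<inter> B, A \<union> B, A - B, B - A}" "valid C c" "cp v C < dg v c"
    using strict_between[OF A B d] by blast
  have "path (len v) (Wh A a \<star> v) (Wh C c \<star> v)"
    by (rule path_compat[OF v A C(2)]) (use C d in auto)
  moreover have "path (len v) (Wh C c \<star> v) (Wh B b \<star> v)"
    by (rule path_compat[OF v C(2) B]) (use C d in auto)
  ultimately show ?thesis using len_Wh_less[OF C(2) v] C(3) by (blast intro: path_trans)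
qed

end

section \<open>Elements reached from the signed permutations by increasing moves\<close>

locale based_acting = acting +
  fixes v0
  assumes v0_V: "v0 \<in> V" and tup_v0: "i \<in> {1..n} \<Longrightarrow> tup v0 i = [(i, False)]"
begin

inductive_set D where
  base: "f \<in> SP n \<Longrightarrow> \<iota> f \<star> v0 \<in> D"
| up: "v \<in> D \<Longrightarrow> valid A a \<Longrightarrow> len v < len (Wh A a \<star> v) \<Longrightarrow> Wh A a \<star> v \<in> D"

lemma D_V: "v \<in> D \<Longrightarrow> v \<in> V"
  by (induction rule: D.induct) (auto simp: iota_V v0_V Wh_V)

text \<open>A signed permutation is carried through the increasing moves down to the base, where it
  is absorbed; the lengths along the way do not change.\<close>

lemma D_iota: "v \<in> D \<Longrightarrow> f \<in> SP n \<Longrightarrow> \<iota> f \<star> v \<in> D"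
proof (induction rule: D.induct)
  case (base g)
  have "\<iota> f \<star> (\<iota> g \<star> v0) = \<iota> (f \<circ> g) \<star> v0" using base by (simp flip: iota_comp mul_app)
  then show ?case using D.base[OF SP_comp[OF base(2,1)]] by simp
next
  case (up v A a)
  have "\<iota> f \<star> (Wh A a \<star> v) = Wh (f ` A) (f a) \<star> (\<iota> f \<star> v)"
    using comp_eq_app[OF iota_Wh[OF up.prems up.hyps(2)]] by simp
  then show ?case
    using up D.up[OF up.IH[OF up.prems] valid_SP[OF up.prems up.hyps(2)]] len_iota D_V Wh_V by metis
qed

lemma len_base: "f \<in> SP n \<Longrightarrow> len (\<iota> f \<star> v0) = n"
  by (simp add: len_iota v0_V) (simp add: len_def tlen_def tup_v0)

lemma D_len_n: "v \<in> D \<Longrightarrow> len v = n \<Longrightarrow> \<exists>f\<in>SP n. v = \<iota> f \<star> v0"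
  by (erule D.cases) (use len_ge D_V in force)+

text \<open>After a move that does not increase the minimal length all words are still single
  letters, but a letter of \<open>A\<close> other than \<open>a\<close> would lengthen the word that
  carries it or its inverse.\<close>

lemma Wh_base:
  assumes f: "f \<in> SP n" and A: "valid A a" and l: "len (Wh A a \<star> (\<iota> f \<star> v0)) \<le> n"
  shows "Wh A a = u"
proof -
  let ?v = "\<iota> f \<star> v0" and ?w = "\<lambda>i. tup (Wh A a \<star> (\<iota> f \<star> v0)) i"
  have v: "?v \<in> V" using f v0_V by (rule iota_V)
  have w: "?w i = mv A a False [f (i, False)]" if "i \<in> {1..n}" for i
    using tup_Wh[OF A v that] that f v0_V by (simp add: tmv_def tup_iota tup_v0)
  have ge: "1 \<le> length (?w i)" if "i \<in> {1..n}" for i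
    using tup_nonempty[OF Wh_V[OF A v] that] by (simp add: Suc_leI)
  have le: "length (?w i) \<le> 1" if i: "i \<in> {1..n}" for i
  proof (rule ccontr)
    assume "\<not> ?thesis"
    then have "(\<Sum>i=1..n. 1) < (\<Sum>i=1..n. length (?w i))"
      using i ge by (intro sum_strict_mono_ex1) (auto simp: not_le)
    then show False using l by (simp add: len_def tlen_def)
  qed
  have "x = a" if x: "x \<in> A" for x
  proof (rule ccontr)
    assume xa: "x \<noteq> a"
    have x': "x \<noteq> inv_letter a" using x A by (auto simp: valid_def)
    have "pinv f x \<in> letters n" using x A f by (auto simp: valid_def SP_letters SP_pinv)
    then obtain i b where i: "i \<in> {1..n}" "pinv f x = (i, b)" by (auto simp: letters_def)
    have "f (i, b) = x" using f i(2) by (metis SP_pinv_app(2))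
    then have "f (i, False) = x \<or> f (i, False) = inv_letter x"
      using SP_inv[OF f, of "(i, False)"] by (cases b) (auto simp: inv_letter_eq_swap)
    then have "1 < length (?w i)" using w[OF i(1)] x xa x' by (auto simp: inv_letter_eq_swap)
    then show False using le[OF i(1)] by simp
  qed
  then have "A = {a}" using A by (auto simp: valid_def)
  then show ?thesis by simp
qed

text \<open>Each edge of the path either stays below \<open>m\<close>, where the assumption applies,
  or is the last one and climbs from below \<open>m\<close> to \<open>m\<close>, where the rule
  \<open>up\<close> applies.\<close>

lemma path_D:
  assumes IH: "\<And>v A a. v \<in> D \<Longrightarrow> valid A a \<Longrightarrow> len v < m \<Longrightarrow> len (Wh A a \<star> v) < m \<Longrightarrow> Wh A a \<star> v \<in> D"
    and "path m g g'" "g \<in> D" "len g < m" "len g' \<le> m"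
  shows "g' \<in> D"
proof -
  have adjD: "h' \<in> D" if h: "h \<in> D" "len h < m" "len h' \<le> m" "adj h h'" for h h'
  proof -
    obtain f A a where f: "f \<in> SP n" "valid A a" "h' = \<iota> f \<star> (Wh A a \<star> h)" using h(4) by (auto simp: adj_def)
    have "len (Wh A a \<star> h) \<le> m" using h f len_iota[OF f(1)] Wh_V D_V by metis
    then have "Wh A a \<star> h \<in> D"
      using IH[OF h(1) f(2) h(2)] D.up[OF h(1) f(2)] h(2) by linarith
    then show ?thesis using f D_iota by simp
  qed
  show ?thesis using assms(2-) by (induction rule: path.induct) (use adjD in auto)
qed

lemma D_Wh: "v \<in> D \<Longrightarrow> valid A a \<Longrightarrow> Wh A a \<star> v \<in> D"
proof (induction "max (len v) (len (Wh A a \<star> v))" arbitrary: v A a rule: less_induct)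
  case less
  have v: "v \<in> V" using less.prems D_V by blast
  show ?case
  proof (cases "len v < len (Wh A a \<star> v)")
    case True
    then show ?thesis using less.prems D.up by blast
  next
    case False
    then have le: "len (Wh A a \<star> v) \<le> len v" by simp
    from less.prems(1) show ?thesis
    proof cases
      case (base f)
      then have "Wh A a = u" using Wh_base less.prems(2) le len_base by metis
      then show ?thesis using less.prems(1) by simp
    next
      \<comment> \<open>\<open>v\<close> arose from the shorter \<open>v'\<close>, and the target is
        no longer than \<open>v\<close>. So \<open>v\<close> is a peak between \<open>v'\<close> and
        the target, and the path around it stays below \<open>len v\<close>, within reach of the
        induction on the larger of the two lengths.\<close>
      case (up v' B b)
      let ?B = "invset B b" and ?b = "inv_letter b"
      have B: "valid ?B ?b" by (rule valid_invset[OF up(3)])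
      have v': "v' = Wh ?B ?b \<star> v" using comp_eq_app[OF Wh_inv(2)[OF up(3)]] up(1) by simp
      have lt: "len v' < len v" using up by simp
      have "path (len v) v' (Wh A a \<star> v)"
        unfolding v' using lt le v' len_Wh_less[OF B v] len_Wh_le[OF less.prems(2) v]
        by (intro path_peak[OF v B less.prems(2)]) auto
      then show ?thesis
        by (rule path_D[rotated]) (use up lt le less.hyps in auto)
    qed
  qed
qed

lemma D_eta: "v \<in> D \<Longrightarrow> \<eta> \<star> v \<in> D"
proof -
  assume v: "v \<in> D"
  have "valid {(1, True), (2, False)} (2, False)" by (auto simp: valid_def)
  moreover have "Wh {(1, True), (2, False)} (2, False) = E (1, True) (2, False)"
    by (simp add: Wh_def insert_Diff_if)
  ultimately have "E (1, True) (2, False) \<star> (\<iota> (tauL 2) \<star> v) \<in> D"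
    using D_Wh[OF D_iota[OF v]] by (metis sw_SP small_letters(3))
  then show ?thesis using comp_eq_app[OF eta_E] by simp
qed

end

section \<open>Stallings folding and cut letters\<close>

fun run :: "('p \<times> (nat \<times> bool) \<times> 'p) set \<Rightarrow> 'p \<Rightarrow> nat word \<Rightarrow> 'p \<Rightarrow> bool" where
  "run E p [] q \<longleftrightarrow> p = q"
| "run E p (l # w) q \<longleftrightarrow> (\<exists>r. (p, l, r) \<in> E \<and> run E r w q)"

lemma run_append: "run E p (v @ w) q \<longleftrightarrow> (\<exists>r. run E p v r \<and> run E r w q)"
  by (induction v arbitrary: p) auto

definition esym :: "('p \<times> (nat \<times> bool) \<times> 'p) set \<Rightarrow> bool" where
  "esym E \<longleftrightarrow> (\<forall>p l q. (p, l, q) \<in> E \<longrightarrow> (q, inv_letter l, p) \<in> E)"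

lemma esymD: "esym E \<Longrightarrow> (p, l, q) \<in> E \<Longrightarrow> (q, inv_letter l, p) \<in> E"
  unfolding esym_def by blast

lemma run_inv_word: "esym E \<Longrightarrow> run E p w q \<Longrightarrow> run E q (inv_word w) p"
  by (induction w arbitrary: p) (use esymD in \<open>force simp: inv_word_Cons run_append\<close>)+

text \<open>In a folded graph a cancelling pair of letters returns to the vertex where it started,
  so removing it keeps both ends of the run.\<close>

lemma run_norm:
  assumes "esym E" and det: "\<And>p l q r. (p, l, q) \<in> E \<Longrightarrow> (p, l, r) \<in> E \<Longrightarrow> q = r"
  shows "run E p w q \<Longrightarrow> run E p (norm w) q"
proof (induction w arbitrary: p)
  case (Cons l w)
  then obtain r where r: "(p, l, r) \<in> E" "run E r (norm w) q" by auto
  show ?case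
  proof (cases "\<exists>v. norm w = inv_letter l # v")
    case True
    then obtain v where v: "norm w = inv_letter l # v" by blast
    then obtain r' where "(r, inv_letter l, r') \<in> E" "run E r' v q" using r(2) by auto
    moreover have "(r, inv_letter l, p) \<in> E" using assms(1) r(1) by (simp add: esym_def)
    ultimately have "run E p v q" using det by blast
    then show ?thesis by (simp add: norm_Cons v ins_letter_def)
  next
    case False
    then have "norm (l # w) = l # norm w" by (auto simp: norm_Cons ins_letter_def split: list.split)
    then show ?thesis using r by auto
  qed
qed simp

locale generating_tuple =
  fixes n :: nat and w :: "nat \<Rightarrow> nat word"
  assumes reduced_w: "i \<in> {1..n} \<Longrightarrow> reduced (w i)"
    and letters_w: "i \<in> {1..n} \<Longrightarrow> set (w i) \<subseteq> letters n"
    and nonempty_w: "i \<in> {1..n} \<Longrightarrow> w i \<noteq> []"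
    and gen_w: "j \<in> {1..n} \<Longrightarrow> \<exists>v. set v \<subseteq> letters n \<and>
      norm (concat (map (\<lambda>(i, b). if b then inv_word (w i) else w i) v)) = [(j, False)]"
begin

text \<open>The vertices of the wedge before any identification: position \<open>k\<close> of a word
  lies after \<open>k\<close> letters, so there is one more position than there are letters.
  \<open>Pos'\<close> indexes the letters, that is, the edges.\<close>

definition Pos :: "(nat \<times> nat) set" where
  "Pos = (SIGMA i:{1..n}. {..length (w i)})"

definition Pos' :: "(nat \<times> nat) set" where
  "Pos' = (SIGMA i:{1..n}. {..<length (w i)})"

text \<open>The graph obtained from the wedge of circles labelled by the words \<open>w i\<close>
  by identifying the positions that have the same value under \<open>f\<close>.\<close>

definition edge :: "(nat \<times> nat \<Rightarrow> 'p) \<Rightarrow> nat \<times> nat \<Rightarrow> 'p \<times> (nat \<times> bool) \<times> 'p" where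
  "edge f x = (f x, w (fst x) ! snd x, f (fst x, Suc (snd x)))"

definition flip :: "'p \<times> (nat \<times> bool) \<times> 'p \<Rightarrow> 'p \<times> (nat \<times> bool) \<times> 'p" where
  "flip x = (case x of (p, l, q) \<Rightarrow> (q, inv_letter l, p))"

definition edges :: "(nat \<times> nat \<Rightarrow> 'p) \<Rightarrow> ('p \<times> (nat \<times> bool) \<times> 'p) set" where
  "edges f = edge f ` Pos' \<union> flip ` edge f ` Pos'"

text \<open>Every edge is present in both orientations; counting uses the one with a positive
  label.\<close>

definition pos_edges :: "(nat \<times> nat \<Rightarrow> 'p) \<Rightarrow> ('p \<times> (nat \<times> bool) \<times> 'p) set" where
  "pos_edges f = {x \<in> edges f. \<not> snd (fst (snd x))}"

text \<open>The inequality bounds the rank of the graph by \<open>n\<close>, the rank of a connected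
  graph being edges minus vertices plus one. The last condition excludes a rose.\<close>

definition good :: "'p \<Rightarrow> (nat \<times> nat \<Rightarrow> 'p) \<Rightarrow> bool" where
  "good p f \<longleftrightarrow> (\<forall>i\<in>{1..n}. f (i, 0) = p \<and> f (i, length (w i)) = p) \<and>
     card (pos_edges f) + 1 \<le> card (f ` Pos) + n \<and> 2 \<le> card (f ` Pos)"

lemma finite_Pos [simp]: "finite Pos" "finite Pos'"
  by (auto simp: Pos_def Pos'_def)

lemma flip_flip [simp]: "flip (flip x) = x"
  by (cases x) (simp add: flip_def)

lemma finite_edges [simp]: "finite (edges f)" "finite (pos_edges f)"
  by (simp_all add: edges_def pos_edges_def)

lemma esym_edges: "esym (edges f)"
proof -
  have "flip x \<in> edges f" if "x \<in> edges f" for x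
    using that by (auto simp: edges_def)
  then show ?thesis by (force simp: esym_def flip_def)
qed

lemma edges_sym: "(p, l, q) \<in> edges f \<Longrightarrow> (q, inv_letter l, p) \<in> edges f"
  by (rule esymD[OF esym_edges])

lemma edge_in: "i \<in> {1..n} \<Longrightarrow> k < length (w i) \<Longrightarrow> (f (i, k), w i ! k, f (i, Suc k)) \<in> edges f"
  by (force simp: edges_def edge_def Pos'_def)

lemma edges_cases:
  assumes "(p, l, q) \<in> edges f"
  obtains i k where "i \<in> {1..n}" "k < length (w i)"
    "(p, l, q) = (f (i, k), w i ! k, f (i, Suc k)) \<or> (q, inv_letter l, p) = (f (i, k), w i ! k, f (i, Suc k))"
  using assms by (auto simp: edges_def edge_def Pos'_def flip_def)

lemma edges_letters: "(p, l, q) \<in> edges f \<Longrightarrow> l \<in> letters n"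
proof (erule edges_cases)
  fix i k assume *: "i \<in> {1..n}" "k < length (w i)"
    "(p, l, q) = (f (i, k), w i ! k, f (i, Suc k)) \<or> (q, inv_letter l, p) = (f (i, k), w i ! k, f (i, Suc k))"
  then have "w i ! k \<in> letters n" using letters_w nth_mem by blast
  then have "l \<in> letters n \<or> inv_letter l \<in> letters n" using *(3) by (metis prod.inject)
  then show ?thesis by simp
qed

lemma edges_vertices: "(p, l, q) \<in> edges f \<Longrightarrow> p \<in> f ` Pos \<and> q \<in> f ` Pos"
  by (erule edges_cases) (auto simp: Pos_def)

lemma run_w:
  assumes "good p f" "i \<in> {1..n}" shows "run (edges f) p (w i) p"
proof -
  have "k \<le> length (w i) \<Longrightarrow> run (edges f) (f (i, k)) (drop k (w i)) p" for k
  proof (induction k rule: inc_induct)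
    case (step k)
    have "drop k (w i) = w i ! k # drop (Suc k) (w i)" using step by (simp add: Cons_nth_drop_Suc)
    then show ?case using step edge_in[OF assms(2) step(2)] by auto
  qed (use assms in \<open>auto simp: good_def\<close>)
  from this[of 0] show ?thesis using assms by (auto simp: good_def)
qed

lemma run_concat:
  assumes "good p f" "set v \<subseteq> letters n"
  shows "run (edges f) p (concat (map (\<lambda>(i, b). if b then inv_word (w i) else w i) v)) p"
  using assms(2)
proof (induction v)
  case (Cons x v)
  obtain i b where x: "x = (i, b)" by (cases x)
  then have i: "i \<in> {1..n}" using Cons.prems by (simp add: letters_def)
  have "run (edges f) p (if b then inv_word (w i) else w i) p"
    using run_w[OF assms(1) i] run_inv_word[OF esym_edges] by auto
  then show ?case using Cons x by (auto simp: run_append)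
qed simp

text \<open>In a folded graph each generator could be read as a loop at the base, because it is the
  normal form of a product of the words \<open>w i\<close>. Determinism would then force every
  position onto the base, leaving one vertex.\<close>

lemma good_not_det:
  assumes "good b f"
  shows "\<exists>p l q r. (p, l, q) \<in> edges f \<and> (p, l, r) \<in> edges f \<and> q \<noteq> r"
proof (rule ccontr)
  assume "\<not> ?thesis"
  then have det: "q = r" if "(p, l, q) \<in> edges f" "(p, l, r) \<in> edges f" for p l q r
    using that by blast
  have loop: "(b, (j, False), b) \<in> edges f" if j: "j \<in> {1..n}" for j
  proof -
    obtain v where v: "set v \<subseteq> letters n"
      "norm (concat (map (\<lambda>(i, b). if b then inv_word (w i) else w i) v)) = [(j, False)]"
      using gen_w[OF j] by blast
    have "run (edges f) b (norm (concat (map (\<lambda>(i, b). if b then inv_word (w i) else w i) v))) b"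
      by (rule run_norm[OF esym_edges det run_concat[OF assms v(1)]])
    then show ?thesis unfolding v(2) by simp
  qed
  have loop': "(b, l, b) \<in> edges f" if "l \<in> letters n" for l
    using that loop[of "fst l"] edges_sym[OF loop[of "fst l"]] by (cases l; cases "snd l") (auto simp: letters_def)
  have "f (i, k) = b" if i: "i \<in> {1..n}" and "k \<le> length (w i)" for i k
    using that(2)
  proof (induction k)
    case 0
    then show ?case using assms i by (simp add: good_def)
  next
    case (Suc k)
    have "w i ! k \<in> letters n" using letters_w[OF i] Suc.prems by (auto simp: subset_iff)
    then show ?case using edge_in[OF i, of k f] Suc loop' det by simp
  qed
  then have "f ` Pos \<subseteq> {b}" by (auto simp: Pos_def)
  then have "card (f ` Pos) \<le> 1" using card_mono[of "{b}"] by simp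
  then show False using assms by (simp add: good_def)
qed

lemma edge_comp: "edge (g \<circ> f) x = (case edge f x of (p, l, q) \<Rightarrow> (g p, l, g q))"
  by (simp add: edge_def)

lemma edges_comp: "edges (g \<circ> f) = (\<lambda>(p, l, q). (g p, l, g q)) ` edges f"
proof -
  let ?h = "\<lambda>(p, l, q). (g p, l, g q)"
  have "flip (?h x) = ?h (flip x)" for x by (cases x) (simp add: flip_def)
  then show ?thesis by (simp add: edges_def edge_comp[abs_def] image_Un image_image)
qed

lemma pos_edges_comp: "pos_edges (g \<circ> f) = (\<lambda>(p, l, q). (g p, l, g q)) ` pos_edges f"
  by (force simp: pos_edges_def edges_comp)

text \<open>Folding the two edges at \<open>p\<close> removes one vertex and at least one edge, so it preserves \<open>good\<close>
  unless only two vertices were left.\<close>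

lemma exists_two_vertex_graph:
  assumes "good b f" "\<And>g. good b g \<Longrightarrow> card (f ` Pos) \<le> card (g ` Pos)"
    and pq: "(p, l, q) \<in> edges f" "(p, l, r) \<in> edges f" "q \<noteq> r"
  shows "card (f ` Pos) = 2"
proof -
  \<comment> \<open>The vertex that disappears is taken different from the base, so that the base
    keeps its name.\<close>
  have "\<exists>x y. {x, y} = {q, r} \<and> x \<noteq> b"
    by (cases "q = b") (use pq(3) in blast)+
  then obtain x y where xy: "{x, y} = {q, r}" "x \<noteq> b" by blast
  define g where "g z = (if z = x then y else z)" for z
  have V: "x \<in> f ` Pos" "y \<in> f ` Pos" "x \<noteq> y"
    using edges_vertices[OF pq(1)] edges_vertices[OF pq(2)] xy pq(3) by (auto simp: doubleton_eq_iff)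
  have gqr: "g q = g r" using xy by (auto simp: g_def doubleton_eq_iff)
  have img: "(g \<circ> f) ` Pos = f ` Pos - {x}"
    using V by (auto simp: g_def image_iff image_comp[symmetric] split: if_splits)
  then have card: "card ((g \<circ> f) ` Pos) = card (f ` Pos) - 1" using V by simp
  have "\<not> inj_on (\<lambda>(p, l, q). (g p, l, g q)) (pos_edges f)"
  proof (cases "snd l")
    case False
    then have "(p, l, q) \<in> pos_edges f" "(p, l, r) \<in> pos_edges f" using pq by (auto simp: pos_edges_def)
    then show ?thesis using gqr pq(3) inj_onD[of "\<lambda>(p, l, q). (g p, l, g q)" _ "(p, l, q)" "(p, l, r)"] by auto
  next
    case True
    then have "(q, inv_letter l, p) \<in> pos_edges f" "(r, inv_letter l, p) \<in> pos_edges f"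
      using edges_sym[OF pq(1)] edges_sym[OF pq(2)] by (auto simp: pos_edges_def inv_letter_def)
    then show ?thesis
      using gqr pq(3) inj_onD[of "\<lambda>(p, l, q). (g p, l, g q)" _ "(q, inv_letter l, p)" "(r, inv_letter l, p)"] by auto
  qed
  then have "card (pos_edges (g \<circ> f)) < card (pos_edges f)"
    unfolding pos_edges_comp
    by (metis card_image_le eq_card_imp_inj_on finite_edges(2) le_neq_implies_less)
  then have "\<not> 2 \<le> card ((g \<circ> f) ` Pos)"
  proof (rule contrapos_pn)
    assume 2: "2 \<le> card ((g \<circ> f) ` Pos)"
    show "\<not> card (pos_edges (g \<circ> f)) < card (pos_edges f)"
    proof
      assume "card (pos_edges (g \<circ> f)) < card (pos_edges f)"
      moreover have "g b = b" using xy by (simp add: g_def)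
      ultimately have "good b (g \<circ> f)" using assms(1) card 2 by (auto simp: good_def)
      then have "card (f ` Pos) \<le> card ((g \<circ> f) ` Pos)" by (rule assms(2))
      then show False using card 2 by linarith
    qed
  qed
  moreover have "2 \<le> card (f ` Pos)" using assms(1) by (simp add: good_def)
  ultimately show ?thesis using card by linarith
qed

lemma letter_occurs:
  assumes "j \<in> {1..n}"
  shows "\<exists>i\<in>{1..n}. \<exists>b. (j, b) \<in> set (w i)"
proof (rule ccontr)
  assume a: "\<not> ?thesis"
  obtain v where v: "set v \<subseteq> letters n"
    "norm (concat (map (\<lambda>(i, b). if b then inv_word (w i) else w i) v)) = [(j, False)]"
    using gen_w[OF assms] by blast
  have "(j, False) \<in> set (concat (map (\<lambda>(i, b). if b then inv_word (w i) else w i) v))"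
    using set_norm[of "concat (map (\<lambda>(i, b). if b then inv_word (w i) else w i) v)"] v(2) by simp
  then obtain i b where "(i, b) \<in> set v" "(j, False) \<in> set (if b then inv_word (w i) else w i)" by auto
  then have "i \<in> {1..n}" "\<exists>b. (j, b) \<in> set (w i)"
    using v(1) by (auto simp: letters_def inv_word_def inv_letter_def split: if_splits)
  then show False using a by blast
qed

lemma label_ex:
  assumes "j \<in> {1..n}"
  shows "\<exists>p q. (p, (j, False), q) \<in> pos_edges f"
proof -
  obtain i b k where "i \<in> {1..n}" "k < length (w i)" "w i ! k = (j, b)"
    using letter_occurs[OF assms] by (auto simp: in_set_conv_nth)
  then have "(f (i, k), (j, b), f (i, Suc k)) \<in> edges f" using edge_in[of i k f] by simp
  then have "\<exists>p q. (p, (j, False), q) \<in> edges f" using edges_sym by (cases b) fastforce+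
  then show ?thesis by (auto simp: pos_edges_def)
qed

definition fiber :: "(nat \<times> nat \<Rightarrow> 'p) \<Rightarrow> nat \<Rightarrow> ('p \<times> (nat \<times> bool) \<times> 'p) set" where
  "fiber f j = {x \<in> pos_edges f. fst (fst (snd x)) = j}"

lemma card_pos_edges: "card (pos_edges f) = (\<Sum>j=1..n. card (fiber f j))"
proof -
  have "pos_edges f = (\<Union>j\<in>{1..n}. fiber f j)"
    using edges_letters by (fastforce simp: fiber_def pos_edges_def letters_def)
  moreover have "card (\<Union>j\<in>{1..n}. fiber f j) = (\<Sum>j=1..n. card (fiber f j))"
    by (rule card_UN_disjoint) (auto simp: fiber_def)
  ultimately show ?thesis by simp
qed

text \<open>All \<open>n\<close> labels occur, so among at most \<open>n + 1\<close> edges a label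
  carried twice uses up the only surplus.\<close>

lemma fiber_cards:
  assumes "card (pos_edges f) \<le> n + 1" "j0 \<in> {1..n}" "2 \<le> card (fiber f j0)"
  shows "card (fiber f j0) = 2" "j \<in> {1..n} \<Longrightarrow> j \<noteq> j0 \<Longrightarrow> card (fiber f j) = 1"
proof -
  have ge: "1 \<le> card (fiber f j)" if j: "j \<in> {1..n}" for j
  proof -
    have "fiber f j \<noteq> {}" using label_ex[OF j, of f] by (auto simp: fiber_def)
    then show ?thesis by (simp add: Suc_le_eq card_gt_0_iff fiber_def)
  qed
  have s: "(\<Sum>j=1..n. card (fiber f j)) = card (fiber f j0) + (\<Sum>j\<in>{1..n}-{j0}. card (fiber f j))"
    using assms(2) by (simp add: sum.remove)
  have t: "(\<Sum>j\<in>{1..n}-{j0}. 1) = n - 1" using assms(2) by simp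
  have le: "(\<Sum>j\<in>{1..n}-{j0}. 1) \<le> (\<Sum>j\<in>{1..n}-{j0}. card (fiber f j))"
    using ge by (intro sum_mono) auto
  have n: "1 \<le> n" using assms(2) by simp
  show "card (fiber f j0) = 2" using s t le assms(1,3) card_pos_edges[of f] n by linarith
  show "card (fiber f j) = 1" if j: "j \<in> {1..n}" "j \<noteq> j0"
  proof (rule ccontr)
    assume "card (fiber f j) \<noteq> 1"
    then have "1 < card (fiber f j)" using ge[OF j(1)] by simp
    then have "(\<Sum>j\<in>{1..n}-{j0}. 1) < (\<Sum>j\<in>{1..n}-{j0}. card (fiber f j))"
      using ge j by (intro sum_strict_mono_ex1) auto
    then show False using s t assms(1,3) card_pos_edges[of f] n by linarith
  qed
qed

text \<open>In a graph with vertices \<open>p\<close>, \<open>q\<close> in which only the label \<open>c\<close> occurs twice, with both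
  edges leaving \<open>p\<close>, the letter \<open>c\<close> is a cut vertex of the Whitehead graph.\<close>

lemma cut_le_deg:
  assumes f: "f (i, 0) = b" "f (i, length (w i)) = b" and i: "i \<in> {1..n}"
    and V: "\<And>k. k \<le> length (w i) \<Longrightarrow> f (i, k) \<in> {p, q}" "p \<noteq> q" "b \<in> {p, q}"
    and e1: "\<And>x y z. (x, y, z) \<in> edges f \<Longrightarrow> y \<noteq> c \<Longrightarrow> y \<noteq> inv_letter c \<Longrightarrow> y \<in> S \<longleftrightarrow> z = q"
    and e2: "\<And>x z. (x, c, z) \<in> edges f \<Longrightarrow> x = p"
    and c: "c \<in> S" "inv_letter c \<notin> S" and z: "z \<longleftrightarrow> b = q"
  shows "cut S z z (w i) + (\<Sum>k<length (w i). of_bool ((w i ! k = c \<and> f (i, Suc k) = q) \<or>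
      (w i ! k = inv_letter c \<and> f (i, k) = q))) \<le> wdeg c (w i)"
proof -
  let ?l = "length (w i)"
  define h where "h k = (of_bool ((w i ! k = c \<and> f (i, Suc k) = q) \<or> (w i ! k = inv_letter c \<and> f (i, k) = q)) :: nat)" for k
  \<comment> \<open>The invariant, established from the end of the word: \<open>s\<close> is the
    side of the letter just read. It can disagree with the current vertex only after an occurrence
    of \<open>c\<close> that ends at \<open>p\<close>, and the extra unit on the right pays for the
    crossing this may cause.\<close>
  have "k \<le> ?l \<Longrightarrow> (\<And>s. (f (i, k) = q \<longrightarrow> s) \<Longrightarrow>
     cut S z s (drop k (w i)) + (\<Sum>m=k..<?l. h m) \<le> of_bool (s \<and> f (i, k) = p) + wdeg c (drop k (w i)))" for k
  proof (induction k rule: inc_induct)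
    case base
    then show ?case using f V(2,3) z by auto
  next
    case (step k)
    let ?y = "w i ! k" and ?q = "f (i, k)" and ?q' = "f (i, Suc k)" and ?v = "drop (Suc k) (w i)"
    have d: "drop k (w i) = ?y # ?v" using step by (simp add: Cons_nth_drop_Suc)
    have sm: "(\<Sum>m=k..<?l. h m) = h k + (\<Sum>m=Suc k..<?l. h m)"
      using step(2) by (simp add: sum.atLeast_Suc_lessThan)
    have E: "(?q, ?y, ?q') \<in> edges f" by (rule edge_in[OF i step(2)])
    have E': "(?q', inv_letter ?y, ?q) \<in> edges f" by (rule edges_sym[OF E])
    have Vq: "?q \<in> {p, q}" "?q' \<in> {p, q}" using V(1)[of k] V(1)[of "Suc k"] step(2) by auto
    consider (c) "?y = c" | (c') "?y = inv_letter c" | (o) "?y \<noteq> c" "?y \<noteq> inv_letter c" by blast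
    then show ?case
    proof cases
      case c
      have q: "?q = p" using e2 E c by simp
      have hk: "h k = of_bool (?q' = q)" using q V(2) by (simp add: h_def c)
      have "cut S z True ?v + (\<Sum>m=Suc k..<?l. h m) \<le> of_bool (?q' = p) + wdeg c ?v"
        using step.IH[of True] by simp
      then show ?thesis using V(2) Vq \<open>c \<in> S\<close> \<open>inv_letter c \<notin> S\<close> hk q unfolding sm d
        by (auto simp: c wdeg_def)
    next
      case c'
      have q: "?q' = p" using e2 E' c' by simp
      have hk: "h k = of_bool (?q = q)" using V(2) by (simp add: h_def c')
      have "cut S z False ?v + (\<Sum>m=Suc k..<?l. h m) \<le> wdeg c ?v"
        using step.IH[of False] V(2) q by simp
      then show ?thesis using V(2) Vq \<open>c \<in> S\<close> \<open>inv_letter c \<notin> S\<close> hk step.prems unfolding sm d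
        by (auto simp: c' wdeg_def)
    next
      case o
      have hk: "h k = 0" using o by (simp add: h_def)
      have y: "?y \<in> S \<longleftrightarrow> ?q' = q" using e1[OF E] o by simp
      have y': "inv_letter ?y \<in> S \<longleftrightarrow> ?q = q" using e1[OF E'] o by (auto simp: inv_letter_eq_swap)
      have "cut S z (?y \<in> S) ?v + (\<Sum>m=Suc k..<?l. h m) \<le> wdeg c ?v"
        using step.IH[of "?y \<in> S"] y V(2) by auto
      then show ?thesis using V(2) Vq hk step.prems o unfolding sm d
        by (auto simp: wdeg_def y')
    qed
  qed
  from this[of 0 z] show ?thesis
    using f z V(2,3) by (auto simp: h_def atLeast0LessThan)
qed

text \<open>Each letter position gives one undirected edge, which \<open>?h\<close> orients so that
  its label is positive.\<close>

lemma card_pos_edges_le: "card (pos_edges f) \<le> card Pos'"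
proof -
  let ?h = "\<lambda>x. if snd (fst (snd (edge f x))) then flip (edge f x) else edge f x"
  have "x \<in> ?h ` Pos'" if x: "x \<in> pos_edges f" for x
  proof -
    obtain y where y: "y \<in> Pos'" "x = edge f y \<or> x = flip (edge f y)"
      using x by (auto simp: pos_edges_def edges_def)
    then have "x = ?h y" using x by (auto simp: pos_edges_def flip_def inv_letter_def split: prod.splits)
    then show ?thesis using y(1) by blast
  qed
  then have "pos_edges f \<subseteq> ?h ` Pos'" by blast
  then show ?thesis by (rule surj_card_le[rotated]) simp
qed

text \<open>This is the wedge of circles, in which only the ends of the words are identified. Word
  indices start at 1, so \<open>(0, 0)\<close> is free to name the base, and a word of length at
  least two supplies a second vertex.\<close>

lemma exists_good:
  assumes "n < tlen n w"
  shows "good (0, 0) (\<lambda>(i, k). if k = 0 \<or> k = length (w i) then (0, 0) else (i, k))"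
proof -
  let ?f = "\<lambda>(i, k). if k = 0 \<or> k = length (w i) then (0, 0) else (i, k)"
  have "card (pos_edges ?f) \<le> card Pos'"
    by (rule card_pos_edges_le)
  moreover have "card Pos' = tlen n w" by (simp add: Pos'_def tlen_def)
  moreover have "card (?f ` Pos) = 1 + (\<Sum>i=1..n. length (w i) - 1)"
  proof -
    have "0 < n" using assms by (cases n) (auto simp: tlen_def)
    then have "(1, 0) \<in> Pos" by (simp add: Pos_def)
    then have "?f (1, 0) \<in> ?f ` Pos" by (rule imageI)
    then have 0: "(0, 0) \<in> ?f ` Pos" by simp
    have "?f ` Pos = insert (0, 0) (SIGMA i:{1..n}. {1..<length (w i)})" (is "_ = ?R")
    proof (intro equalityI subsetI)
      fix x assume "x \<in> ?f ` Pos"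
      then obtain i k where "i \<in> {1..n}" "k \<le> length (w i)" "x = ?f (i, k)" by (auto simp: Pos_def)
      then show "x \<in> ?R" by (cases "k = 0 \<or> k = length (w i)") auto
    next
      fix x assume x: "x \<in> ?R"
      show "x \<in> ?f ` Pos"
      proof (cases "x = (0, 0)")
        case False
        then have 1: "x \<in> Pos" "?f x = x" using x by (auto simp: Pos_def)
        show ?thesis using imageI[OF 1(1), of ?f] unfolding 1(2) .
      qed (use 0 in simp)
    qed
    then show ?thesis by (simp add: card_insert_if)
  qed
  moreover have "(\<Sum>i=1..n. length (w i) - 1) + n = tlen n w"
  proof -
    have "(\<Sum>i=1..n. length (w i) - 1) + (\<Sum>i=1..n. 1) = (\<Sum>i=1..n. length (w i))"
      using nonempty_w unfolding sum.distrib[symmetric] by (intro sum.cong) (auto simp: Suc_le_eq)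
    then show ?thesis by (simp add: tlen_def)
  qed
  ultimately show ?thesis using assms by (auto simp: good_def)
qed

theorem exists_reducing:
  assumes "n < tlen n w"
  obtains A a where "A \<subseteq> letters n" "a \<in> A" "inv_letter a \<notin> A" "tcap n A w < tdeg n a w"
proof -
  define b :: "nat \<times> nat" where "b = (0, 0)"
  \<comment> \<open>A good graph with the fewest vertices stands in for the last graph of a folding
    sequence.\<close>
  obtain f where f: "good b f" "\<And>g. good b g \<Longrightarrow> card (f ` Pos) \<le> card (g ` Pos)"
    using ex_has_least_nat[of "good b" _ "\<lambda>f. card (f ` Pos)", OF exists_good[OF assms, folded b_def]]
    by blast
  obtain p c x y where e: "(p, c, x) \<in> edges f" "(p, c, y) \<in> edges f" "x \<noteq> y"
    using good_not_det[OF f(1)] by blast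
  have V2: "card (f ` Pos) = 2" by (rule exists_two_vertex_graph[OF f e])
  have n0: "0 < n" using assms by (cases n) (auto simp: tlen_def)
  then have "f (1, 0) = b" "(1, 0) \<in> Pos" using f(1) by (auto simp: good_def Pos_def)
  then have b: "b \<in> f ` Pos" using imageI[of "(1, 0)" Pos f] by simp
  have p: "p \<in> f ` Pos" "x \<in> f ` Pos" "y \<in> f ` Pos" 
    using edges_vertices[OF e(1)] edges_vertices[OF e(2)] by blast+
  obtain q where Vpq: "f ` Pos = {p, q}" "p \<noteq> q"
  proof -
    obtain r1 r2 where r: "f ` Pos = {r1, r2}" "r1 \<noteq> r2" using V2 by (meson card_2_iff)
    with p(1) consider "p = r1" | "p = r2" by blast
    then show thesis using that[of r1] that[of r2] r by cases (metis insert_commute)+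
  qed
  have pc: "(p, c, p) \<in> edges f" "(p, c, q) \<in> edges f" using e p Vpq by auto
  have c: "c \<in> letters n" by (rule edges_letters[OF pc(1)])
  have E: "card (pos_edges f) \<le> n + 1" using f(1) V2 by (simp add: good_def)
  let ?j = "fst c"
  have j: "?j \<in> {1..n}" using c by (auto simp: letters_def)
  \<comment> \<open>The fiber consists of positively labelled edges; \<open>h\<close> reverses edges
    when \<open>c\<close> is an inverse letter.\<close>
  have "\<exists>h. inj h \<and> (\<forall>x z. (x, c, z) \<in> edges f \<longrightarrow> h (x, c, z) \<in> fiber f ?j)"
  proof (cases "snd c")
    case False
    then show ?thesis by (intro exI[of _ id]) (auto simp: fiber_def pos_edges_def)
  next
    case True
    have "inj (flip :: (nat \<times> nat) \<times> (nat \<times> bool) \<times> (nat \<times> nat) \<Rightarrow> _)" by (rule inj_on_inverseI[of _ flip]) simp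
    moreover have "flip (x, c, z) \<in> fiber f ?j" if "(x, c, z) \<in> edges f" for x z
      using edges_sym[OF that] True by (simp add: fiber_def pos_edges_def flip_def inv_letter_def)
    ultimately show ?thesis by blast
  qed
  then obtain h where h: "inj h" "\<And>x z. (x, c, z) \<in> edges f \<Longrightarrow> h (x, c, z) \<in> fiber f ?j" by blast
  have card_h: "card M \<le> card (fiber f ?j)" if "M \<subseteq> {(x, c, z) |x z. (x, c, z) \<in> edges f}" for M
  proof -
    have "h ` M \<subseteq> fiber f ?j" using that h(2) by blast
    then show ?thesis using card_mono[of "fiber f ?j" "h ` M"] card_image[OF inj_on_subset[OF h(1)], of M]
      by (simp add: fiber_def)
  qed
  have two: "2 \<le> card (fiber f ?j)"
    using card_h[of "{(p, c, p), (p, c, q)}"] pc Vpq(2) by simp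
  note fc = fiber_cards[OF E j two]
  \<comment> \<open>A third edge labelled \<open>c\<close> would exceed the two edges in the
    fiber.\<close>
  have e2: "z = p" if "(z, c, r) \<in> edges f" for z r
  proof (rule ccontr)
    assume "z \<noteq> p"
    then show False using card_h[of "{(p, c, p), (p, c, q), (z, c, r)}"] pc Vpq(2) that fc(1) by simp
  qed
  have uniq: "z = z'" if h: "(r, l, z) \<in> edges f" "(r', l, z') \<in> edges f" "l \<noteq> c" "l \<noteq> inv_letter c" for r l z r' z'
  proof -
    have l: "fst l \<in> {1..n}" "fst l \<noteq> ?j"
      using edges_letters[OF h(1)] h(3,4) by (auto simp: letters_def fst_eq_letter)
    obtain m where m: "fiber f (fst l) = {m}" using fc(2)[OF l] by (auto simp: card_1_singleton_iff)
    show ?thesis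
    proof (cases "snd l")
      case False
      then have "(r, l, z) \<in> fiber f (fst l)" "(r', l, z') \<in> fiber f (fst l)"
        using h by (auto simp: fiber_def pos_edges_def)
      then show ?thesis using m by auto
    next
      case True
      then have "(z, inv_letter l, r) \<in> fiber f (fst l)" "(z', inv_letter l, r') \<in> fiber f (fst l)"
        using edges_sym[OF h(1)] edges_sym[OF h(2)] by (auto simp: fiber_def pos_edges_def inv_letter_def)
      then show ?thesis using m by auto
    qed
  qed
  \<comment> \<open>The labels entering \<open>q\<close>. A letter other than \<open>c\<close> and
    its inverse enters at most one vertex, by \<open>uniq\<close>; \<open>c\<close> enters both
    vertices and is counted on the side of \<open>q\<close>.\<close>
  define S where "S = {l. \<exists>r. (r, l, q) \<in> edges f}"
  have cS: "c \<in> S" using pc by (auto simp: S_def)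
  have cS': "inv_letter c \<notin> S"
  proof
    assume "inv_letter c \<in> S"
    then obtain r where "(r, inv_letter c, q) \<in> edges f" unfolding S_def by blast
    then have "(q, c, r) \<in> edges f" using edges_sym by fastforce
    then show False using e2 Vpq(2) by blast
  qed
  have e1: "l \<in> S \<longleftrightarrow> z = q" if h: "(r, l, z) \<in> edges f" "l \<noteq> c" "l \<noteq> inv_letter c" for r l z
    using uniq[OF h(1) _ h(2,3)] h(1) unfolding S_def by blast
  let ?z = "b = q"
  define H where "H i = (\<Sum>k<length (w i). of_bool ((w i ! k = c \<and> f (i, Suc k) = q) \<or>
      (w i ! k = inv_letter c \<and> f (i, k) = q)) :: nat)" for i
  have le: "cut S ?z ?z (w i) + H i \<le> wdeg c (w i)" if i: "i \<in> {1..n}" for i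
    unfolding H_def
  proof (rule cut_le_deg[where b = b and p = p])
    show "f (i, k) \<in> {p, q}" if "k \<le> length (w i)" for k
      using that i by (subst Vpq(1)[symmetric]) (auto simp: Pos_def)
  qed (use f(1) i b Vpq e1 e2 cS cS' in \<open>auto simp: good_def\<close>)
  \<comment> \<open>Some word traverses the edge labelled \<open>c\<close> between \<open>p\<close>
    and \<open>q\<close>, and this makes the inequality strict.\<close>
  have "\<exists>i\<in>{1..n}. 0 < H i"
  proof -
    obtain i k where ik: "i \<in> {1..n}" "k < length (w i)"
      "(p, c, q) = (f (i, k), w i ! k, f (i, Suc k)) \<or> (q, inv_letter c, p) = (f (i, k), w i ! k, f (i, Suc k))"
      using edges_cases[OF pc(2)] .
    then have "0 < H i" unfolding H_def by (intro sum_pos2[of _ k]) auto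
    then show ?thesis using ik(1) by blast
  qed
  then have "0 < (\<Sum>i=1..n. H i)" by (auto intro: sum_pos2)
  moreover have "(\<Sum>i=1..n. cut S ?z ?z (w i)) + (\<Sum>i=1..n. H i) \<le> tdeg n c w"
    unfolding tdeg_def sum.distrib[symmetric] using le by (intro sum_mono) auto
  ultimately have lt: "(\<Sum>i=1..n. cut S ?z ?z (w i)) < tdeg n c w" by linarith
  have SL: "S \<subseteq> letters n"
  proof
    fix l assume "l \<in> S"
    then obtain r where "(r, l, q) \<in> edges f" unfolding S_def by blast
    then show "l \<in> letters n" by (rule edges_letters)
  qed
  show thesis
  proof (cases ?z)
    case False
    then show thesis using that[of S c] SL cS cS' lt by (simp add: tcap_def)
  next
    case True
    \<comment> \<open>The base is on the side of \<open>S\<close>, while \<open>tcap\<close> has it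
      outside the set. The complement, with the inverse of \<open>c\<close> as multiplier, has the
      same capacity and degree.\<close>
    let ?A = "letters n - S"
    have "cut ?A False False (w i) = cut S True True (w i)" if i: "i \<in> {1..n}" for i
    proof -
      have "set v \<subseteq> letters n \<Longrightarrow> cut ?A z s v = cut (- S) z s v" for v z s
        by (induction v arbitrary: s) auto
      then show ?thesis using letters_w[OF i] cut_compl[of S True True "w i"] by simp
    qed
    then have "tcap n ?A w < tdeg n (inv_letter c) w" using lt True by (simp add: tcap_def)
    then show thesis using that[of ?A "inv_letter c"] c cS cS' by auto
  qed
qed

end

section \<open>Automorphisms of the free group\<close>

lemma carrier_Fn: "u \<in> carrier (Fn n) \<longleftrightarrow> set u \<subseteq> letters n \<and> reduced u"
  by (auto simp: Fn_def free_grp_simps letters_def)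

lemma group_AutF: "group (AutF n)"
  unfolding Fn_def by (rule group.AutoGroup[OF free_grp_group])

lemma AutF_carrier: "\<phi> \<in> carrier (AutF n) \<longleftrightarrow>
    \<phi> \<in> extensional (carrier (Fn n)) \<and> bij_betw \<phi> (carrier (Fn n)) (carrier (Fn n)) \<and>
    (\<forall>u\<in>carrier (Fn n). \<forall>v\<in>carrier (Fn n). \<phi> (norm (u @ v)) = norm (\<phi> u @ \<phi> v))"
  unfolding AutoGroup_def auto_def hom_def Bij_def
  by (auto simp: Fn_def free_grp_simps(2) dest: bij_betw_imp_funcset)

lemma AutF_closed: "\<phi> \<in> carrier (AutF n) \<Longrightarrow> u \<in> carrier (Fn n) \<Longrightarrow> \<phi> u \<in> carrier (Fn n)"
  unfolding AutF_carrier by (auto simp: bij_betw_def)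

lemma AutF_hom: "\<phi> \<in> carrier (AutF n) \<Longrightarrow> u \<in> carrier (Fn n) \<Longrightarrow> v \<in> carrier (Fn n) \<Longrightarrow>
    \<phi> (norm (u @ v)) = norm (\<phi> u @ \<phi> v)"
  by (auto simp: AutF_carrier)

lemma AutF_mult: "\<phi> \<in> carrier (AutF n) \<Longrightarrow> \<psi> \<in> carrier (AutF n) \<Longrightarrow> u \<in> carrier (Fn n) \<Longrightarrow>
    (\<phi> \<otimes>\<^bsub>AutF n\<^esub> \<psi>) u = \<phi> (\<psi> u)"
  by (auto simp: AutoGroup_def auto_def BijGroup_def compose_def)

lemma AutF_one: "u \<in> carrier (Fn n) \<Longrightarrow> \<one>\<^bsub>AutF n\<^esub> u = u"
  by (simp add: AutoGroup_def BijGroup_def)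

lemma gen_Fn: "i \<in> {1..n} \<Longrightarrow> gen i \<in> carrier (Fn n)"
  by (simp add: carrier_Fn gen_def letters_def)

lemma Nil_Fn: "[] \<in> carrier (Fn n)"
  by (simp add: carrier_Fn)

lemma AutF_Nil: "\<phi> \<in> carrier (AutF n) \<Longrightarrow> \<phi> [] = []"
proof -
  assume p: "\<phi> \<in> carrier (AutF n)"
  have "\<phi> [] = norm (\<phi> [] @ \<phi> [])" using AutF_hom[OF p Nil_Fn Nil_Fn] by simp
  then have "norm (\<phi> [] @ inv_word (\<phi> [])) = norm (\<phi> [] @ \<phi> [] @ inv_word (\<phi> []))"
    by (metis append_assoc norm_append_norm_left)
  then have "norm (\<phi> []) = []" by (metis append_Nil2 norm_append_norm_right norm_inv_right')
  then show ?thesis using AutF_closed[OF p Nil_Fn] by (simp add: carrier_Fn)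
qed

definition lift :: "(nat \<Rightarrow> nat word) \<Rightarrow> nat \<times> bool \<Rightarrow> nat word" where
  "lift f = (\<lambda>(i, b). if b then inv_word (f i) else f i)"

lemma AutF_letter:
  assumes "\<phi> \<in> carrier (AutF n)" "l \<in> letters n"
  shows "\<phi> [l] = lift (\<lambda>i. \<phi> (gen i)) l"
proof (cases l)
  case (Pair i b)
  show ?thesis
  proof (cases b)
    case True
    have i: "i \<in> {1..n}" using assms(2) Pair by (simp add: letters_def)
    have l: "[l] \<in> carrier (Fn n)" using assms(2) by (simp add: carrier_Fn)
    note g = AutF_closed[OF assms(1) gen_Fn[OF i]]
    have "norm (\<phi> (gen i) @ \<phi> [l]) = \<phi> (norm (gen i @ [l]))"
      using AutF_hom[OF assms(1) gen_Fn[OF i] l] by simp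
    also have "norm (gen i @ [l]) = []"
      using norm_cancel[of "(i, False)" "[]"] Pair True by (simp add: gen_def)
    finally have "norm (\<phi> (gen i) @ \<phi> [l]) = []" using AutF_Nil[OF assms(1)] by simp
    then have "norm (inv_word (\<phi> (gen i)) @ \<phi> (gen i) @ \<phi> [l]) = norm (inv_word (\<phi> (gen i)))"
      by (metis append_Nil2 norm_append_norm_right)
    then have "norm (\<phi> [l]) = norm (inv_word (\<phi> (gen i)))" by (simp add: norm_inv_left)
    then show ?thesis using AutF_closed[OF assms(1) l] g Pair True by (simp add: carrier_Fn lift_def)
  qed (simp add: Pair lift_def gen_def)
qed

lemma AutF_wsubst:
  assumes "\<phi> \<in> carrier (AutF n)" "u \<in> carrier (Fn n)"
  shows "\<phi> u = wsubst (lift (\<lambda>i. \<phi> (gen i))) u"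
  using assms(2)
proof (induction u)
  case Nil
  then show ?case using AutF_Nil[OF assms(1)] by simp
next
  case (Cons l u)
  have l: "l \<in> letters n" "[l] \<in> carrier (Fn n)" "u \<in> carrier (Fn n)" "reduced (l # u)"
    using Cons.prems by (auto simp: carrier_Fn reduced_Cons)
  have "\<phi> (l # u) = norm (\<phi> [l] @ \<phi> u)" using AutF_hom[OF assms(1) l(2,3)] l(4) by simp
  then show ?case using AutF_letter[OF assms(1) l(1)] Cons.IH[OF l(3)] by (simp add: wsubst_Cons)
qed

lemma lift_cong: "f (fst l) = g (fst l) \<Longrightarrow> lift f l = lift g l"
  by (cases l) (simp add: lift_def)

lemma AutF_ext:
  assumes "\<phi> \<in> carrier (AutF n)" "\<psi> \<in> carrier (AutF n)" "\<And>i. i \<in> {1..n} \<Longrightarrow> \<phi> (gen i) = \<psi> (gen i)"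
  shows "\<phi> = \<psi>"
proof (rule extensionalityI)
  show "\<phi> \<in> extensional (carrier (Fn n))" "\<psi> \<in> extensional (carrier (Fn n))"
    using assms by (auto simp: AutF_carrier)
  fix u assume u: "u \<in> carrier (Fn n)"
  have "wsubst (lift (\<lambda>i. \<phi> (gen i))) u = wsubst (lift (\<lambda>i. \<psi> (gen i))) u"
    using u by (intro wsubst_cong lift_cong assms(3)) (auto simp: carrier_Fn letters_def subset_iff)
  then show "\<phi> u = \<psi> u" using AutF_wsubst[OF assms(1) u] AutF_wsubst[OF assms(2) u] by simp
qed

definition endo :: "nat \<Rightarrow> (nat \<times> bool \<Rightarrow> nat word) \<Rightarrow> nat word \<Rightarrow> nat word" where
  "endo n F = (\<lambda>u\<in>carrier (Fn n). wsubst F u)"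

definition nice :: "nat \<Rightarrow> (nat \<times> bool \<Rightarrow> nat word) \<Rightarrow> bool" where
  "nice n F \<longleftrightarrow> inv_compat F \<and> (\<forall>l\<in>letters n. set (F l) \<subseteq> letters n)"

lemma wsubst_Fn: "nice n F \<Longrightarrow> u \<in> carrier (Fn n) \<Longrightarrow> wsubst F u \<in> carrier (Fn n)"
  using set_norm[of "concat (map F u)"] by (fastforce simp: carrier_Fn nice_def wsubst_def)

lemma endo_app: "u \<in> carrier (Fn n) \<Longrightarrow> endo n F u = wsubst F u"
  by (simp add: endo_def)

text \<open>Bijectivity comes from the explicit inverse substitution \<open>G\<close>, so it has to
  be checked on letters only.\<close>

lemma endo_AutF:
  assumes "nice n F" "nice n G" "\<And>l. l \<in> letters n \<Longrightarrow> wsubst F (G l) = [l]" "\<And>l. l \<in> letters n \<Longrightarrow> wsubst G (F l) = [l]"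
  shows "endo n F \<in> carrier (AutF n)"
proof -
  have inv: "wsubst F' (wsubst G' u) = u"
    if "nice n F'" "nice n G'" "\<And>l. l \<in> letters n \<Longrightarrow> wsubst F' (G' l) = [l]" "u \<in> carrier (Fn n)" for F' G' u
  proof -
    have "wsubst F' (wsubst G' u) = wsubst (\<lambda>l. wsubst F' (G' l)) u"
      using that(1) by (intro wsubst_wsubst) (simp add: nice_def)
    also have "\<dots> = u" using that(3,4) by (intro wsubst_id) (auto simp: carrier_Fn)
    finally show ?thesis .
  qed
  have "bij_betw (endo n F) (carrier (Fn n)) (carrier (Fn n))"
    by (rule bij_betw_byWitness[where f' = "endo n G"])
      (auto simp: endo_app wsubst_Fn assms inv)
  moreover have "endo n F (norm (u @ v)) = norm (endo n F u @ endo n F v)"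
    if "u \<in> carrier (Fn n)" "v \<in> carrier (Fn n)" for u v
  proof -
    have "norm (u @ v) \<in> carrier (Fn n)"
      using that set_norm[of "u @ v"] by (auto simp: carrier_Fn)
    then show ?thesis using that assms(1) by (simp add: endo_app nice_def wsubst_append)
  qed
  ultimately show ?thesis by (simp add: AutF_carrier endo_def)
qed

lemma subst_hom_endo: "subst_hom n f = endo n (lift f)"
  by (simp add: subst_hom_def endo_def wsubst_def lift_def)

section \<open>Signed permutations and \<eta> as automorphisms\<close>

definition Wm :: "nat \<Rightarrow> (nat \<times> bool \<Rightarrow> nat \<times> bool) \<Rightarrow> nat word \<Rightarrow> nat word" where
  "Wm n f = endo n (\<lambda>l. [f l])"

lemma nice_SP: "f \<in> SP n \<Longrightarrow> nice n (\<lambda>l. [f l])"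
  unfolding nice_def inv_compat_def by (auto simp: inv_word_def SP_inv SP_letters)

lemma Wm_AutF: "f \<in> SP n \<Longrightarrow> Wm n f \<in> carrier (AutF n)"
proof -
  assume f: "f \<in> SP n"
  show ?thesis
    unfolding Wm_def
    by (rule endo_AutF[OF nice_SP[OF f] nice_SP[OF SP_pinv[OF f]]])
      (simp_all add: wsubst_Cons SP_pinv_app[OF f])
qed

lemma Wm_app: "f \<in> SP n \<Longrightarrow> u \<in> carrier (Fn n) \<Longrightarrow> Wm n f u = map f u"
proof -
  assume f: "f \<in> SP n" and u: "u \<in> carrier (Fn n)"
  have "Wm n f u = norm (map f u)" using u by (simp add: Wm_def endo_app wsubst_def)
  also have "\<dots> = map f u" using f u by (simp add: norm_map_SP carrier_Fn)
  finally show ?thesis .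
qed

lemma Wm_gen: "f \<in> SP n \<Longrightarrow> i \<in> {1..n} \<Longrightarrow> Wm n f (gen i) = [f (i, False)]"
  using Wm_app[OF _ gen_Fn] by (simp add: gen_def)

lemma Wm_mult:
  assumes "f \<in> SP n" "g \<in> SP n"
  shows "Wm n f \<otimes>\<^bsub>AutF n\<^esub> Wm n g = Wm n (f \<circ> g)"
proof (rule AutF_ext[of _ n])
  interpret A: group "AutF n" by (rule group_AutF)
  show "Wm n f \<otimes>\<^bsub>AutF n\<^esub> Wm n g \<in> carrier (AutF n)" "Wm n (f \<circ> g) \<in> carrier (AutF n)"
    using assms by (simp_all add: Wm_AutF SP_comp)
  fix i assume i: "i \<in> {1..n}"
  have "(i, False) \<in> letters n" using i by (simp add: letters_def)
  then have "[g (i, False)] \<in> carrier (Fn n)"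
    using SP_letters[OF assms(2)] by (simp add: carrier_Fn)
  then show "(Wm n f \<otimes>\<^bsub>AutF n\<^esub> Wm n g) (gen i) = Wm n (f \<circ> g) (gen i)"
    using AutF_mult[OF Wm_AutF Wm_AutF gen_Fn[OF i], OF assms] assms i
    by (simp add: Wm_gen[OF assms(2)] Wm_gen[OF SP_comp[OF assms]] Wm_app[OF assms(1)])
qed

lemma Wm_id: "Wm n id = \<one>\<^bsub>AutF n\<^esub>"
proof (rule AutF_ext[of _ n])
  interpret A: group "AutF n" by (rule group_AutF)
  show "\<one>\<^bsub>AutF n\<^esub> \<in> carrier (AutF n)" by simp
  show "Wm n id (gen i) = \<one>\<^bsub>AutF n\<^esub> (gen i)" if "i \<in> {1..n}" for i
    using AutF_one[OF gen_Fn[OF that]] Wm_gen[OF SP_id that] by (simp add: gen_def)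
qed (rule Wm_AutF[OF SP_id])

text \<open>The images of the generators under an element of W_n form a list of letters with
  distinct indices, which \<open>SP_ex\<close> extends to a bijection of all letters.\<close>

lemma W_eq: "W n = Wm n ` SP n"
proof (intro equalityI subsetI)
  fix \<alpha> assume "\<alpha> \<in> W n"
  then obtain \<pi> \<epsilon> where a: "\<alpha> \<in> carrier (AutF n)" "bij_betw \<pi> {1..n} {1..n}"
    "\<And>i. i \<in> {1..n} \<Longrightarrow> \<alpha> (gen i) = [(\<pi> i, \<epsilon> i)]" by (auto simp: W_def)
  let ?xs = "map (\<lambda>i. (\<pi> i, \<epsilon> i)) [1..<Suc n]"
  have set: "set [1..<Suc n] = {1..n}" by auto
  have "map fst ?xs = map \<pi> [1..<Suc n]" by (simp del: upt_Suc)
  moreover have "distinct (map \<pi> [1..<Suc n])"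
    using a(2) unfolding distinct_map set by (simp add: bij_betw_def)
  ultimately have "distinct (map fst ?xs)" by (simp only:)
  moreover have "set ?xs \<subseteq> letters n"
    using a(2) by (force simp: letters_def bij_betw_def)
  ultimately obtain f where f: "f \<in> SP n" "\<And>i. i < length ?xs \<Longrightarrow> f (Suc i, False) = ?xs ! i"
    using SP_ex by blast
  have "\<alpha> = Wm n f"
  proof (rule AutF_ext[OF a(1) Wm_AutF[OF f(1)]])
    fix i assume i: "i \<in> {1..n}"
    then obtain k where k: "i = Suc k" "k < n" by (cases i) auto
    have "f (i, False) = (\<pi> i, \<epsilon> i)" using f(2)[of k] k by (simp del: upt_Suc)
    then show "\<alpha> (gen i) = Wm n f (gen i)" using a(3)[OF i] Wm_gen[OF f(1) i] by simp
  qed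
  then show "\<alpha> \<in> Wm n ` SP n" using f by blast
next
  fix \<alpha> assume "\<alpha> \<in> Wm n ` SP n"
  then obtain f where f: "f \<in> SP n" "\<alpha> = Wm n f" by blast
  let ?p = "\<lambda>i. fst (f (i, False))"
  have "?p ` {1..n} \<subseteq> {1..n}"
    using SP_letters[OF f(1)] by (auto simp: letters_def mem_Times_iff)
  moreover have "inj_on ?p {1..n}"
    using SP_fst[OF f(1)] by (auto simp: inj_on_def)
  ultimately have "bij_betw ?p {1..n} {1..n}"
    by (simp add: bij_betw_def endo_inj_surj)
  then show "\<alpha> \<in> W n"
    using f Wm_AutF Wm_gen unfolding W_def
    by (auto intro!: exI[of _ ?p] exI[of _ "\<lambda>i. snd (f (i, False))"])
qed

lemma tau_Wm: "tau n i = Wm n (tauL i)"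
proof -
  have "lift (\<lambda>k. if k = i then [(i, True)] else gen k) l = [tauL i l]" for l
    by (cases l) (auto simp: lift_def sw_def gen_def inv_word_def)
  then show ?thesis unfolding tau_def subst_hom_endo Wm_def by presburger
qed

lemma sigma_Wm: "sigma n i j = Wm n (sigmaL i j)"
proof -
  have "lift (\<lambda>k. if k = i then gen j else if k = j then gen i else gen k) l = [sigmaL i j l]" for l
    by (cases l) (auto simp: lift_def sw_def gen_def inv_word_def)
  then show ?thesis unfolding sigma_def subst_hom_endo Wm_def by presburger
qed

text \<open>\<eta> on letters, written as the inversion of a_2 followed by a Whitehead substitution,
  the form that \<open>tup_eta\<close> asks for.\<close>

definition etal :: "nat \<times> bool \<Rightarrow> nat word" where
  "etal l = lm {(1, True), (2, False)} (2, False) (tauL 2 l)"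

lemma etal_simps [simp]: "etal (Suc 0, False) = [(2, True), (1, False)]" "etal (Suc 0, True) = [(1, True), (2, False)]"
  "etal (2, False) = [(2, True)]" "etal (2, True) = [(2, False)]"
  "i \<noteq> 1 \<Longrightarrow> i \<noteq> 2 \<Longrightarrow> etal (i, b) = [(i, b)]"
  by (auto simp: etal_def lm_def sw_def)

lemma etal_if: "etal (i, b) = (if i = 1 then (if b then [(1, True), (2, False)] else [(2, True), (1, False)])
    else [(i, if i = 2 then \<not> b else b)])"
  by (cases b; cases "i = 1"; cases "i = 2") auto

lemma eta_endo: "eta n = endo n etal"
proof -
  have "lift (\<lambda>k. if k = 1 then [(2, True), (1, False)] else if k = 2 then [(2, True)] else gen k) l = etal l" for l
    by (cases l) (auto simp: lift_def etal_def lm_def sw_def gen_def inv_word_def)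
  then show ?thesis unfolding eta_def subst_hom_endo by presburger
qed

lemma nice_etal: "2 \<le> n \<Longrightarrow> nice n etal"
proof -
  assume n: "2 \<le> n"
  have "etal (inv_letter l) = inv_word (etal l)" for l
    using sw_inv[of "(2, False)" "(2, True)" l] inv_compat_lm unfolding etal_def inv_compat_def by simp
  moreover have "set (etal l) \<subseteq> letters n" if "l \<in> letters n" for l
    using that n by (cases l; cases "fst l = 1"; cases "fst l = 2"; cases "snd l") (auto simp: letters_def)
  ultimately show ?thesis by (simp add: nice_def inv_compat_def)
qed

text \<open>Insertion letter by letter lets the simplifier compute images of concrete words without
  unfolding \<open>norm\<close>.\<close>

lemma wsubst_eval: "wsubst F [] = []" "wsubst F (l # u) = foldr ins_letter (F l) (wsubst F u)"
  by simp (metis norm_append norm_reduced reduced_wsubst wsubst_Cons)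

lemma eta_AutF: "2 \<le> n \<Longrightarrow> eta n \<in> carrier (AutF n)"
proof -
  assume "2 \<le> n"
  moreover have "wsubst etal (etal l) = [l]" for l
    by (cases l; cases "fst l = 1"; cases "fst l = 2"; cases "snd l") (auto simp: wsubst_eval ins_letter_def)
  ultimately show ?thesis unfolding eta_endo by (intro endo_AutF[of _ _ etal] nice_etal)
qed

section \<open>Verification of the relations in Aut(F_n)\<close>

fun maps :: "(nat \<times> bool \<Rightarrow> nat word) list \<Rightarrow> nat word \<Rightarrow> nat word" where
  "maps [] u = u"
| "maps (F # Fs) u = wsubst F (maps Fs u)"

text \<open>Pairs an abstract generator with a substitution that computes it, so that a relator can
  be evaluated on the generators through \<open>maps\<close> instead of products in
  \<open>AutF n\<close>.\<close>

definition lmap :: "gsym \<Rightarrow> (nat \<times> bool \<Rightarrow> nat word) \<Rightarrow> nat \<Rightarrow> bool" where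
  "lmap g F n \<longleftrightarrow> nice n F \<and> g \<in> Gens n \<and> gval n g = endo n F"

lemma gval_AutF: "2 \<le> n \<Longrightarrow> g \<in> Gens n \<Longrightarrow> gval n g \<in> carrier (AutF n)"
  by (auto simp: Gens_def gval_def W_def eta_AutF)

lemma lmap_None: "2 \<le> n \<Longrightarrow> lmap None etal n"
  by (simp add: lmap_def nice_etal Gens_def gval_def eta_endo)

lemma lmap_Wm: "f \<in> SP n \<Longrightarrow> lmap (Some (Wm n f)) (\<lambda>l. [f l]) n"
  by (simp add: lmap_def nice_SP Gens_def gval_def Wm_def W_eq)

lemma evalP_Nil [simp]: "evalP n [] = \<one>\<^bsub>AutF n\<^esub>"
  by (simp add: evalP_def)

lemma evalP_Cons: "evalP n ((g, b) # u) =
   (if b then inv\<^bsub>AutF n\<^esub> (gval n g) else gval n g) \<otimes>\<^bsub>AutF n\<^esub> evalP n u"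
  by (simp add: evalP_def)

context
  fixes n :: nat
  assumes n2: "2 \<le> n"
begin

interpretation A: group "AutF n" by (rule group_AutF)

lemma evalP_closed: "set u \<subseteq> Gens n \<times> UNIV \<Longrightarrow> evalP n u \<in> carrier (AutF n)"
  by (induction u) (auto simp: evalP_Cons gval_AutF n2)

lemma evalP_append: "set u \<subseteq> Gens n \<times> UNIV \<Longrightarrow> set v \<subseteq> Gens n \<times> UNIV \<Longrightarrow>
    evalP n (u @ v) = evalP n u \<otimes>\<^bsub>AutF n\<^esub> evalP n v"
  by (induction u) (auto simp: evalP_Cons gval_AutF n2 evalP_closed A.m_assoc)

lemma evalP_ins: "set (l # u) \<subseteq> Gens n \<times> UNIV \<Longrightarrow> evalP n (ins_letter l u) = evalP n (l # u)"
proof (cases "\<exists>u'. u = inv_letter l # u'")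
  case True
  assume a: "set (l # u) \<subseteq> Gens n \<times> UNIV"
  obtain u' where u: "u = inv_letter l # u'" using True by blast
  obtain g b where l: "l = (g, b)" by (cases l)
  have g: "gval n g \<in> carrier (AutF n)" "evalP n u' \<in> carrier (AutF n)"
    using a by (auto simp: u l gval_AutF n2 evalP_closed)
  then show ?thesis by (auto simp: u l ins_letter_def evalP_Cons simp flip: A.m_assoc)
next
  case False
  then have "ins_letter l u = l # u" by (auto simp: ins_letter_def split: list.split)
  then show ?thesis by simp
qed

lemma evalP_norm: "set u \<subseteq> Gens n \<times> UNIV \<Longrightarrow> evalP n (norm u) = evalP n u"
proof (induction u)
  case (Cons l u)
  obtain g b where l: "l = (g, b)" by (cases l)
  have "set (l # norm u) \<subseteq> Gens n \<times> UNIV" using Cons.prems set_norm[of u] by auto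
  then have "evalP n (norm (l # u)) = evalP n (l # norm u)" by (simp add: norm_Cons evalP_ins)
  then show ?case using Cons by (simp add: l evalP_Cons)
qed simp

lemma evalP_maps:
  assumes "list_all2 (\<lambda>g F. lmap g F n) gs Fs" "u \<in> carrier (Fn n)"
  shows "evalP n (map (\<lambda>g. (g, False)) gs) u = maps Fs u \<and> maps Fs u \<in> carrier (Fn n)"
  using assms(1)
proof (induction rule: list_all2_induct)
  case Nil
  then show ?case using assms(2) by (simp add: AutF_one)
next
  case (Cons g gs F Fs)
  have "set gs \<subseteq> Gens n"
    using Cons.hyps(2) by (auto simp: list_all2_conv_all_nth lmap_def in_set_conv_nth)
  then have "set (map (\<lambda>g. (g, False)) gs) \<subseteq> Gens n \<times> UNIV" by auto
  then have "evalP n (map (\<lambda>g. (g, False)) gs) \<in> carrier (AutF n)" by (rule evalP_closed)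
  moreover have "gval n g \<in> carrier (AutF n)"
    using Cons.hyps(1) gval_AutF[OF n2, of g] by (simp add: lmap_def)
  ultimately have "evalP n (map (\<lambda>g. (g, False)) (g # gs)) u = gval n g (maps Fs u)"
    using Cons.IH assms(2) by (simp add: evalP_Cons AutF_mult)
  then show ?case using Cons by (simp add: lmap_def endo_app wsubst_Fn)
qed

lemma evalP_pw_one:
  assumes "list_all2 (\<lambda>g F. lmap g F n) gs Fs" "\<And>i. i \<in> {1..n} \<Longrightarrow> maps Fs (gen i) = gen i"
  shows "set (pw gs) \<subseteq> Gens n \<times> UNIV" "evalP n (pw gs) = \<one>\<^bsub>AutF n\<^esub>"
proof -
  have "set gs \<subseteq> Gens n"
    using assms(1) by (auto simp: list_all2_conv_all_nth lmap_def in_set_conv_nth)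
  then have s: "set (map (\<lambda>g. (g, False)) gs) \<subseteq> Gens n \<times> UNIV" by auto
  then show "set (pw gs) \<subseteq> Gens n \<times> UNIV" unfolding pw_def using set_norm by blast
  have "evalP n (pw gs) = evalP n (map (\<lambda>g. (g, False)) gs)" unfolding pw_def by (rule evalP_norm[OF s])
  also have "\<dots> = \<one>\<^bsub>AutF n\<^esub>"
    using evalP_maps[OF assms(1) gen_Fn] assms(2)
    by (intro AutF_ext[of _ n] evalP_closed s) (auto simp: AutF_one gen_Fn)
  finally show "evalP n (pw gs) = \<one>\<^bsub>AutF n\<^esub>" .
qed

end

lemma Rel_cases:
  assumes "4 \<le> n" "r \<in> Rel n"
  shows "set r \<subseteq> Gens n \<times> UNIV \<and> reduced r \<and> evalP n r = \<one>\<^bsub>AutF n\<^esub>"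
proof -
  have n2: "2 \<le> n" using assms(1) by simp
  have rep: "replicate 2 x = [x, x]" "replicate 3 x = [x, x, x]" "replicate 4 x = [x, x, x, x]" for x :: 'z
    by (simp_all add: eval_nat_numeral)
  have red: "reduced (pw gs)" for gs by (simp add: pw_def)
  have sp: "sw x y \<in> SP n" if "fst x \<in> {1..n}" "fst y \<in> {1..n}" for x y
    using that by (intro sw_SP) (auto simp: letters_def mem_Times_iff)
  note ev = evalP_pw_one[OF n2]
  note L = lmap_None[OF n2] lmap_Wm[OF sp]
  note E = wsubst_eval ins_letter_def sw_def gen_def
  have *: ?thesis if "r = pw gs" "list_all2 (\<lambda>g F. lmap g F n) gs Fs" "\<And>i. i \<in> {1..n} \<Longrightarrow> maps Fs (gen i) = gen i" for gs Fs
    using ev[OF that(2,3)] red that(1) by simp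
  \<comment> \<open>The relations with fixed indices involve the first four generators only; all
    others can be treated as one case.\<close>
  have i5: "i = 1 \<or> i = 2 \<or> i = 3 \<or> i = 4 \<or> 4 < i" if "i \<in> {1..n}" for i
    using that by fastforce
  let ?g = "\<lambda>f. Some (Wm n f) :: gsym" and ?F = "\<lambda>f l. [f l] :: nat word"
  consider (1) "r = pw [None, None]"
    | (2) "r = ppow [Some (sigma n 1 2), None] 3"
    | (3) i where "r = ppow [None, Some (tau n i)] 2" "2 < i" "i \<le> n"
    | (4) i j where "r = ppow [None, Some (sigma n i j)] 2" "2 < i" "i \<le> n" "2 < j" "j \<le> n" "i \<noteq> j"
    | (5) "r = ppow (concat (replicate 2 [None, Some (tau n 1)]) @ [Some (tau n 2)]) 2"
    | (6) "r = ppow [None, Some (sigma n 1 3), Some (tau n 2), None, Some (sigma n 1 2)] 4"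
    | (7) "r = pw ([Some (sigma n 1 2), None, Some (sigma n 1 3), Some (tau n 2), None, Some (sigma n 1 2)]
          @ concat (replicate 2 [Some (sigma n 2 3), None, Some (sigma n 1 3), Some (tau n 2), None]))"
    | (8) "r = ppow [Some (sigma n 1 4), Some (sigma n 2 3), None] 4"
    | (9) "r \<in> carrier (FG n)" "evalP n r = \<one>\<^bsub>AutF n\<^esub>"
    using assms(2) unfolding Rel_def by blast
  then show ?thesis
  proof cases
    case 1
    show ?thesis
      by (rule *[OF 1, of "[etal, etal]"]) (use i5 L in \<open>fastforce simp: E\<close>)+
  next
    case 2
    have "r = pw (concat (replicate 3 [?g (sigmaL 1 2), None]))" by (simp add: 2 ppow_def sigma_Wm)
    then show ?thesis
      by (rule *[of _ "concat (replicate 3 [?F (sigmaL 1 2), etal])"])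
        (use assms(1) in \<open>simp add: L rep\<close>, drule i5, elim disjE, simp_all add: E rep)
  next
    case 3
    have "r = pw [None, ?g (tauL i), None, ?g (tauL i)]" by (simp add: 3(1) ppow_def tau_Wm rep)
    then show ?thesis
      by (rule *[of _ "[etal, ?F (tauL i), etal, ?F (tauL i)]"])
        (use 3 in \<open>simp add: L\<close>, use 3(2) in \<open>auto simp: E etal_if\<close>)
  next
    case 4
    have "r = pw [None, ?g (sigmaL i j), None, ?g (sigmaL i j)]" by (simp add: 4(1) ppow_def sigma_Wm rep)
    then show ?thesis
      by (rule *[of _ "[etal, ?F (sigmaL i j), etal, ?F (sigmaL i j)]"])
        (use 4 in \<open>simp add: L\<close>, use 4(2,4) in \<open>auto simp: E etal_if\<close>)
  next
    case 5
    have "r = pw (concat (replicate 2 (concat (replicate 2 [None, ?g (tauL 1)]) @ [?g (tauL 2)])))" by (simp add: 5 ppow_def sigma_Wm tau_Wm rep)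
    then show ?thesis
      by (rule *[of _ "concat (replicate 2 (concat (replicate 2 [etal, ?F (tauL 1)]) @ [?F (tauL 2)]))"])
        (use assms(1) in \<open>simp add: L rep\<close>, drule i5, elim disjE, simp_all add: E rep)
  next
    case 6
    have "r = pw (concat (replicate 4 [None, ?g (sigmaL 1 3), ?g (tauL 2), None, ?g (sigmaL 1 2)]))" by (simp add: 6 ppow_def sigma_Wm tau_Wm rep)
    then show ?thesis
      by (rule *[of _ "concat (replicate 4 [etal, ?F (sigmaL 1 3), ?F (tauL 2), etal, ?F (sigmaL 1 2)])"])
        (use assms(1) in \<open>simp add: L rep\<close>, drule i5, elim disjE, simp_all add: E rep)
  next
    case 7
    have "r = pw ([?g (sigmaL 1 2), None, ?g (sigmaL 1 3), ?g (tauL 2), None, ?g (sigmaL 1 2)] @ concat (replicate 2 [?g (sigmaL 2 3), None, ?g (sigmaL 1 3), ?g (tauL 2), None]))" by (simp add: 7 ppow_def sigma_Wm tau_Wm rep)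
    then show ?thesis
      by (rule *[of _ "[?F (sigmaL 1 2), etal, ?F (sigmaL 1 3), ?F (tauL 2), etal, ?F (sigmaL 1 2)] @ concat (replicate 2 [?F (sigmaL 2 3), etal, ?F (sigmaL 1 3), ?F (tauL 2), etal])"])
        (use assms(1) in \<open>simp add: L rep\<close>, drule i5, elim disjE, simp_all add: E rep)
  next
    case 8
    have "r = pw (concat (replicate 4 [?g (sigmaL 1 4), ?g (sigmaL 2 3), None]))" by (simp add: 8 ppow_def sigma_Wm tau_Wm rep)
    then show ?thesis
      by (rule *[of _ "concat (replicate 4 [?F (sigmaL 1 4), ?F (sigmaL 2 3), etal])"])
        (use assms(1) in \<open>simp add: L rep\<close>, drule i5, elim disjE, simp_all add: E rep)
  next
    case 9
    then show ?thesis by (simp add: FG_def free_grp_simps)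
  qed
qed

section \<open>The presented group\<close>

definition qc :: "nat \<Rightarrow> gsym word \<Rightarrow> gsym word set" where
  "qc n u = normal_closure (FG n) (Rel n) #>\<^bsub>FG n\<^esub> norm u"

definition gw :: "nat \<Rightarrow> gsym word \<Rightarrow> bool" where
  "gw n u \<longleftrightarrow> set u \<subseteq> Gens n \<times> UNIV"

text \<open>Left multiplication, extended by the identity outside the carrier. As a total function
  it composes associatively with \<open>id\<close> as neutral element, without carrier conditions,
  which is the form that \<open>presented\<close> requires.\<close>

definition La :: "nat \<Rightarrow> gsym word set \<Rightarrow> gsym word set \<Rightarrow> gsym word set" where
  "La n g = (\<lambda>v. if v \<in> carrier (Pres n) then g \<otimes>\<^bsub>Pres n\<^esub> v else v)"

definition ga :: "nat \<Rightarrow> gsym \<Rightarrow> gsym word set \<Rightarrow> gsym word set" where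
  "ga n g = La n (qc n [(g, False)])"

fun chain :: "nat \<Rightarrow> gsym list \<Rightarrow> gsym word set \<Rightarrow> gsym word set" where
  "chain n [] = id"
| "chain n (g # gs) = ga n g \<circ> chain n gs"

lemma gw_simps [simp]: "gw n []" "gw n ((g, b) # u) \<longleftrightarrow> g \<in> Gens n \<and> gw n u" "gw n (u @ v) \<longleftrightarrow> gw n u \<and> gw n v"
  by (auto simp: gw_def)

lemma gw_map: "set gs \<subseteq> Gens n \<Longrightarrow> gw n (map (\<lambda>g. (g, False)) gs)"
  by (auto simp: gw_def)

lemma carrier_FG: "u \<in> carrier (FG n) \<longleftrightarrow> gw n u \<and> reduced u"
  by (auto simp: FG_def free_grp_simps gw_def)

lemma norm_FG: "gw n u \<Longrightarrow> norm u \<in> carrier (FG n)"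
  unfolding FG_def gw_def by (rule norm_in_free_grp)

lemma FG_mult: "u \<otimes>\<^bsub>FG n\<^esub> v = norm (u @ v)"
  by (simp add: FG_def free_grp_simps)

lemma group_FG: "group (FG n)"
  unfolding FG_def by (rule free_grp_group)

context
  fixes n :: nat
  assumes n4: "4 \<le> n"
begin

lemma n2: "2 \<le> n" using n4 by simp

interpretation A: group "AutF n" by (rule group_AutF)
interpretation F: group "FG n" by (rule group_FG)

abbreviation N where "N \<equiv> normal_closure (FG n) (Rel n)"

lemma Rel_FG: "Rel n \<subseteq> carrier (FG n)"
  using Rel_cases[OF n4] by (auto simp: carrier_FG gw_def)

lemma N_normal: "N \<lhd> FG n"
  unfolding normal_closure_def
proof (rule F.normal_generateI)
  fix h k assume h: "h \<in> (\<Union>g\<in>carrier (FG n). (\<lambda>r. g \<otimes>\<^bsub>FG n\<^esub> r \<otimes>\<^bsub>FG n\<^esub> inv\<^bsub>FG n\<^esub> g) ` Rel n)"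
    and k: "k \<in> carrier (FG n)"
  then obtain g r where g: "g \<in> carrier (FG n)" "r \<in> Rel n" "r \<in> carrier (FG n)"
    "h = g \<otimes>\<^bsub>FG n\<^esub> r \<otimes>\<^bsub>FG n\<^esub> inv\<^bsub>FG n\<^esub> g" using Rel_FG by auto
  have "k \<otimes>\<^bsub>FG n\<^esub> h \<otimes>\<^bsub>FG n\<^esub> inv\<^bsub>FG n\<^esub> k = (k \<otimes>\<^bsub>FG n\<^esub> g) \<otimes>\<^bsub>FG n\<^esub> r \<otimes>\<^bsub>FG n\<^esub> inv\<^bsub>FG n\<^esub> (k \<otimes>\<^bsub>FG n\<^esub> g)"
    using g k by (simp add: F.m_assoc F.inv_mult_group)
  moreover have "k \<otimes>\<^bsub>FG n\<^esub> g \<in> carrier (FG n)" using g k by simp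
  ultimately show "k \<otimes>\<^bsub>FG n\<^esub> h \<otimes>\<^bsub>FG n\<^esub> inv\<^bsub>FG n\<^esub> k \<in> (\<Union>g\<in>carrier (FG n). (\<lambda>r. g \<otimes>\<^bsub>FG n\<^esub> r \<otimes>\<^bsub>FG n\<^esub> inv\<^bsub>FG n\<^esub> g) ` Rel n)"
    using g(2) by blast
qed (use Rel_FG in auto)

lemma Rel_N: "Rel n \<subseteq> N"
proof
  fix r assume r: "r \<in> Rel n"
  then have "r = \<one>\<^bsub>FG n\<^esub> \<otimes>\<^bsub>FG n\<^esub> r \<otimes>\<^bsub>FG n\<^esub> inv\<^bsub>FG n\<^esub> \<one>\<^bsub>FG n\<^esub>" using Rel_FG by auto
  then have "r \<in> (\<Union>g\<in>carrier (FG n). (\<lambda>r. g \<otimes>\<^bsub>FG n\<^esub> r \<otimes>\<^bsub>FG n\<^esub> inv\<^bsub>FG n\<^esub> g) ` Rel n)"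
    using r by blast
  then show "r \<in> N" unfolding normal_closure_def by (rule generate.incl)
qed

interpretation P: group "Pres n"
  unfolding Pres_def by (rule normal.factorgroup_is_group[OF N_normal])

interpretation ev: group_hom "FG n" "AutF n" "evalP n"
proof (unfold_locales, rule homI)
  show "evalP n u \<in> carrier (AutF n)" if "u \<in> carrier (FG n)" for u
    using that evalP_closed[OF n2] by (simp add: carrier_FG gw_def)
  show "evalP n (u \<otimes>\<^bsub>FG n\<^esub> v) = evalP n u \<otimes>\<^bsub>AutF n\<^esub> evalP n v"
    if "u \<in> carrier (FG n)" "v \<in> carrier (FG n)" for u v
    using that evalP_norm[OF n2, of "u @ v"] evalP_append[OF n2, of u v]
    by (simp add: FG_mult carrier_FG gw_def)
qed

lemma evalP_N: "r \<in> N \<Longrightarrow> evalP n r = \<one>\<^bsub>AutF n\<^esub>"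
proof -
  have "(\<Union>g\<in>carrier (FG n). (\<lambda>r. g \<otimes>\<^bsub>FG n\<^esub> r \<otimes>\<^bsub>FG n\<^esub> inv\<^bsub>FG n\<^esub> g) ` Rel n) \<subseteq> kernel (FG n) (AutF n) (evalP n)"
  proof
    fix h assume "h \<in> (\<Union>g\<in>carrier (FG n). (\<lambda>r. g \<otimes>\<^bsub>FG n\<^esub> r \<otimes>\<^bsub>FG n\<^esub> inv\<^bsub>FG n\<^esub> g) ` Rel n)"
    then obtain g r where g: "g \<in> carrier (FG n)" "r \<in> Rel n" "r \<in> carrier (FG n)"
      "h = g \<otimes>\<^bsub>FG n\<^esub> r \<otimes>\<^bsub>FG n\<^esub> inv\<^bsub>FG n\<^esub> g" using Rel_FG by auto
    then show "h \<in> kernel (FG n) (AutF n) (evalP n)"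
      using Rel_cases[OF n4 g(2)] by (simp add: kernel_def)
  qed
  then have "N \<subseteq> kernel (FG n) (AutF n) (evalP n)"
    unfolding normal_closure_def by (rule F.generate_subgroup_incl) (rule ev.subgroup_kernel)
  then show "r \<in> N \<Longrightarrow> evalP n r = \<one>\<^bsub>AutF n\<^esub>" by (auto simp: kernel_def)
qed

lemma qc_closed: "gw n u \<Longrightarrow> qc n u \<in> carrier (Pres n)"
  unfolding qc_def Pres_def carrier_FactGroup by (rule imageI) (rule norm_FG)

lemma qc_mult: "gw n u \<Longrightarrow> gw n v \<Longrightarrow> qc n u \<otimes>\<^bsub>Pres n\<^esub> qc n v = qc n (u @ v)"
  using hom_mult[OF normal.r_coset_hom_Mod[OF N_normal] norm_FG norm_FG, of u v]
  by (simp add: qc_def Pres_def FG_mult)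

lemma qc_norm: "norm u = norm v \<Longrightarrow> qc n u = qc n v"
  by (simp add: qc_def)

lemma qc_Nil: "qc n [] = \<one>\<^bsub>Pres n\<^esub>"
proof -
  have "qc n [] \<otimes>\<^bsub>Pres n\<^esub> qc n [] = qc n []" by (simp add: qc_mult)
  then show ?thesis using P.l_cancel_one[of "qc n []" "qc n []"] qc_closed[of "[]"] by simp
qed

lemma qc_surj: "v \<in> carrier (Pres n) \<Longrightarrow> \<exists>u. gw n u \<and> v = qc n u"
  unfolding Pres_def carrier_FactGroup by (auto simp: carrier_FG qc_def)

lemma qc_N: "gw n u \<Longrightarrow> norm u \<in> N \<Longrightarrow> qc n u = \<one>\<^bsub>Pres n\<^esub>"
  using F.coset_join2[OF norm_FG _ , of u N] N_normal
  by (simp add: qc_def Pres_def normal_def)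

text \<open>The choice of a representative is harmless: representatives differ by an element of the
  normal closure, which evaluates to the identity.\<close>

lemma pres_map_qc:
  assumes "gw n u" shows "pres_map n (qc n u) = evalP n u"
proof -
  have u: "norm u \<in> carrier (FG n)" by (rule norm_FG[OF assms])
  have sub: "subgroup N (FG n)" using N_normal by (simp add: normal_def)
  have "norm u \<in> qc n u" unfolding qc_def by (rule F.rcos_self[OF u sub])
  then have "(SOME v. v \<in> qc n u) \<in> qc n u" by (rule someI)
  then obtain m where m: "m \<in> N" "(SOME v. v \<in> qc n u) = m \<otimes>\<^bsub>FG n\<^esub> norm u"
    unfolding qc_def r_coset_def by auto
  have "m \<in> carrier (FG n)" using m(1) subgroup.subset[OF sub] by blast
  then have "pres_map n (qc n u) = evalP n m \<otimes>\<^bsub>AutF n\<^esub> evalP n (norm u)"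
    unfolding pres_map_def m(2) using u by simp
  then show ?thesis
    using evalP_N[OF m(1)] u evalP_norm[OF n2] assms by (simp add: gw_def flip: evalP_norm[OF n2])
qed

lemma pres_map_closed: "v \<in> carrier (Pres n) \<Longrightarrow> pres_map n v \<in> carrier (AutF n)"
  using qc_surj pres_map_qc evalP_closed[OF n2] by (metis gw_def)

lemma pres_map_mult: "v \<in> carrier (Pres n) \<Longrightarrow> v' \<in> carrier (Pres n) \<Longrightarrow>
    pres_map n (v \<otimes>\<^bsub>Pres n\<^esub> v') = pres_map n v \<otimes>\<^bsub>AutF n\<^esub> pres_map n v'"
proof -
  assume "v \<in> carrier (Pres n)" "v' \<in> carrier (Pres n)"
  then obtain x y where "gw n x" "gw n y" "v = qc n x" "v' = qc n y" using qc_surj by blast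
  then show ?thesis by (simp add: qc_mult pres_map_qc evalP_append[OF n2] gw_def[symmetric])
qed

lemma pres_map_hom: "pres_map n \<in> hom (Pres n) (AutF n)"
  by (rule homI) (simp_all add: pres_map_closed pres_map_mult)

lemma ga_qc: "g \<in> Gens n \<Longrightarrow> gw n u \<Longrightarrow> ga n g (qc n u) = qc n ((g, False) # u)"
  using qc_mult[of "[(g, False)]" u] by (simp add: ga_def La_def qc_closed)

lemma chain_qc: "set gs \<subseteq> Gens n \<Longrightarrow> gw n u \<Longrightarrow> chain n gs (qc n u) = qc n (map (\<lambda>g. (g, False)) gs @ u)"
  by (induction gs) (simp_all add: ga_qc gw_map)

lemma chain_out: "v \<notin> carrier (Pres n) \<Longrightarrow> chain n gs v = v"
  by (induction gs) (simp_all add: ga_def La_def)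

lemma chain_eq:
  assumes "set gs \<subseteq> Gens n" "set hs \<subseteq> Gens n"
    and "qc n (map (\<lambda>g. (g, False)) gs) = qc n (map (\<lambda>g. (g, False)) hs)"
  shows "chain n gs = chain n hs"
proof
  fix v
  show "chain n gs v = chain n hs v"
  proof (cases "v \<in> carrier (Pres n)")
    case True
    then obtain u where u: "gw n u" "v = qc n u" using qc_surj by blast
    show ?thesis using assms u by (simp add: chain_qc gw_map flip: qc_mult)
  qed (simp add: chain_out)
qed

lemma chain_Rel:
  assumes "set gs \<subseteq> Gens n" "pw gs \<in> Rel n" shows "chain n gs = id"
proof -
  have "norm (map (\<lambda>g. (g, False)) gs) \<in> N" using assms(2) Rel_N by (auto simp: pw_def)
  then have "qc n (map (\<lambda>g. (g, False)) gs) = qc n (map (\<lambda>g. (g, False)) [])"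
    using qc_N[OF gw_map[OF assms(1)]] by (simp add: qc_Nil)
  then have "chain n gs = chain n []" by (intro chain_eq assms(1)) auto
  then show ?thesis by simp
qed

lemma Gens_Wm [simp]: "f \<in> SP n \<Longrightarrow> Some (Wm n f) \<in> Gens n" and Gens_None [simp]: "None \<in> Gens n"
  by (auto simp: Gens_def W_eq)

abbreviation io :: "(nat \<times> bool \<Rightarrow> nat \<times> bool) \<Rightarrow> gsym word set \<Rightarrow> gsym word set" where
  "io f \<equiv> ga n (Some (Wm n f))"

abbreviation et :: "gsym word set \<Rightarrow> gsym word set" where
  "et \<equiv> ga n None"

abbreviation tu :: "gsym word set \<Rightarrow> nat \<Rightarrow> nat word" where
  "tu v i \<equiv> pres_map n v (gen i)"

text \<open>The relators of W_n, freed from the requirement that the word be reduced.\<close>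

lemma W_relator:
  assumes "gw n u" "set u \<subseteq> Some ` W n \<times> UNIV" "evalP n u = \<one>\<^bsub>AutF n\<^esub>"
  shows "qc n u = \<one>\<^bsub>Pres n\<^esub>"
proof -
  have "norm u \<in> Rel n"
    using assms set_norm[of u] norm_FG[OF assms(1)] evalP_norm[OF n2, of u]
    unfolding Rel_def by (auto simp: gw_def)
  then show ?thesis using qc_N[OF assms(1)] Rel_N by blast
qed

lemma io_comp: "f \<in> SP n \<Longrightarrow> g \<in> SP n \<Longrightarrow> io f \<circ> io g = io (f \<circ> g)"
proof -
  assume f: "f \<in> SP n" and g: "g \<in> SP n"
  let ?f = "(Some (Wm n f), False) :: gsym \<times> bool" and ?g = "(Some (Wm n g), False) :: gsym \<times> bool"
    and ?h = "(Some (Wm n (f \<circ> g)), False) :: gsym \<times> bool" and ?h' = "(Some (Wm n (f \<circ> g)), True) :: gsym \<times> bool"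
  have gw: "gw n [?f, ?g]" "gw n [?h]" "gw n [?h']" "gw n [?f, ?g, ?h']" using f g SP_comp by auto
  \<comment> \<open>The multiplication table of W_n enters through the relator made of
    \<open>?f\<close>, \<open>?g\<close> and the inverse of \<open>?h\<close>.\<close>
  have "evalP n [?f, ?g, ?h'] = \<one>\<^bsub>AutF n\<^esub>"
    using f g Wm_AutF[of _ n] SP_comp[OF f g] Wm_mult[OF f g]
    by (simp add: evalP_Cons gval_def flip: A.m_assoc)
  moreover have "set [?f, ?g, ?h'] \<subseteq> Some ` W n \<times> UNIV" using f g SP_comp by (auto simp: W_eq)
  ultimately have "qc n [?f, ?g, ?h'] = \<one>\<^bsub>Pres n\<^esub>" using gw by (intro W_relator)
  then have "qc n [?h] = qc n [?f, ?g, ?h'] \<otimes>\<^bsub>Pres n\<^esub> qc n [?h]" using gw qc_closed by simp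
  also have "\<dots> = qc n ([?f, ?g] @ ?h' # inv_letter ?h' # [])" using gw by (simp add: qc_mult)
  also have "\<dots> = qc n [?f, ?g]" by (rule qc_norm) (use norm_cancel_mid[of "[?f, ?g]" ?h' "[]"] in simp)
  finally have "chain n [Some (Wm n f), Some (Wm n g)] = chain n [Some (Wm n (f \<circ> g))]"
    using f g SP_comp[OF f g] by (intro chain_eq) auto
  then show ?thesis by (simp only: chain.simps comp_id)
qed

lemma io_id: "io id = id"
proof -
  have "evalP n [(Some (Wm n id), False)] = \<one>\<^bsub>AutF n\<^esub>"
    using Wm_id Wm_AutF[OF SP_id, of n] by (simp add: evalP_Cons gval_def)
  moreover have "gw n [(Some (Wm n id), False)]" using Gens_Wm[OF SP_id] by simp
  moreover have "set [(Some (Wm n id), False)] \<subseteq> Some ` W n \<times> UNIV"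
    using SP_id[of n] unfolding W_eq by simp
  ultimately have "qc n [(Some (Wm n id), False)] = qc n []" by (simp only: qc_Nil W_relator)
  then have "chain n [Some (Wm n id)] = chain n []"
    using Gens_Wm[OF SP_id] by (intro chain_eq) auto
  then show ?thesis by (simp only: chain.simps comp_id)
qed

lemma tu_ga:
  assumes "g \<in> Gens n" "v \<in> carrier (Pres n)" "i \<in> {1..n}"
  shows "tu (ga n g v) i = gval n g (tu v i)"
proof -
  obtain u where u: "gw n u" "v = qc n u" using qc_surj assms by blast
  have "pres_map n (ga n g v) = gval n g \<otimes>\<^bsub>AutF n\<^esub> evalP n u"
    using u assms by (simp add: ga_qc pres_map_qc evalP_Cons)
  then show ?thesis
    using u gval_AutF[OF n2 assms(1)] evalP_closed[OF n2, of u] gen_Fn[OF assms(3)]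
    by (simp add: pres_map_qc AutF_mult gw_def)
qed

lemma ga_closed: "g \<in> Gens n \<Longrightarrow> v \<in> carrier (Pres n) \<Longrightarrow> ga n g v \<in> carrier (Pres n)"
  using qc_surj ga_qc qc_closed by (metis gw_simps(2))

lemma pres_map_one: "pres_map n \<one>\<^bsub>Pres n\<^esub> = \<one>\<^bsub>AutF n\<^esub>"
  using pres_map_qc[of "[]"] by (simp add: qc_Nil)

lemma tu_Fn: "v \<in> carrier (Pres n) \<Longrightarrow> i \<in> {1..n} \<Longrightarrow> tu v i \<in> carrier (Fn n)"
  using AutF_closed[OF pres_map_closed gen_Fn] .

lemma AutF_nonempty: "\<phi> \<in> carrier (AutF n) \<Longrightarrow> i \<in> {1..n} \<Longrightarrow> \<phi> (gen i) \<noteq> []"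
proof
  assume p: "\<phi> \<in> carrier (AutF n)" and i: "i \<in> {1..n}" and "\<phi> (gen i) = []"
  then have "\<phi> (gen i) = \<phi> []" using AutF_Nil[OF p] by simp
  then have "gen i = []" using p gen_Fn[OF i] Nil_Fn by (auto simp: AutF_carrier bij_betw_def inj_on_def)
  then show False by (simp add: gen_def)
qed

text \<open>The regular representation: group elements are replaced by left multiplications,
  composed as functions and acting on the group itself, with the identity element as base
  point.\<close>

lemma pres_acting: "based_acting n (\<circ>) id io et (\<lambda>m v. m v) tu (carrier (Pres n)) \<one>\<^bsub>Pres n\<^esub>"
proof
  have tau: "Some (tau n i) = Some (Wm n (tauL i))" and sigma: "Some (sigma n i j) = Some (Wm n (sigmaL i j))" for i j
    by (simp_all add: tau_Wm sigma_Wm)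
  have rep: "replicate 2 x = [x, x]" "replicate 3 x = [x, x, x]" "replicate 4 x = [x, x, x, x]" for x :: 'z
    by (simp_all add: eval_nat_numeral)
  have G: "Some (Wm n (sw (i, b) (j, c))) \<in> Gens n" if "i \<in> {1..n}" "j \<in> {1..n}" for i j b c
    using that by (intro Gens_Wm sw_SP) (auto simp: letters_def)
  let ?S = "\<lambda>i j. Some (Wm n (sigmaL i j)) :: gsym" and ?T = "\<lambda>i. Some (Wm n (tauL i)) :: gsym"
  show "4 \<le> n" by (rule n4)
  show "(a \<circ> b) \<circ> c = a \<circ> (b \<circ> c)" for a b c :: "gsym word set \<Rightarrow> gsym word set" by (rule comp_assoc)
  show "id \<circ> a = a" "a \<circ> id = a" for a :: "gsym word set \<Rightarrow> gsym word set" by (rule id_comp comp_id)+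
  show "io f \<circ> io g = io (f \<circ> g)" if "f \<in> SP n" "g \<in> SP n" for f g by (rule io_comp[OF that])
  show "io id = id" by (rule io_id)
  have 1: "chain n [None, None] = id"
    by (rule chain_Rel) (simp, simp add: Rel_def)
  have "ppow [?S 1 2, None] 3 \<in> Rel n" by (simp add: Rel_def sigma_Wm)
  then have 2: "chain n [?S 1 2, None, ?S 1 2, None, ?S 1 2, None] = id"
    using G n4 by (intro chain_Rel) (auto simp: ppow_def rep)
  have 3: "chain n [None, ?T i, None, ?T i] = id" if i: "2 < i" "i \<le> n" for i
  proof -
    have "ppow [None, ?T i] 2 \<in> Rel n" using i by (auto simp: Rel_def tau_Wm)
    then show ?thesis using G i by (intro chain_Rel) (auto simp: ppow_def rep)
  qed
  have 4: "chain n [None, ?S i j, None, ?S i j] = id"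
    if i: "2 < i" "i \<le> n" "2 < j" "j \<le> n" "i \<noteq> j" for i j
  proof -
    have "ppow [None, ?S i j] 2 \<in> Rel n" using i unfolding Rel_def sigma_Wm by blast
    then show ?thesis using G i by (intro chain_Rel) (auto simp: ppow_def rep)
  qed
  have "ppow (concat (replicate 2 [None, ?T 1]) @ [?T 2]) 2 \<in> Rel n" by (simp add: Rel_def tau_Wm)
  then have 5: "chain n [None, ?T 1, None, ?T 1, ?T 2, None, ?T 1, None, ?T 1, ?T 2] = id"
    using G n4 by (intro chain_Rel) (auto simp: ppow_def rep)
  have "pw ([?S 1 2, None, ?S 1 3, ?T 2, None, ?S 1 2] @ concat (replicate 2 [?S 2 3, None, ?S 1 3, ?T 2, None])) \<in> Rel n"
    by (simp add: Rel_def tau_Wm sigma_Wm)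
  then have 7: "chain n [?S 1 2, None, ?S 1 3, ?T 2, None, ?S 1 2, ?S 2 3, None, ?S 1 3, ?T 2, None, ?S 2 3, None, ?S 1 3, ?T 2, None] = id"
    using G n4 by (intro chain_Rel) (auto simp: rep)
  have "ppow [?S 1 4, ?S 2 3, None] 4 \<in> Rel n" by (simp add: Rel_def sigma_Wm)
  then have 8: "chain n [?S 1 4, ?S 2 3, None, ?S 1 4, ?S 2 3, None, ?S 1 4, ?S 2 3, None, ?S 1 4, ?S 2 3, None] = id"
    using G n4 by (intro chain_Rel) (auto simp: ppow_def rep)
  note c = chain.simps comp_id
  show "et \<circ> et = id" using 1 by (simp only: c)
  show "io (sigmaL 1 2) \<circ> (et \<circ> (io (sigmaL 1 2) \<circ> (et \<circ> (io (sigmaL 1 2) \<circ> et)))) = id" using 2 by (simp only: c)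
  show "et \<circ> (io (tauL i) \<circ> (et \<circ> io (tauL i))) = id" if "2 < i" "i \<le> n" for i using 3[OF that] by (simp only: c)
  show "et \<circ> (io (sigmaL i j) \<circ> (et \<circ> io (sigmaL i j))) = id" if "2 < i" "i \<le> n" "2 < j" "j \<le> n" "i \<noteq> j" for i j
    using 4[OF that] by (simp only: c)
  show "et \<circ> (io (tauL 1) \<circ> (et \<circ> (io (tauL 1) \<circ> (io (tauL 2) \<circ> (et \<circ> (io (tauL 1) \<circ> (et \<circ> (io (tauL 1) \<circ> io (tauL 2))))))))) = id"
    using 5 by (simp only: c)
  show "io (sigmaL 1 2) \<circ> (et \<circ> (io (sigmaL 1 3) \<circ> (io (tauL 2) \<circ> (et \<circ> (io (sigmaL 1 2) \<circ> (io (sigmaL 2 3) \<circ> (et \<circ> (io (sigmaL 1 3) \<circ>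
     (io (tauL 2) \<circ> (et \<circ> (io (sigmaL 2 3) \<circ> (et \<circ> (io (sigmaL 1 3) \<circ> (io (tauL 2) \<circ> et)))))))))))))) = id"
    using 7 by (simp only: c)
  show "io (sigmaL 1 4) \<circ> (io (sigmaL 2 3) \<circ> (et \<circ> (io (sigmaL 1 4) \<circ> (io (sigmaL 2 3) \<circ> (et \<circ> (io (sigmaL 1 4) \<circ> (io (sigmaL 2 3) \<circ>
     (et \<circ> (io (sigmaL 1 4) \<circ> (io (sigmaL 2 3) \<circ> et)))))))))) = id"
    using 8 by (simp only: c)
  show "(a \<circ> b) v = a (b v)" for a b :: "gsym word set \<Rightarrow> gsym word set" and v by simp
  show "id v = v" for v :: "gsym word set" by simp
  show "io f v \<in> carrier (Pres n)" if "f \<in> SP n" "v \<in> carrier (Pres n)" for f v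
    using that by (simp add: ga_closed)
  show "et v \<in> carrier (Pres n)" if "v \<in> carrier (Pres n)" for v
    using that by (simp add: ga_closed)
  show "reduced (tu v i)" if "v \<in> carrier (Pres n)" "i \<in> {1..n}" for v i
    using tu_Fn[OF that] by (simp add: carrier_Fn)
  show "tu v i \<noteq> []" if "v \<in> carrier (Pres n)" "i \<in> {1..n}" for v i
    using AutF_nonempty[OF pres_map_closed] that by blast
  show "tu (io f v) i = map f (tu v i)" if "f \<in> SP n" "v \<in> carrier (Pres n)" "i \<in> {1..n}" for f v i
    using tu_ga[of "Some (Wm n f)" v i] that Wm_app[OF that(1) tu_Fn[OF that(2,3)]] by (simp add: gval_def)
  show "tu (et v) i = wsubst (lm {(1, True), (2, False)} (2, False)) (map (tauL 2) (tu v i))"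
    if "v \<in> carrier (Pres n)" "i \<in> {1..n}" for v i
    using tu_ga[of None v i] that endo_app[OF tu_Fn[OF that], of etal]
    by (simp add: gval_def eta_endo wsubst_map etal_def[abs_def])
  show "\<one>\<^bsub>Pres n\<^esub> \<in> carrier (Pres n)" by simp
  show "tu \<one>\<^bsub>Pres n\<^esub> i = [(i, False)]" if "i \<in> {1..n}" for i
    using AutF_one[OF gen_Fn[OF that]] by (simp add: pres_map_one gen_def)
qed

interpretation B: based_acting n "(\<circ>)" id io et "\<lambda>m v. m v" tu "carrier (Pres n)" "\<one>\<^bsub>Pres n\<^esub>"
  by (rule pres_acting)

lemma qc_cancel: "g \<in> Gens n \<Longrightarrow> gw n u \<Longrightarrow> ga n g (qc n ((g, True) # u)) = qc n u"
  using ga_qc[of g "(g, True) # u"] qc_norm[of "(g, False) # (g, True) # u" u] norm_cancel[of "(g, False)" u]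
  by simp

text \<open>Every element is a product of generators and their inverses. The inverse of a signed
  permutation acts as the generator for \<open>pinv f\<close>, and \<eta> is an involution, so
  closure under the generators is enough.\<close>

lemma carrier_D: "v \<in> carrier (Pres n) \<Longrightarrow> v \<in> B.D"
proof -
  define D where "D = B.D"
  note D_base = B.D.base[folded D_def] and D_iota = B.D_iota[folded D_def] and D_eta = B.D_eta[folded D_def]
  have "gw n u \<Longrightarrow> qc n u \<in> D" for u
  proof (induction u)
    case Nil
    have "io id \<one>\<^bsub>Pres n\<^esub> = \<one>\<^bsub>Pres n\<^esub>" by (rule trans[OF fun_cong[OF io_id] id_apply])
    then show ?case using D_base[OF SP_id] unfolding qc_Nil by (simp only:)
  next
    case (Cons l u)
    obtain g b where l: "l = (g, b)" by (cases l)
    have g: "g \<in> Gens n" "gw n u" using Cons.prems l by auto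
    then have IH: "qc n u \<in> D" using Cons.IH by simp
    consider (W) f where "f \<in> SP n" "g = Some (Wm n f)" | (eta) "g = None"
      using g(1) by (auto simp: Gens_def W_eq)
    then show ?case
    proof cases
      case W
      have F: "qc n ((g, False) # u) \<in> D" using D_iota[OF IH W(1)] ga_qc[OF g] W by simp
      have "io (pinv f) (io f (qc n ((g, True) # u))) = qc n ((g, True) # u)"
        using B.comp_eq_app[OF B.iota_cancel(2)[OF W(1)]] by simp
      then have "qc n ((g, True) # u) = io (pinv f) (qc n u)" using qc_cancel[OF g] W by simp
      then have "qc n ((g, True) # u) \<in> D" using D_iota[OF IH SP_pinv[OF W(1)]] by simp
      then show ?thesis using F l by (cases b) auto
    next
      case eta
      have F: "qc n ((g, False) # u) \<in> D" using D_eta[OF IH] ga_qc[OF g] eta by simp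
      have "et (et (qc n ((g, True) # u))) = qc n ((g, True) # u)"
        using B.comp_eq_app[OF B.rel1] by simp
      then have "qc n ((g, True) # u) = et (qc n u)" using qc_cancel[OF g] eta by simp
      then have "qc n ((g, True) # u) \<in> D" using D_eta[OF IH] by simp
      then show ?thesis using F l by (cases b) auto
    qed
  qed
  then show "v \<in> carrier (Pres n) \<Longrightarrow> v \<in> B.D" using qc_surj unfolding D_def by blast
qed

section \<open>Injectivity\<close>

lemma pres_map_kernel:
  assumes "v \<in> carrier (Pres n)" "pres_map n v = \<one>\<^bsub>AutF n\<^esub>" shows "v = \<one>\<^bsub>Pres n\<^esub>"
proof -
  have tv: "tu v i = [(i, False)]" if "i \<in> {1..n}" for i
    using AutF_one[OF gen_Fn[OF that]] assms(2) by (simp add: gen_def)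
  then have "B.len v = n" by (simp add: B.len_def tlen_def)
  then obtain f where f: "f \<in> SP n" "v = io f \<one>\<^bsub>Pres n\<^esub>" using B.D_len_n carrier_D assms(1) by blast
  have "f (i, False) = id (i, False)" if i: "i \<in> {1..n}" for i
    using B.tup_iota[OF f(1) P.one_closed i] B.tup_v0[OF i] tv[OF i] f(2) by simp
  then have "f = id" using f(1) SP_id by (intro SP_ext)
  then show ?thesis using f(2) by (simp add: io_id)
qed

lemma pres_map_inj: "inj_on (pres_map n) (carrier (Pres n))"
proof -
  interpret h: group_hom "Pres n" "AutF n" "pres_map n"
    by unfold_locales (rule pres_map_hom)
  show ?thesis using pres_map_kernel by (intro h.inj_on_one_iff[THEN iffD2]) auto
qed

section \<open>Surjectivity and generation\<close>

lemma AutF_generating: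
  assumes p: "\<phi> \<in> carrier (AutF n)"
  shows "generating_tuple n (\<lambda>i. \<phi> (gen i))"
proof
  show "reduced (\<phi> (gen i))" "set (\<phi> (gen i)) \<subseteq> letters n" if "i \<in> {1..n}" for i
    using AutF_closed[OF p gen_Fn[OF that]] by (auto simp: carrier_Fn)
  show "\<phi> (gen i) \<noteq> []" if "i \<in> {1..n}" for i by (rule AutF_nonempty[OF p that])
  show "\<exists>v. set v \<subseteq> letters n \<and> norm (concat (map (\<lambda>(i, b). if b then inv_word (\<phi> (gen i)) else \<phi> (gen i)) v)) = [(j, False)]"
    if j: "j \<in> {1..n}" for j
  proof -
    have "gen j \<in> \<phi> ` carrier (Fn n)" using p gen_Fn[OF j] by (simp add: AutF_carrier bij_betw_def)
    then obtain v where "v \<in> carrier (Fn n)" "\<phi> v = gen j" by auto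
    then show ?thesis using AutF_wsubst[OF p, of v]
      by (intro exI[of _ v]) (simp add: carrier_Fn wsubst_def lift_def gen_def[of j])
  qed
qed

text \<open>At this length every image is a single letter, and the indices form a permutation
  because every generator has to occur.\<close>

lemma AutF_short_W:
  assumes p: "\<phi> \<in> carrier (AutF n)" and len: "tlen n (\<lambda>i. \<phi> (gen i)) \<le> n"
  shows "\<phi> \<in> W n"
proof -
  interpret T: generating_tuple n "\<lambda>i. \<phi> (gen i)" by (rule AutF_generating[OF p])
  have ge: "1 \<le> length (\<phi> (gen i))" if "i \<in> {1..n}" for i
    using T.nonempty_w[OF that] by (simp add: Suc_leI)
  have le: "length (\<phi> (gen i)) \<le> 1" if i: "i \<in> {1..n}" for i
  proof (rule ccontr)
    assume "\<not> ?thesis"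
    then have "(\<Sum>i=1..n. 1) < (\<Sum>i=1..n. length (\<phi> (gen i)))"
      using i ge by (intro sum_strict_mono_ex1) (auto simp: not_le)
    then show False using len by (simp add: tlen_def)
  qed
  have single: "\<phi> (gen i) = [hd (\<phi> (gen i))]" if "i \<in> {1..n}" for i
    using ge[OF that] le[OF that] by (cases "\<phi> (gen i)") auto
  define \<pi> where "\<pi> i = fst (hd (\<phi> (gen i)))" for i
  define \<epsilon> where "\<epsilon> i = snd (hd (\<phi> (gen i)))" for i
  have img: "\<phi> (gen i) = [(\<pi> i, \<epsilon> i)]" if "i \<in> {1..n}" for i
    using single[OF that] by (simp add: \<pi>_def \<epsilon>_def)
  have "\<pi> ` {1..n} \<subseteq> {1..n}"
    using T.letters_w img by (fastforce simp: letters_def)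
  moreover have "{1..n} \<subseteq> \<pi> ` {1..n}"
  proof
    fix j assume j: "j \<in> {1..n}"
    obtain i b where "i \<in> {1..n}" "(j, b) \<in> set (\<phi> (gen i))" using T.letter_occurs[OF j] by blast
    then show "j \<in> \<pi> ` {1..n}" using img by auto
  qed
  ultimately have "\<pi> ` {1..n} = {1..n}" by blast
  then have "bij_betw \<pi> {1..n} {1..n}" by (simp add: bij_betw_def eq_card_imp_inj_on)
  then show ?thesis using p img by (auto simp: W_def)
qed

lemma pres_map_surj: "\<phi> \<in> carrier (AutF n) \<Longrightarrow> \<phi> \<in> pres_map n ` carrier (Pres n)"
proof (induction "tlen n (\<lambda>i. \<phi> (gen i))" arbitrary: \<phi> rule: less_induct)
  case less
  note p = less.prems
  show ?case
  proof (cases "n < tlen n (\<lambda>i. \<phi> (gen i))")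
    case False
    then obtain f where f: "f \<in> SP n" "\<phi> = Wm n f" using AutF_short_W[OF p] by (auto simp: W_eq)
    have "gw n [(Some (Wm n f), False)]" using f by simp
    then have "pres_map n (qc n [(Some (Wm n f), False)]) = \<phi>"
      using f Wm_AutF[OF f(1)] by (simp add: pres_map_qc evalP_Cons gval_def)
    then show ?thesis using qc_closed \<open>gw n [_]\<close> by (metis imageI)
  next
    case True
    interpret T: generating_tuple n "\<lambda>i. \<phi> (gen i)" by (rule AutF_generating[OF p])
    obtain A a where A: "A \<subseteq> letters n" "a \<in> A" "inv_letter a \<notin> A"
      "tcap n A (\<lambda>i. \<phi> (gen i)) < tdeg n a (\<lambda>i. \<phi> (gen i))"
      using T.exists_reducing[OF True] .
    have vA: "B.valid A a" using A by (simp add: B.valid_def)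
    \<comment> \<open>A preimage of the Whitehead automorphism \<open>(A, a)\<close>: its lift
      applied to the identity element.\<close>
    define x where "x = B.Wh A a \<one>\<^bsub>Pres n\<^esub>"
    have x: "x \<in> carrier (Pres n)" unfolding x_def using B.Wh_V[OF vA P.one_closed] .
    have xg: "tu x i = wsubst (lm A a) [(i, False)]" if i: "i \<in> {1..n}" for i
      using B.tup_Wh[OF vA P.one_closed i] B.tup_v0[OF i] wsubst_lm[OF A(2,3), of "[(i, False)]"]
      by (simp add: x_def tmv_def)
    have xw: "pres_map n x u = wsubst (lm A a) u" if u: "u \<in> carrier (Fn n)" for u
    proof -
      have "lift (tu x) l = norm (lm A a l)" if l: "l \<in> letters n" for l
      proof (cases l)
        case (Pair i b)
        have i: "i \<in> {1..n}" using l Pair by (simp add: letters_def)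
        have "lm A a (i, True) = inv_word (lm A a (i, False))"
          using inv_compat_lm[of A a] unfolding inv_compat_def by (metis inv_letter_Pair)
        then show ?thesis using xg[OF i] Pair
          by (cases b) (simp_all add: lift_def wsubst_def inv_word_norm)
      qed
      then have "wsubst (lift (tu x)) u = wsubst (\<lambda>l. norm (lm A a l)) u"
        using u by (intro wsubst_cong) (auto simp: carrier_Fn)
      then show ?thesis using AutF_wsubst[OF pres_map_closed[OF x] u] by (simp add: wsubst_norm_fun)
    qed
    \<comment> \<open>Composition from the left applies \<open>(A, a)\<close> to the images of the
      generators, which shortens the tuple; afterwards the factor is cancelled inside the image of
      \<open>pres_map n\<close>.\<close>
    let ?\<psi> = "pres_map n x \<otimes>\<^bsub>AutF n\<^esub> \<phi>"
    have psi: "?\<psi> \<in> carrier (AutF n)" using p pres_map_closed[OF x] by simp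
    have "?\<psi> (gen i) = tmv A a (\<lambda>i. \<phi> (gen i)) i" if i: "i \<in> {1..n}" for i
      using AutF_mult[OF pres_map_closed[OF x] p gen_Fn[OF i]] xw[OF AutF_closed[OF p gen_Fn[OF i]]]
        wsubst_lm[OF A(2,3) T.reduced_w[OF i]] by (simp add: tmv_def)
    then have "tlen n (\<lambda>i. ?\<psi> (gen i)) = tlen n (tmv A a (\<lambda>i. \<phi> (gen i)))"
      by (simp add: tlen_def)
    then have "tlen n (\<lambda>i. ?\<psi> (gen i)) < tlen n (\<lambda>i. \<phi> (gen i))"
      using tlen_tmv[of n A a "\<lambda>i. \<phi> (gen i)"] A(4) by linarith
    then obtain v where v: "v \<in> carrier (Pres n)" "?\<psi> = pres_map n v" using less.hyps[OF _ psi] by auto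
    interpret h: group_hom "Pres n" "AutF n" "pres_map n"
      by unfold_locales (rule pres_map_hom)
    have "\<phi> = inv\<^bsub>AutF n\<^esub> (pres_map n x) \<otimes>\<^bsub>AutF n\<^esub> ?\<psi>"
      using p pres_map_closed[OF x] by (simp flip: A.m_assoc)
    also have "\<dots> = pres_map n (inv\<^bsub>Pres n\<^esub> x \<otimes>\<^bsub>Pres n\<^esub> v)" using x v by simp
    finally show ?thesis using x v by blast
  qed
qed

lemma pres_map_iso: "pres_map n \<in> iso (Pres n) (AutF n)"
  using pres_map_hom pres_map_inj pres_map_closed pres_map_surj
  by (auto simp: iso_def bij_betw_def)

lemma evalP_generate: "gw n u \<Longrightarrow> evalP n u \<in> generate (AutF n) (W n \<union> {eta n})"
proof (induction u)
  case (Cons l u)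
  obtain g b where l: "l = (g, b)" by (cases l)
  have "gval n g \<in> W n \<union> {eta n}" using Cons.prems l by (auto simp: Gens_def gval_def)
  then show ?case using Cons
    by (auto simp: l evalP_Cons intro!: generate.eng intro: generate.inv generate.incl)
qed (simp add: generate.one)

lemma generate_AutF: "generate (AutF n) (W n \<union> {eta n}) = carrier (AutF n)"
proof
  have "W n \<union> {eta n} \<subseteq> carrier (AutF n)" using eta_AutF[OF n2] by (auto simp: W_def)
  then show "generate (AutF n) (W n \<union> {eta n}) \<subseteq> carrier (AutF n)" by (rule A.generate_incl)
  show "carrier (AutF n) \<subseteq> generate (AutF n) (W n \<union> {eta n})"
  proof
    fix \<phi> assume "\<phi> \<in> carrier (AutF n)"
    then obtain v where v: "v \<in> carrier (Pres n)" "\<phi> = pres_map n v" using pres_map_surj by blast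
    then obtain u where "gw n u" "v = qc n u" using qc_surj by blast
    then show "\<phi> \<in> generate (AutF n) (W n \<union> {eta n})" using evalP_generate pres_map_qc v(2) by simp
  qed
qed

end

theorem theorem1:
  fixes n :: nat
  assumes "4 \<le> n"
  shows "generate (AutF n) (W n \<union> {eta n}) = carrier (AutF n) \<and>
         pres_map n \<in> iso (Pres n) (AutF n)"
  using generate_AutF[OF assms] pres_map_iso[OF assms] by blast

end
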